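(* Let $1<p<\infty$. Let $H_1,H_2,\dots,H_n\subset\mathbb{C}$ be half planes such that $\mathcal{P}:=\bigcap_{k=1}^n H_k\neq\emptyset$ is a convex polygon. Then $$A^p(\mathcal{P})=\sum_{k=1}^n A^p(H_k).$$
   Context: For an open set $\Omega\subset\mathbb{C}$ and $1\le p<\infty$, the Bergman space $A^p(\Omega)$ consists of all holomorphic functions $f$ on $\Omega$ with $\int_\Omega |f(x+iy)|^p\,dx\,dy<+\infty$. Half planes are open half planes of $\mathbb{C}$ (bounded by arbitrary real lines); a convex polygon here is an open bounded convex polygonal region. The sum $\sum_{k=1}^n A^p(H_k)$ is the set of functions on $\mathcal{P}$ of the form $\sum_{k=1}^n f_k|_{\mathcal{P}}$ with $f_k\in A^p(H_k)$. *)

theory Defs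
  imports "HOL-Analysis.Analysis" "HOL-Library.FuncSet"
begin

definition half_plane :: "complex set \<Rightarrow> bool" where
  "half_plane H \<longleftrightarrow> (\<exists>a b. a \<noteq> 0 \<and> H = {z. a \<bullet> z < b})"

definition convex_polygon :: "complex set \<Rightarrow> bool" where
  "convex_polygon S \<longleftrightarrow> open S \<and> bounded S \<and> convex S \<and> polytope (closure S)"

(* A function on \<Omega> is an element of extensional \<Omega>, so that equality of members of A^p(\<Omega>) is
   equality on \<Omega>. The measure lborel on the type complex is dx dy. *)
definition bergman_space :: "real \<Rightarrow> complex set \<Rightarrow> (complex \<Rightarrow> complex) set" where
  "bergman_space p \<Omega> =
     {f \<in> extensional \<Omega>. f holomorphic_on \<Omega> \<and>
        set_integrable lborel \<Omega> (\<lambda>z. norm (f z) powr p)}"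

definition bergman_sum ::
    "real \<Rightarrow> 'i set \<Rightarrow> ('i \<Rightarrow> complex set) \<Rightarrow> (complex \<Rightarrow> complex) set" where
  "bergman_sum p I H =
     {restrict (\<lambda>z. \<Sum>k\<in>I. f k z) (\<Inter>k\<in>I. H k) | f. \<forall>k\<in>I. f k \<in> bergman_space p (H k)}"

end

theory Submission
  imports Defs "HOL-Complex_Analysis.Complex_Analysis"
begin

text \<open>
  Fix a point \<open>c\<close> of the polygon \<open>P\<close>. Cut \<open>P\<close> into triangles with apex \<open>c\<close> whose bases lie on the
  sides, and split \<open>f\<close> accordingly by Cauchy integrals over the legs \<open>[c, v]\<close> joining \<open>c\<close> to the
  vertices. The plain Cauchy kernel does not survive the singularity of \<open>f\<close> at \<open>v\<close>, so it is replaced by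
  \<open>1 / (t - z) + 1 / (t - (2 * v - z))\<close>: the reflected pole \<open>2 * v - z\<close> lies outside \<open>P\<close> when \<open>z\<close> is in
  a half plane bounded by a line through \<open>v\<close>, so the added term is harmless for Cauchy's theorem, while
  the sum vanishes at \<open>t = v\<close> and decays like \<open>1 / z^2\<close>. The resulting operator is
  dominated by a Hardy operator with kernel \<open>s / (s + \<bar>z - v\<bar>)^2\<close>, which is bounded on \<open>L^p\<close> of the plane exactly
  because \<open>p > 1\<close>.

  Replacing \<open>f t / (t - z)\<close> by \<open>(f t - f z) / (t - z)\<close> continues this integral across its leg, to \<open>N v z\<close> say. Hence
  for two boundary points \<open>v\<close>, \<open>w\<close> on the line bounding a half plane \<open>H\<close> the function
  \<open>f z * Ln ((w - z) / (v - z)) - N v z + N w z\<close> on \<open>P\<close> extends to a member of \<open>A^p(H)\<close>. Going once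
  around \<open>P\<close> the terms \<open>N\<close> cancel and the logarithms add up to \<open>2 * pi * \<i>\<close>.
\<close>

section \<open>Hardy's inequality and the mean value inequality\<close>

text \<open>By the mean value inequality \<open>f\<close> may grow like
  \<open>s powr (- 2 / p)\<close> at the point of a leg with parameter \<open>s\<close>, counted
  from \<open>v\<close>. For p <= 2 this is not integrable, so the plain Cauchy integral over the
  leg can diverge; the zero of the modified kernel at \<open>v\<close> leaves
  \<open>s powr (1 - 2 / p)\<close>, integrable exactly when p > 1. The decay like 1 / z^2 is
  decisive for the same range, since 1 / z is not p-integrable at infinity in a half plane when p <=
  2. The logarithm enters as the integral of 1 / (t - z) over a leg: subtracting \<open>f z\<close>
  removes the pole, but costs \<open>f z\<close> times a logarithm. The logarithms of two legs and
  of the side between their end points cancel as soon as \<open>z\<close> is outside the triangle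
  they form, which is why the contribution of a side continues to its whole half plane. No list of
  vertices is ever formed. The boundary is parametrised by the angle seen from \<open>c\<close>, a
  piece lying on one side is treated directly, and pieces are glued by bisection of the interval
  from 0 to 2 * pi.\<close>

lemma powr_above_tangent:
  fixes p m x :: real
  assumes "1 \<le> p" "0 < m" "0 \<le> x"
  shows "m powr p + p * m powr (p - 1) * (x - m) \<le> x powr p"
proof (cases "x = 0")
  case True
  \<comment> \<open>At \<open>x = 0\<close>, which is outside the open half line on which convexity
    is used below, the left side is \<open>(1 - p) * m powr p\<close> and hence nonpositive.\<close>
  have "m powr (p - 1) * m = m powr p"
    using assms by (metis add.commute diff_add_cancel powr_mult_base less_imp_le mult.commute)
  then have "m powr p + p * m powr (p - 1) * (x - m) = (1 - p) * m powr p"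
    using True by (simp add: algebra_simps)
  then show ?thesis using assms True by (simp add: mult_le_0_iff)
next
  case False
  then have "x > 0" using assms by simp
  have "p * m powr (p - 1) * (x - m) \<le> x powr p - m powr p"
  proof (rule convex_on_imp_above_tangent[where A = "{0<..}"])
    show "convex_on {0<..} (\<lambda>x. x powr p)" using powr_convex assms by blast
    show "((\<lambda>x. x powr p) has_real_derivative p * m powr (p - 1)) (at m within {0<..})"
      using assms by (auto intro!: derivative_eq_intros)
  qed (use assms \<open>x > 0\<close> in \<open>auto simp: interior_open\<close>)
  then show ?thesis by simp
qed

text \<open>Jensen's inequality without normalising the measure: the tangent of
  \<open>x powr p\<close> at the mean \<open>m\<close> is integrated, and its linear term has
  integral zero. Rescaling by the total mass \<open>c\<close> produces the factor
  \<open>c powr (p - 1)\<close>.\<close>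

lemma (in finite_measure) powr_integral_le:
  fixes X :: "'a \<Rightarrow> real"
  assumes [measurable]: "X \<in> borel_measurable M" and X: "\<And>x. 0 \<le> X x" and p: "1 \<le> p"
  shows "ennreal ((\<integral>x. X x \<partial>M) powr p)
    \<le> ennreal (measure M (space M) powr (p - 1)) * (\<integral>\<^sup>+x. ennreal (X x powr p) \<partial>M)"
proof -
  define c where "c = measure M (space M)"
  define m where "m = (\<integral>x. X x \<partial>M) / c"
  show ?thesis
  \<comment> \<open>A non-integrable \<open>X\<close> has Bochner integral 0 by convention and thus
    belongs to the first case, so \<open>X\<close> is integrable in the second.\<close>
  proof (cases "(\<integral>x. X x \<partial>M) = 0 \<or> c = 0")
    case True
    have "(\<integral>x. X x \<partial>M) = 0" if "c = 0"
    proof -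
      have "emeasure M (space M) = 0" using that by (simp add: c_def emeasure_eq_measure)
      then have "AE x in M. X x = 0"
        by (intro AE_I[where N = "space M"]) auto
      then show ?thesis by (simp add: integral_eq_zero_AE)
    qed
    with True show ?thesis by auto
  next
    case False
    then have intX: "integrable M X" using not_integrable_integral_eq by blast
    have c: "c > 0" using False by (simp add: c_def zero_less_measure_iff measure_eq_0_null_sets less_le)
    have m: "m > 0" using False c X by (simp add: m_def less_le integral_nonneg_AE)
    show ?thesis
    proof (cases "(\<integral>\<^sup>+x. ennreal (X x powr p) \<partial>M) = \<infinity>")
      case True
      then show ?thesis using c by (simp add: c_def ennreal_mult_top)
    next
      case fin: False
      then have int: "integrable M (\<lambda>x. X x powr p)"
        by (intro integrableI_bounded) (auto simp: less_top)
      have "(\<integral>x. m powr p + p * m powr (p - 1) * (X x - m) \<partial>M) \<le> (\<integral>x. X x powr p \<partial>M)"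
        using powr_above_tangent[OF p m X] intX int by (intro integral_mono) auto
      also have "(\<integral>x. m powr p + p * m powr (p - 1) * (X x - m) \<partial>M)
          = m powr p * c + p * m powr (p - 1) * ((\<integral>x. X x \<partial>M) - m * c)"
        using intX by (simp add: c_def algebra_simps)
      also have "(\<integral>x. X x \<partial>M) - m * c = 0" using c by (simp add: m_def)
      finally have "c powr (p - 1) * (m powr p * c) \<le> c powr (p - 1) * (\<integral>x. X x powr p \<partial>M)"
        by (simp add: mult_left_mono)
      moreover have "c powr (p - 1) * (m powr p * c) = (\<integral>x. X x \<partial>M) powr p"
      proof -
        have "c powr (p - 1) * c = c powr p"
          using c by (metis add.commute diff_add_cancel powr_mult_base less_imp_le mult.commute)
        then have "c powr (p - 1) * (m powr p * c) = (m * c) powr p"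
          using c m by (simp add: powr_mult mult_ac)
        then show ?thesis using c by (simp add: m_def)
      qed
      ultimately have "ennreal ((\<integral>x. X x \<partial>M) powr p) \<le> ennreal (c powr (p - 1) * (\<integral>x. X x powr p \<partial>M))"
        by (simp add: ennreal_leI)
      also have "\<dots> = ennreal (c powr (p - 1)) * (\<integral>\<^sup>+x. ennreal (X x powr p) \<partial>M)"
        using int by (simp add: ennreal_mult nn_integral_eq_integral)
      finally show ?thesis by (simp add: c_def)
    qed
  qed
qed

lemma set_integrable_has_integral_nonneg:
  fixes f :: "'a::euclidean_space \<Rightarrow> real"
  assumes [measurable]: "f \<in> borel_measurable borel" "S \<in> sets borel"
    and f: "\<And>x. 0 \<le> f x" and I: "(f has_integral I) S"
  shows "set_integrable lborel S f"
proof -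
  have "(\<integral>\<^sup>+x. ennreal (indicator S x * f x) \<partial>lborel) = I"
  proof (rule nn_integral_has_integral_lborel)
    have "(\<lambda>x. if x \<in> S then f x else 0) = (\<lambda>x. indicator S x * f x)" by auto
    then show "((\<lambda>x. indicator S x * f x) has_integral I) UNIV"
      using I by (metis has_integral_restrict_UNIV)
  qed (use f in auto)
  then show ?thesis
    unfolding set_integrable_def by (intro integrableI_nn_integral_finite[where x = I])
      (use f I in \<open>auto intro: has_integral_nonneg\<close>)
qed

text \<open>Comparison with \<open>t powr a\<close> up to 1 and with \<open>t powr (a - 2)\<close>
  beyond. For the exponent \<open>1 - 2 / p\<close> used in Hardy's inequality,
  \<open>- 1 < a\<close> is the condition p > 1.\<close>

lemma set_integrable_powr_div_square:
  fixes a :: real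
  assumes "- 1 < a" "a < 1"
  shows "set_integrable lborel {0<..} (\<lambda>t. t powr a / (1 + t)\<^sup>2)"
proof -
  have A: "set_integrable lborel {0..1} (\<lambda>t::real. t powr a)"
    using has_integral_powr_from_0[of a 1] assms
    by (intro set_integrable_has_integral_nonneg) auto
  have B: "set_integrable lborel {1..} (\<lambda>t::real. t powr (a - 2))"
    using has_integral_powr_to_inf[of "a - 2" 1] assms
    by (intro set_integrable_has_integral_nonneg) auto
  have "set_integrable lborel {0<..1} (\<lambda>t::real. t powr a / (1 + t)\<^sup>2)"
  proof (rule set_integrable_bound[OF set_integrable_subset[OF A]])
    show "AE t in lborel. t \<in> {0<..1} \<longrightarrow> norm (t powr a / (1 + t)\<^sup>2) \<le> norm (t powr a)"
    proof (intro AE_I2 impI)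
      fix t :: real assume "t \<in> {0<..1}"
      then have "1 \<le> (1 + t)\<^sup>2" by (simp add: power2_eq_square algebra_simps)
      then show "norm (t powr a / (1 + t)\<^sup>2) \<le> norm (t powr a)"
        using mult_left_mono[of 1 "(1 + t)\<^sup>2" "t powr a"] by (auto simp: divide_le_eq)
    qed
  qed (auto simp: set_borel_measurable_def)
  moreover have "set_integrable lborel {1<..} (\<lambda>t::real. t powr a / (1 + t)\<^sup>2)"
  proof (rule set_integrable_bound[OF set_integrable_subset[OF B]])
    show "AE t in lborel. t \<in> {1<..} \<longrightarrow> norm (t powr a / (1 + t)\<^sup>2) \<le> norm (t powr (a - 2))"
    proof (intro AE_I2 impI)
      fix t :: real assume t: "t \<in> {1<..}"
      then have "t\<^sup>2 \<le> (1 + t)\<^sup>2" by (simp add: power2_eq_square algebra_simps)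
      moreover have "t powr (a - 2) = t powr a / t\<^sup>2" using t by (simp add: powr_diff)
      ultimately show "norm (t powr a / (1 + t)\<^sup>2) \<le> norm (t powr (a - 2))"
        using t by (simp add: divide_left_mono)
    qed
  qed (auto simp: set_borel_measurable_def)
  ultimately have "set_integrable lborel ({0<..1} \<union> {1<..}) (\<lambda>t. t powr a / (1 + t)\<^sup>2)"
    by (rule set_integrable_Un) auto
  moreover have "{0<..1} \<union> {1<..} = {0::real<..}" by auto
  ultimately show ?thesis by simp
qed

lemma nn_integral_complex_scaleR:
  fixes g :: "complex \<Rightarrow> ennreal"
  assumes [measurable]: "g \<in> borel_measurable borel" and c: "c > 0"
  shows "(\<integral>\<^sup>+z. g (c *\<^sub>R z) \<partial>lborel) = ennreal (1 / c\<^sup>2) * (\<integral>\<^sup>+z. g z \<partial>lborel)"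
proof -
  have "(\<integral>\<^sup>+z. g z \<partial>lborel)
      = (\<integral>\<^sup>+z. g z \<partial>density (distr lborel borel (\<lambda>x. 0 + c *\<^sub>R x)) (\<lambda>_. \<bar>c\<bar>^DIM(complex)))"
    using lborel_affine[of c "0::complex"] c by simp
  also have "\<dots> = (\<integral>\<^sup>+z. ennreal (c\<^sup>2) * g (c *\<^sub>R z) \<partial>lborel)"
    using c by (simp add: nn_integral_density nn_integral_distr)
  also have "\<dots> = ennreal (c\<^sup>2) * (\<integral>\<^sup>+z. g (c *\<^sub>R z) \<partial>lborel)"
    by (simp add: nn_integral_cmult)
  finally show ?thesis using c
    by (simp add: mult.assoc[symmetric] ennreal_mult[symmetric])
qed

text \<open>The substitution \<open>s = norm z * t\<close> makes the kernel independent of \<open>z\<close>; Jensen's inequality for the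
  finite measure \<open>t powr (1 - 2 / p) / (1 + t)^2\<close> on the half line then only requires scaling in the plane.\<close>

lemma hardy_estimate:
  fixes \<phi> :: "real \<Rightarrow> real" and p :: real
  assumes [measurable]: "\<phi> \<in> borel_measurable borel" and \<phi>: "\<And>s. 0 \<le> \<phi> s" and p: "1 < p"
  obtains C where "0 \<le> C"
    "(\<integral>\<^sup>+z. ennreal ((\<integral>s. indicator {0<..} s * (\<phi> s * s / (s + norm z)\<^sup>2) \<partial>lborel) powr p) \<partial>(lborel :: complex measure))
      \<le> ennreal C * (\<integral>\<^sup>+z. ennreal (\<phi> (norm z) powr p) \<partial>(lborel :: complex measure))"
proof -
  \<comment> \<open>The kernel contributes a factor \<open>t\<close>, split into
    \<open>t powr (1 - 2 / p)\<close> in the weight and \<open>t powr (2 / p)\<close> beside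
    \<open>\<phi>\<close>. The \<open>p\<close>-th power of the latter is \<open>t^2\<close>, which
    cancels the Jacobian \<open>1 / t^2\<close> of the dilation by \<open>t\<close> exactly, so the
    inner integral is the same \<open>A\<close> for every \<open>t\<close>.\<close>
  define w where "w t = indicator {0<..} t * (t powr (1 - 2 / p) / (1 + t)\<^sup>2)" for t :: real
  define \<nu> where "\<nu> = density lborel (\<lambda>t. ennreal (w t))"
  define \<Phi> where "\<Phi> z = (\<integral>s. indicator {0<..} s * (\<phi> s * s / (s + norm z)\<^sup>2) \<partial>lborel)" for z :: complex
  define A where "A = (\<integral>\<^sup>+z. ennreal (\<phi> (norm z) powr p) \<partial>(lborel :: complex measure))"
  have w_meas [measurable]: "w \<in> borel_measurable borel" unfolding w_def by measurable
  have w0: "0 \<le> w t" for t by (auto simp: w_def)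
  have w_int: "integrable lborel w"
    using set_integrable_powr_div_square[of "1 - 2 / p"] p
    by (simp add: w_def[abs_def] set_integrable_def field_simps)
  have nu_UNIV: "emeasure \<nu> UNIV = ennreal (\<integral>t. w t \<partial>lborel)"
    using w_int w0 by (simp add: \<nu>_def emeasure_density nn_integral_eq_integral)
  interpret \<nu>: finite_measure \<nu>
    by (rule finite_measureI) (use nu_UNIV in \<open>simp add: \<nu>_def\<close>)
  define c where "c = measure \<nu> (space \<nu>)"
  have \<Phi>: "\<Phi> z = (\<integral>t. \<phi> (norm z * t) * t powr (2 / p) \<partial>\<nu>)" if "z \<noteq> 0" for z
  proof -
    let ?r = "norm z"
    have r: "?r > 0" using that by simp
    have "\<Phi> z = ?r * (\<integral>t. indicator {0<..} (?r * t) * (\<phi> (?r * t) * (?r * t) / (?r * t + ?r)\<^sup>2) \<partial>lborel)"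
      unfolding \<Phi>_def using r lborel_integral_real_affine[of ?r "\<lambda>s. indicator {0<..} s * (\<phi> s * s / (s + norm z)\<^sup>2)" 0]
      by simp
    also have "\<dots> = (\<integral>t. ?r * (indicator {0<..} (?r * t) * (\<phi> (?r * t) * (?r * t) / (?r * t + ?r)\<^sup>2)) \<partial>lborel)"
      by (rule integral_mult_right_zero[symmetric])
    also have "\<dots> = (\<integral>t. w t * (\<phi> (?r * t) * t powr (2 / p)) \<partial>lborel)"
    proof (rule Bochner_Integration.integral_cong[OF refl])
      fix t :: real
      show "?r * (indicator {0<..} (?r * t) * (\<phi> (?r * t) * (?r * t) / (?r * t + ?r)\<^sup>2))
          = w t * (\<phi> (?r * t) * t powr (2 / p))"
      proof (cases "t > 0")
        case True
        have "(?r * t + ?r)\<^sup>2 = ?r\<^sup>2 * (1 + t)\<^sup>2" by (simp add: power2_eq_square algebra_simps)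
        moreover have "t powr (1 - 2 / p) * t powr (2 / p) = t" using True by (simp add: powr_add[symmetric])
        moreover have "?r * (\<phi> (?r * t) * (?r * t) / (?r\<^sup>2 * (1 + t)\<^sup>2)) = \<phi> (?r * t) * t / (1 + t)\<^sup>2"
          using r by (simp add: power2_eq_square[of ?r])
        ultimately show ?thesis using True r by (simp add: w_def mult_ac)
      next
        case False
        then show ?thesis using r by (simp add: w_def zero_less_mult_iff)
      qed
    qed
    also have "\<dots> = (\<integral>t. \<phi> (?r * t) * t powr (2 / p) \<partial>\<nu>)"
      unfolding \<nu>_def using w0 by (subst integral_density) auto
    finally show ?thesis .
  qed
  have bound: "ennreal (\<Phi> z powr p)
      \<le> ennreal (c powr (p - 1)) * (\<integral>\<^sup>+t. ennreal (w t * t\<^sup>2) * ennreal (\<phi> (norm (t *\<^sub>R z)) powr p) \<partial>lborel)"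
    if "z \<noteq> 0" for z
  proof -
    have "ennreal (\<Phi> z powr p) \<le> ennreal (c powr (p - 1)) * (\<integral>\<^sup>+t. ennreal ((\<phi> (norm z * t) * t powr (2 / p)) powr p) \<partial>\<nu>)"
      unfolding \<Phi>[OF that] c_def
      by (rule \<nu>.powr_integral_le) (use \<phi> p in \<open>auto simp: \<nu>_def\<close>)
    also have "(\<integral>\<^sup>+t. ennreal ((\<phi> (norm z * t) * t powr (2 / p)) powr p) \<partial>\<nu>)
        = (\<integral>\<^sup>+t. ennreal (w t) * ennreal ((\<phi> (norm z * t) * t powr (2 / p)) powr p) \<partial>lborel)"
      unfolding \<nu>_def by (subst nn_integral_density) auto
    also have "\<dots> = (\<integral>\<^sup>+t. ennreal (w t * t\<^sup>2) * ennreal (\<phi> (norm (t *\<^sub>R z)) powr p) \<partial>lborel)"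
    proof (rule nn_integral_cong)
      fix t :: real
      show "ennreal (w t) * ennreal ((\<phi> (norm z * t) * t powr (2 / p)) powr p)
          = ennreal (w t * t\<^sup>2) * ennreal (\<phi> (norm (t *\<^sub>R z)) powr p)"
      proof (cases "t > 0")
        case True
        have "(\<phi> (norm z * t) * t powr (2 / p)) powr p = \<phi> (norm z * t) powr p * t\<^sup>2"
          using True p \<phi> by (simp add: powr_mult powr_powr)
        then show ?thesis using True w0[of t] by (simp add: ennreal_mult[symmetric] mult_ac)
      qed (simp add: w_def)
    qed
    finally show ?thesis .
  qed
  have "(\<integral>\<^sup>+z. ennreal (\<Phi> z powr p) \<partial>lborel)
      \<le> (\<integral>\<^sup>+z. ennreal (c powr (p - 1)) * (\<integral>\<^sup>+t. ennreal (w t * t\<^sup>2) * ennreal (\<phi> (norm (t *\<^sub>R z)) powr p) \<partial>lborel) \<partial>(lborel :: complex measure))"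
  proof (rule nn_integral_mono_AE)
    have "AE z in lborel. z \<noteq> (0 :: complex)" by (rule AE_lborel_singleton)
    then show "AE z in lborel. ennreal (\<Phi> z powr p) \<le> ennreal (c powr (p - 1)) * (\<integral>\<^sup>+t. ennreal (w t * t\<^sup>2) * ennreal (\<phi> (norm (t *\<^sub>R z)) powr p) \<partial>lborel)"
      by eventually_elim (rule bound)
  qed
  also have "\<dots> = ennreal (c powr (p - 1)) * (\<integral>\<^sup>+z. (\<integral>\<^sup>+t. ennreal (w t * t\<^sup>2) * ennreal (\<phi> (norm (t *\<^sub>R z)) powr p) \<partial>lborel) \<partial>(lborel :: complex measure))"
    by (simp add: nn_integral_cmult)
  also have "(\<integral>\<^sup>+z. (\<integral>\<^sup>+t. ennreal (w t * t\<^sup>2) * ennreal (\<phi> (norm (t *\<^sub>R z)) powr p) \<partial>lborel) \<partial>(lborel :: complex measure))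
      = (\<integral>\<^sup>+t. (\<integral>\<^sup>+z. ennreal (w t * t\<^sup>2) * ennreal (\<phi> (norm (t *\<^sub>R z)) powr p) \<partial>(lborel :: complex measure)) \<partial>lborel)"
    by (rule lborel_pair.Fubini'[symmetric]) measurable
  also have "\<dots> = (\<integral>\<^sup>+t. ennreal (w t) * A \<partial>lborel)"
  proof (rule nn_integral_cong)
    fix t :: real
    show "(\<integral>\<^sup>+z. ennreal (w t * t\<^sup>2) * ennreal (\<phi> (norm (t *\<^sub>R z)) powr p) \<partial>(lborel :: complex measure)) = ennreal (w t) * A"
    proof (cases "t > 0")
      case True
      have "(\<integral>\<^sup>+z. ennreal (w t * t\<^sup>2) * ennreal (\<phi> (norm (t *\<^sub>R z)) powr p) \<partial>(lborel :: complex measure))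
          = ennreal (w t * t\<^sup>2) * (\<integral>\<^sup>+z. ennreal (\<phi> (norm (t *\<^sub>R z)) powr p) \<partial>(lborel :: complex measure))"
        by (rule nn_integral_cmult) measurable
      also have "(\<integral>\<^sup>+z. ennreal (\<phi> (norm (t *\<^sub>R z)) powr p) \<partial>(lborel :: complex measure)) = ennreal (1 / t\<^sup>2) * A"
        unfolding A_def by (rule nn_integral_complex_scaleR) (use True in measurable)
      finally show ?thesis using True w0[of t]
        by (simp add: mult.assoc[symmetric] ennreal_mult[symmetric])
    qed (simp add: w_def)
  qed
  also have "\<dots> = (\<integral>\<^sup>+t. ennreal (w t) \<partial>lborel) * A"
    by (rule nn_integral_multc) measurable
  also have "(\<integral>\<^sup>+t. ennreal (w t) \<partial>lborel) = ennreal c"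
    using w_int w0 nu_UNIV by (simp add: nn_integral_eq_integral c_def \<nu>_def measure_def)
  finally have "(\<integral>\<^sup>+z. ennreal (\<Phi> z powr p) \<partial>lborel) \<le> ennreal (c powr (p - 1) * c) * A"
    by (simp add: c_def ennreal_mult mult.assoc)
  then show ?thesis
    using that[of "c powr (p - 1) * c"] by (simp add: \<Phi>_def A_def c_def)
qed

section \<open>Rotation invariance of area and the mean value inequality for powers of the
  modulus\<close>

text \<open>Carries facts about orthogonal maps of \<open>real^2\<close> over to
  \<open>complex\<close>. It suffices to compare the measures of boxes, since the coordinate map
  pulls a box back to a box.\<close>

lemma distr_lborel_vec_complex:
  "distr (lborel :: (real^2) measure) borel (\<lambda>x. Complex (x $ 1) (x $ 2)) = lborel"
proof (rule lborel_eqI[symmetric])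
  have [measurable]: "(\<lambda>x::real^2. Complex (x $ 1) (x $ 2)) \<in> borel_measurable borel"
    by (intro borel_measurable_continuous_onI) (auto simp: Complex_eq intro!: continuous_intros)
  fix l u :: complex
  assume le: "\<And>b. b \<in> Basis \<Longrightarrow> l \<bullet> b \<le> u \<bullet> b"
  have le': "Re l \<le> Re u" "Im l \<le> Im u"
    using le[of 1] le[of \<i>] by (auto simp: Basis_complex_def)
  have "(\<lambda>x::real^2. Complex (x $ 1) (x $ 2)) -` box l u = box (vector [Re l, Im l]) (vector [Re u, Im u])"
    by (auto simp: box_def Basis_complex_def Basis_vec_def inner_axis forall_2 vector_2)
  moreover have "emeasure lborel (box (vector [Re l, Im l]) (vector [Re u, Im u]) :: (real^2) set) = (Re u - Re l) * (Im u - Im l)"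
    using le' by (subst emeasure_lborel_box) (auto simp: Basis_vec_def inner_axis forall_2 vector_2 UNIV_2 axis_eq_axis)
  ultimately show "emeasure (distr (lborel :: (real^2) measure) borel (\<lambda>x. Complex (x $ 1) (x $ 2))) (box l u) = (\<Prod>b\<in>Basis. (u - l) \<bullet> b)"
    by (simp add: emeasure_distr Basis_complex_def)
qed simp

text \<open>In real coordinates multiplication by \<open>cnj e\<close> is an orthogonal map
  \<open>r\<close>. The preimage of a box under multiplication by \<open>e\<close> is the image of
  the box under \<open>r\<close>, and orthogonal images keep their measure.\<close>

lemma distr_lborel_complex_rotate:
  fixes e :: complex
  assumes e: "norm e = 1"
  shows "distr lborel borel ((*) e) = lborel"
proof (rule lborel_eqI[symmetric])
  let ?V = "\<lambda>x::real^2. Complex (x $ 1) (x $ 2)"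
  define r :: "real^2 \<Rightarrow> real^2" where "r x = vector [Re (cnj e * ?V x), Im (cnj e * ?V x)]" for x
  have Vr: "?V (r x) = cnj e * ?V x" for x by (simp add: r_def complex_eq_iff vector_2)
  have ee: "e * cnj e = 1" using e by (simp add: complex_norm_square[symmetric])
  have [measurable]: "?V \<in> borel_measurable borel"
    by (intro borel_measurable_continuous_onI) (auto simp: Complex_eq intro!: continuous_intros)
  have em: "emeasure lborel X = emeasure lborel (?V -` X)" if "X \<in> sets borel" for X
    using that by (subst distr_lborel_vec_complex[symmetric], subst emeasure_distr) auto
  have norm_V: "norm (?V x) = norm x" for x
    by (simp add: norm_vec_def L2_set_def UNIV_2 cmod_def)
  have orth: "orthogonal_transformation r"
  proof -
    have "linear r"
      by (rule linearI) (auto simp: r_def vec_eq_iff forall_2 vector_2 algebra_simps)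
    moreover have "norm (r x) = norm x" for x
      using norm_V[of "r x"] norm_V[of x] e by (simp add: Vr norm_mult)
    ultimately show ?thesis by (simp add: orthogonal_transformation)
  qed
  fix l u :: complex
  assume le: "\<And>b. b \<in> Basis \<Longrightarrow> l \<bullet> b \<le> u \<bullet> b"
  let ?B = "?V -` box l u"
  have B: "?V -` ((*) e -` box l u) = r ` ?B"
  proof (intro equalityI subsetI)
    fix x assume x: "x \<in> ?V -` ((*) e -` box l u)"
    define y :: "real^2" where "y = vector [Re (e * ?V x), Im (e * ?V x)]"
    have y: "?V y = e * ?V x" by (simp add: y_def complex_eq_iff vector_2)
    have "?V (r y) = ?V x" unfolding Vr y using ee by (simp add: mult_ac)
    then have "r y = x" by (simp add: vec_eq_iff forall_2)
    moreover have "y \<in> ?B" using x y by simp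
    ultimately show "x \<in> r ` ?B" by blast
  next
    fix x assume "x \<in> r ` ?B"
    then obtain y where y: "x = r y" "y \<in> ?B" by auto
    have "e * ?V (r y) = ?V y" unfolding Vr using ee by (simp add: mult.assoc[symmetric])
    then show "x \<in> ?V -` ((*) e -` box l u)" using y by simp
  qed
  have fin: "emeasure lborel ?B = (\<Prod>b\<in>Basis. (u - l) \<bullet> b)"
    using em[of "box l u"] emeasure_lborel_box[of l u] le by simp
  have Bm: "?B \<in> sets borel" using measurable_sets[of ?V borel borel "box l u"] by simp
  have rBm: "r ` ?B \<in> sets borel" unfolding B[symmetric]
    using measurable_sets[of ?V borel borel "(*) e -` box l u"] measurable_sets[of "(*) e" borel borel "box l u"] by simp
  have "?B \<in> lmeasurable" using fin Bm by (simp add: fmeasurable_def)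
  then have "r ` ?B \<in> lmeasurable" "measure lebesgue (r ` ?B) = measure lebesgue ?B"
    using measurable_orthogonal_image[OF orth] measure_orthogonal_image[OF orth] by auto
  then have "emeasure lebesgue (r ` ?B) = emeasure lebesgue ?B"
    using \<open>?B \<in> lmeasurable\<close> by (simp add: emeasure_eq_measure2)
  then have "emeasure lborel (r ` ?B) = emeasure lborel ?B" using Bm rBm by simp
  then show "emeasure (distr lborel borel ((*) e)) (box l u) = (\<Prod>b\<in>Basis. (u - l) \<bullet> b)"
    using fin B em[of "(*) e -` box l u"] measurable_sets[of "(*) e" borel borel "box l u"]
    by (simp add: emeasure_distr)
qed simp

text \<open>Cauchy's formula at the centre of the unit disc for the function sending
  \<open>u\<close> to \<open>f (u * w)\<close>. Moving \<open>w\<close> into the function keeps the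
  path fixed and admits \<open>w = 0\<close>.\<close>

lemma norm_le_circle_mean:
  assumes f: "f holomorphic_on ball 0 d" and w: "norm w < d"
  shows "norm (f 0) \<le> (\<integral>t. indicator {0..1} t * norm (f (exp (2 * of_real pi * \<i> * of_real t) * w)) \<partial>lborel)"
proof -
  define g where "g u = f (u * w)" for u
  let ?e = "\<lambda>t::real. exp (2 * of_real pi * \<i> * of_real t)"
  have g: "g holomorphic_on cball 0 1"
    unfolding g_def
  proof (rule holomorphic_on_compose_gen[OF _ f, unfolded o_def])
    show "(\<lambda>u. u * w) ` cball 0 1 \<subseteq> ball 0 d"
    proof clarsimp
      fix u :: complex assume "norm u \<le> 1"
      then have "norm u * norm w \<le> 1 * norm w" by (intro mult_right_mono) auto
      then show "norm (u * w) < d" using w by (simp add: norm_mult)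
    qed
  qed (auto intro!: holomorphic_intros)
  have norm_e: "norm (?e t) = 1" for t by simp
  have e0: "?e t \<noteq> 0" for t by simp
  have cont: "continuous_on UNIV (\<lambda>t. g (?e t))"
    by (rule continuous_on_compose2[OF holomorphic_on_imp_continuous_on[OF g]]) (auto intro!: continuous_intros)
  have "((\<lambda>u. g u / (u - 0)) has_contour_integral (2 * of_real pi * \<i> * g 0)) (circlepath 0 1)"
    by (rule Cauchy_integral_circlepath_simple[OF g]) simp
  then have "((\<lambda>t. g (?e t) / ?e t * (2 * of_real pi * \<i> * ?e t)) has_integral (2 * of_real pi * \<i> * g 0)) {0..1}"
    unfolding has_contour_integral_def
  proof (rule has_integral_eq[rotated])
    fix t :: real assume "t \<in> {0..1}"
    then show "g (circlepath 0 1 t) / (circlepath 0 1 t - 0) * vector_derivative (circlepath 0 1) (at t within {0..1})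
        = g (?e t) / ?e t * (2 * of_real pi * \<i> * ?e t)"
      by (subst vector_derivative_circlepath01) (auto simp: circlepath)
  qed
  then have "((\<lambda>t. (2 * of_real pi * \<i>) * g (?e t)) has_integral (2 * of_real pi * \<i> * g 0)) {0..1}"
    by (rule has_integral_eq[rotated]) (use e0 in simp)
  then have "((\<lambda>t. g (?e t)) has_integral g 0) {0..1}"
    by (simp add: has_integral_mult_right_iff)
  then have "norm (g 0) \<le> integral {0..1} (\<lambda>t. norm (g (?e t)))"
    by (metis integral_norm_bound_integral integral_unique has_integral_integrable order_refl
        integrable_continuous_interval continuous_on_norm continuous_on_subset[OF cont subset_UNIV])
  also have "\<dots> = (LINT t:{0..1}|lborel. norm (g (?e t)))"
    by (rule set_borel_integral_eq_integral(2)[symmetric])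
      (intro borel_integrable_atLeastAtMost' continuous_on_norm continuous_on_subset[OF cont subset_UNIV])
  finally show ?thesis by (simp add: g_def set_lebesgue_integral_def)
qed

text \<open>Averaging over all rotations of the disc avoids polar coordinates.\<close>

lemma norm_powr_mean_value:
  fixes f :: "complex \<Rightarrow> complex"
  assumes f: "f holomorphic_on ball a d" and d: "0 < d" and p: "1 \<le> p"
  shows "ennreal (pi * d\<^sup>2) * ennreal (norm (f a) powr p)
    \<le> (\<integral>\<^sup>+w. indicator (ball a d) w * ennreal (norm (f w) powr p) \<partial>lborel)"
proof -
  \<comment> \<open>Extension by zero makes \<open>F\<close> Borel on the whole plane, as required
    for exchanging the integrals over angle and plane.\<close>
  define F where "F w = (if w \<in> ball 0 d then norm (f (a + w)) else 0)" for w
  let ?e = "\<lambda>t::real. exp (2 * of_real pi * \<i> * of_real t)"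
  have f': "(\<lambda>w. f (a + w)) holomorphic_on ball 0 d"
    by (rule holomorphic_on_compose_gen[OF _ f, unfolded o_def])
      (auto intro!: holomorphic_intros simp: dist_norm)
  have [measurable]: "F \<in> borel_measurable borel"
  proof -
    have "continuous_on (ball 0 d) (\<lambda>w. norm (f (a + w)))"
      using f' by (intro continuous_on_norm holomorphic_on_imp_continuous_on)
    then show ?thesis unfolding F_def
      by (intro borel_measurable_continuous_on_if) auto
  qed
  have F0: "0 \<le> F w" for w by (simp add: F_def)
  have [measurable]: "?e \<in> borel_measurable borel"
    by (intro borel_measurable_continuous_onI continuous_intros)
  \<comment> \<open>The uniform distribution of the angle has mass 1, so the constant in Jensen's
    inequality is 1.\<close>
  define M where "M = density lborel (indicator {0..1::real})"
  have M_UNIV: "emeasure M UNIV = 1" by (simp add: M_def emeasure_density)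
  interpret M: finite_measure M by (rule finite_measureI) (use M_UNIV in \<open>simp add: M_def\<close>)
  have M1: "measure M (space M) = 1" using M_UNIV by (simp add: M_def measure_def)
  have mean: "ennreal (norm (f a) powr p) \<le> (\<integral>\<^sup>+t. indicator {0..1} t * ennreal (F (?e t * w) powr p) \<partial>lborel)"
    if w: "w \<in> ball 0 d" for w
  proof -
    have w': "?e t * w \<in> ball 0 d" for t using w by (simp add: norm_mult)
    have "norm (f a) \<le> (\<integral>t. indicator {0..1} t * F (?e t * w) \<partial>lborel)"
      using norm_le_circle_mean[OF f', of w] w w' by (simp add: F_def)
    also have "\<dots> = (\<integral>t. F (?e t * w) \<partial>M)"
    proof -
      have "M = density lborel (\<lambda>t. ennreal (indicator {0..1} t))"
        by (simp add: M_def ennreal_indicator)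
      then show ?thesis by (simp add: integral_density)
    qed
    finally have "norm (f a) powr p \<le> (\<integral>t. F (?e t * w) \<partial>M) powr p"
      using p by (intro powr_mono2) auto
    then have "ennreal (norm (f a) powr p) \<le> ennreal ((\<integral>t. F (?e t * w) \<partial>M) powr p)"
      by (rule ennreal_leI)
    also have "\<dots> \<le> ennreal (measure M (space M) powr (p - 1)) * (\<integral>\<^sup>+t. ennreal (F (?e t * w) powr p) \<partial>M)"
      by (rule M.powr_integral_le) (use F0 p in \<open>auto simp: M_def\<close>)
    also have "\<dots> = (\<integral>\<^sup>+t. indicator {0..1} t * ennreal (F (?e t * w) powr p) \<partial>lborel)"
      unfolding M1 unfolding M_def by (simp add: nn_integral_density)
    finally show ?thesis .
  qed
  have "emeasure lborel (ball (0::complex) d) = ennreal (pi * d\<^sup>2)"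
    using d by (simp add: emeasure_ball unit_ball_vol_2)
  then have "ennreal (pi * d\<^sup>2) * ennreal (norm (f a) powr p)
      = (\<integral>\<^sup>+w. ennreal (norm (f a) powr p) * indicator (ball 0 d) w \<partial>(lborel :: complex measure))"
    by (subst nn_integral_cmult) (auto simp: mult.commute intro!: borel_measurable_indicator)
  also have "\<dots> \<le> (\<integral>\<^sup>+w. (\<integral>\<^sup>+t. indicator {0..1} t * ennreal (F (?e t * w) powr p) \<partial>lborel) \<partial>lborel)"
    using mean by (intro nn_integral_mono) (auto simp: indicator_def)
  also have "\<dots> = (\<integral>\<^sup>+t. (\<integral>\<^sup>+w. indicator {0..1} t * ennreal (F (?e t * w) powr p) \<partial>(lborel :: complex measure)) \<partial>lborel)"
    by (rule lborel_pair.Fubini'[symmetric]) measurable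
  also have "\<dots> = (\<integral>\<^sup>+t. indicator {0..1} (t::real) * (\<integral>\<^sup>+w. ennreal (F w powr p) \<partial>lborel) \<partial>lborel)"
  proof (rule nn_integral_cong)
    fix t :: real
    have "(\<integral>\<^sup>+w. ennreal (F w powr p) \<partial>lborel) = (\<integral>\<^sup>+w. ennreal (F w powr p) \<partial>distr lborel borel ((*) (?e t)))"
      by (simp add: distr_lborel_complex_rotate)
    also have "\<dots> = (\<integral>\<^sup>+w. ennreal (F (?e t * w) powr p) \<partial>lborel)"
      by (subst nn_integral_distr) auto
    finally show "(\<integral>\<^sup>+w. indicator {0..1} t * ennreal (F (?e t * w) powr p) \<partial>lborel) = indicator {0..1} t * (\<integral>\<^sup>+w. ennreal (F w powr p) \<partial>lborel)"
      by (simp add: nn_integral_cmult)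
  qed
  also have "\<dots> = (\<integral>\<^sup>+w. ennreal (F w powr p) \<partial>lborel)"
    by (simp add: nn_integral_multc)
  also have "\<dots> = (\<integral>\<^sup>+w. ennreal (F (w - a) powr p) \<partial>lborel)"
  proof -
    have "(\<integral>\<^sup>+w. ennreal (F w powr p) \<partial>lborel) = (\<integral>\<^sup>+w. ennreal (F w powr p) \<partial>distr lborel borel (\<lambda>x. - a + x))"
      by (subst lborel_distr_plus) simp
    also have "\<dots> = (\<integral>\<^sup>+w. ennreal (F (w - a) powr p) \<partial>lborel)"
      by (subst nn_integral_distr) (auto simp: algebra_simps)
    finally show ?thesis .
  qed
  also have "\<dots> = (\<integral>\<^sup>+w. indicator (ball a d) w * ennreal (norm (f w) powr p) \<partial>lborel)"
    by (intro nn_integral_cong) (auto simp: F_def dist_norm norm_minus_commute indicator_def)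
  finally show ?thesis .
qed

section \<open>Cauchy integrals along a leg\<close>

lemma norm_diff_le_of_norm_bound:
  fixes f :: "complex \<Rightarrow> complex"
  assumes f: "f holomorphic_on ball z0 r" and B: "\<And>z. z \<in> ball z0 r \<Longrightarrow> norm (f z) \<le> B"
    and z: "z \<in> ball z0 (r / 2)"
  shows "norm (f z - f z0) \<le> B / (r / 2) * norm (z - z0)"
proof (rule field_differentiable_bound[where S = "ball z0 (r / 2)"])
  have r: "r > 0" using z by (metis dist_commute le_less_trans mem_ball zero_le_dist half_gt_zero_iff)
  show "z0 \<in> ball z0 (r / 2)" using r by simp
  fix w assume w: "w \<in> ball z0 (r / 2)"
  have sub: "cball w (r / 2) \<subseteq> ball z0 r"
  proof
    fix x assume "x \<in> cball w (r / 2)"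
    then show "x \<in> ball z0 r" using w dist_triangle[of z0 x w] by simp
  qed
  have "w \<in> ball z0 r" using sub r centre_in_cball[of w "r / 2"] by (meson half_gt_zero less_imp_le subsetD)
  then show "(f has_field_derivative deriv f w) (at w within ball z0 (r / 2))"
    by (rule has_field_derivative_at_within[OF holomorphic_derivI[OF f open_ball]])
  have "norm ((deriv ^^ 1) f w) \<le> fact 1 * B / (r / 2) ^ 1"
  proof (rule Cauchy_inequality)
    show "f holomorphic_on ball w (r / 2)"
      using f sub by (meson ball_subset_cball holomorphic_on_subset order_trans)
    show "continuous_on (cball w (r / 2)) f"
      using f sub by (meson holomorphic_on_imp_continuous_on holomorphic_on_subset)
    show "norm (f x) \<le> B" if "norm (w - x) = r / 2" for x
      using B[of x] sub that by (auto simp: subset_iff dist_norm)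
  qed (use r in simp)
  then show "norm (deriv f w) \<le> B / (r / 2)" by simp
qed (use z in auto)

text \<open>For holomorphic integrands a local majorant of \<open>g\<close> also dominates the
  difference quotients, because Cauchy's estimate turns a bound on a ball into a Lipschitz bound on
  the ball of half the radius. Dominated convergence then applies along every sequence tending to
  \<open>z0\<close>.\<close>

lemma holomorphic_on_integral_dominated:
  fixes g :: "complex \<Rightarrow> 'a \<Rightarrow> complex"
  assumes U: "open U" and meas: "\<And>z. z \<in> U \<Longrightarrow> g z \<in> borel_measurable M"
    and hol: "\<And>t. t \<in> space M \<Longrightarrow> (\<lambda>z. g z t) holomorphic_on U"
    and dom: "\<And>z0. z0 \<in> U \<Longrightarrow>
      \<exists>r>0. \<exists>h. integrable M h \<and> (\<forall>z\<in>ball z0 r. z \<in> U \<and> (\<forall>t\<in>space M. norm (g z t) \<le> h t))"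
  shows "(\<lambda>z. \<integral>t. g z t \<partial>M) holomorphic_on U"
  unfolding holomorphic_on_open[OF U]
proof
  fix z0 assume z0: "z0 \<in> U"
  obtain r h where r: "r > 0" and h: "integrable M h"
    and gU: "\<And>z. z \<in> ball z0 r \<Longrightarrow> z \<in> U"
    and gh: "\<And>z t. z \<in> ball z0 r \<Longrightarrow> t \<in> space M \<Longrightarrow> norm (g z t) \<le> h t"
    using dom[OF z0] by blast
  have int: "integrable M (g z)" if "z \<in> ball z0 r" for z
  proof (rule Bochner_Integration.integrable_bound[OF h meas[OF gU[OF that]]], rule AE_I2)
    fix t assume "t \<in> space M"
    then show "norm (g z t) \<le> norm (h t)" using gh[OF that] by fastforce
  qed
  define D where "D t = deriv (\<lambda>z. g z t) z0" for t
  have D: "((\<lambda>z. g z t) has_field_derivative D t) (at z0)" if "t \<in> space M" for t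
    unfolding D_def using hol[OF that] U z0 by (rule holomorphic_derivI)
  have "((\<lambda>z. (\<integral>t. g z t \<partial>M)) has_field_derivative (\<integral>t. D t \<partial>M)) (at z0)"
    unfolding has_field_derivative_iff tendsto_at_iff_sequentially
  proof (intro allI impI)
    fix X :: "nat \<Rightarrow> complex"
    assume Xne: "\<forall>i. X i \<in> UNIV - {z0}" and X: "X \<longlonglongrightarrow> z0"
    \<comment> \<open>Replacing the quotient by 0 for the finitely many \<open>X i\<close> far from
      \<open>z0\<close> gives measurability and the bound for every \<open>i\<close> without
      changing the limit.\<close>
    define s where "s i t = (if X i \<in> ball z0 (r / 2) then (g (X i) t - g z0 t) / (X i - z0) else 0)" for i t
    have ev: "\<forall>\<^sub>F i in sequentially. X i \<in> ball z0 (r / 2)"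
      using X r by (auto simp: tendsto_iff dist_commute dest: spec[of _ "r / 2"])
    have half: "ball z0 (r / 2) \<subseteq> ball z0 r" using r by (auto intro: subset_ball)
    have lim: "(\<lambda>i. s i t) \<longlonglongrightarrow> D t" if t: "t \<in> space M" for t
    proof (rule Lim_transform_eventually)
      show "(\<lambda>i. (g (X i) t - g z0 t) / (X i - z0)) \<longlonglongrightarrow> D t"
        using D[OF t] X Xne unfolding has_field_derivative_iff tendsto_at_iff_sequentially
        by (auto simp: o_def)
      show "\<forall>\<^sub>F i in sequentially. (g (X i) t - g z0 t) / (X i - z0) = s i t"
        using ev by eventually_elim (simp add: s_def)
    qed
    have smeas: "s i \<in> borel_measurable M" for i
      unfolding s_def using meas[OF gU] half r z0 by (cases "X i \<in> ball z0 (r / 2)") (auto simp: meas)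
    have "(\<lambda>i. \<integral>t. s i t \<partial>M) \<longlonglongrightarrow> (\<integral>t. D t \<partial>M)"
    proof (rule integral_dominated_convergence[where w = "\<lambda>t. h t / (r / 2)"])
      show "D \<in> borel_measurable M"
        by (rule borel_measurable_LIMSEQ_metric[OF smeas lim])
      show "AE t in M. (\<lambda>i. s i t) \<longlonglongrightarrow> D t" using lim by auto
      show "AE t in M. norm (s i t) \<le> h t / (r / 2)" for i
      proof (intro AE_I2)
        fix t assume t: "t \<in> space M"
        have h0: "0 \<le> h t" using gh[of z0 t] t r norm_ge_zero order_trans by (metis centre_in_ball)
        show "norm (s i t) \<le> h t / (r / 2)"
        proof (cases "X i \<in> ball z0 (r / 2)")
          case True
          have "norm (g (X i) t - g z0 t) \<le> h t / (r / 2) * norm (X i - z0)"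
            by (rule norm_diff_le_of_norm_bound[OF holomorphic_on_subset[OF hol[OF t]] gh[OF _ t] True])
              (use gU in auto)
          moreover have "norm (X i - z0) > 0" using Xne by simp
          ultimately show ?thesis using True by (simp add: s_def norm_divide pos_divide_le_eq)
        qed (use h0 r in \<open>simp add: s_def\<close>)
      qed
    qed (use h smeas in auto)
    then have "(\<lambda>i. ((\<integral>t. g (X i) t \<partial>M) - (\<integral>t. g z0 t \<partial>M)) / (X i - z0)) \<longlonglongrightarrow> (\<integral>t. D t \<partial>M)"
    proof (rule Lim_transform_eventually)
      show "\<forall>\<^sub>F i in sequentially. (\<integral>t. s i t \<partial>M) = ((\<integral>t. g (X i) t \<partial>M) - (\<integral>t. g z0 t \<partial>M)) / (X i - z0)"
        using ev
      proof eventually_elim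
        case (elim i)
        then have "X i \<in> ball z0 r" using half by blast
        then show ?case using elim int[of "X i"] int[of z0] r by (simp add: s_def)
      qed
    qed
    then show "((\<lambda>y. ((\<integral>t. g y t \<partial>M) - (\<integral>t. g z0 t \<partial>M)) / (y - z0)) \<circ> X) \<longlonglongrightarrow> (\<integral>t. D t \<partial>M)"
      by (simp add: o_def)
  qed
  then show "\<exists>f'. ((\<lambda>z. (\<integral>t. g z t \<partial>M)) has_field_derivative f') (at z0)" ..
qed

text \<open>A homothety of ratio \<open>s\<close> centred at a point of the closure maps an open
  convex set into itself. Hence the free room around a leg shrinks only linearly on the way to
  \<open>v\<close>.\<close>

lemma ball_homothety_subset_convex:
  fixes P :: "complex set"
  assumes P: "open P" "convex P" and v: "v \<in> closure P" and q: "ball q r \<subseteq> P" and s: "0 < s" "s \<le> 1"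
  shows "ball (v + of_real s * (q - v)) (s * r) \<subseteq> P"
proof
  fix x assume x: "x \<in> ball (v + of_real s * (q - v)) (s * r)"
  define y where "y = v + (x - v) / of_real s"
  have "x - (v + of_real s * (q - v)) = of_real s * (y - q)"
    using s by (simp add: y_def field_simps)
  then have "norm (x - (v + of_real s * (q - v))) = s * norm (y - q)"
    using s by (simp add: norm_mult)
  then have "norm (y - q) < r" using x s by (simp add: dist_norm norm_minus_commute)
  then have "y \<in> interior P" using q P by (auto simp: interior_open dist_norm norm_minus_commute)
  from mem_interior_closure_convex_shrink[OF P(2) this v s]
  have "v - s *\<^sub>R (v - y) \<in> P" using P by (simp add: interior_open)
  also have "v - s *\<^sub>R (v - y) = x" using s by (simp add: y_def scaleR_conv_of_real)
  finally show "x \<in> P" .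
qed

section \<open>Growth of f towards a boundary point\<close>

locale bergman_corner =
  fixes p :: real and P :: "complex set" and f :: "complex \<Rightarrow> complex" and v :: complex
  assumes p: "1 < p" and openP: "open P" and convexP: "convex P"
    and holf: "f holomorphic_on P" and intf: "set_integrable lborel P (\<lambda>z. norm (f z) powr p)"
    and v: "v \<in> closure P" and vP: "v \<notin> P"
begin

lemma leg_in:
  assumes "q \<in> P" "0 < s" "s \<le> 1"
  shows "v + of_real s * (q - v) \<in> P"
proof -
  obtain r where "r > 0" "ball q r \<subseteq> P" using openP assms openE by blast
  then show ?thesis using ball_homothety_subset_convex[OF openP convexP v, of q r s] assms
    by (meson centre_in_ball mult_pos_pos subsetD)
qed

lemma norm_powr_le_integral:
  assumes "ball q r \<subseteq> P" "0 < r" "0 < s" "s \<le> 1"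
  shows "ennreal (pi * (s * r)\<^sup>2) * ennreal (norm (f (v + of_real s * (q - v))) powr p)
    \<le> (\<integral>\<^sup>+w. indicator (ball (v + of_real s * (q - v)) (s * r)) w * (indicator P w * ennreal (norm (f w) powr p)) \<partial>lborel)"
proof -
  have sub: "ball (v + of_real s * (q - v)) (s * r) \<subseteq> P"
    using ball_homothety_subset_convex[OF openP convexP v] assms by blast
  have "ennreal (pi * (s * r)\<^sup>2) * ennreal (norm (f (v + of_real s * (q - v))) powr p)
      \<le> (\<integral>\<^sup>+w. indicator (ball (v + of_real s * (q - v)) (s * r)) w * ennreal (norm (f w) powr p) \<partial>lborel)"
    by (rule norm_powr_mean_value[OF holomorphic_on_subset[OF holf sub]]) (use assms p in auto)
  also have "\<dots> = (\<integral>\<^sup>+w. indicator (ball (v + of_real s * (q - v)) (s * r)) w * (indicator P w * ennreal (norm (f w) powr p)) \<partial>lborel)"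
    using sub by (intro nn_integral_cong) (auto simp: indicator_def)
  finally show ?thesis .
qed

lemma integral_f_finite: "(\<integral>\<^sup>+w. indicator P w * ennreal (norm (f w) powr p) \<partial>lborel) < \<infinity>"
proof -
  have "(\<integral>\<^sup>+w. ennreal (norm (indicator P w *\<^sub>R (norm (f w) powr p))) \<partial>lborel) < \<infinity>"
    using intf unfolding set_integrable_def integrable_iff_bounded by blast
  also have "(\<lambda>w. ennreal (norm (indicator P w *\<^sub>R (norm (f w) powr p)))) = (\<lambda>w. indicator P w * ennreal (norm (f w) powr p))"
    by (auto simp: indicator_def)
  finally show ?thesis .
qed

text \<open>The disc of radius \<open>s * r\<close> around the point lies in \<open>P\<close> and
  has area of order \<open>s^2\<close>, so the mean value inequality bounds the \<open>p\<close>-th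
  power of the modulus by a multiple of \<open>s powr (- 2)\<close>. Compactness of \<open>K\<close>
  makes \<open>r\<close> uniform.\<close>

lemma growth:
  assumes K: "compact K" "K \<subseteq> P"
  obtains C where "0 \<le> C" "\<And>q s. q \<in> K \<Longrightarrow> 0 < s \<Longrightarrow> s \<le> 1 \<Longrightarrow> norm (f (v + of_real s * (q - v))) \<le> C * s powr (- 2 / p)"
proof -
  obtain r where r: "r > 0" "(\<Union>q\<in>K. cball q r) \<subseteq> P"
    using compact_subset_open_imp_cball_epsilon_subset[OF K(1) openP K(2)] by blast
  define I where "I = (\<integral>\<^sup>+w. indicator P w * ennreal (norm (f w) powr p) \<partial>lborel)"
  have I: "I = ennreal (enn2real I)" using integral_f_finite by (simp add: I_def ennreal_enn2real_if less_top)
  define C where "C = (enn2real I / (pi * r\<^sup>2)) powr (1 / p)"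
  have "norm (f (v + of_real s * (q - v))) \<le> C * s powr (- 2 / p)" if "q \<in> K" "0 < s" "s \<le> 1" for q s
  proof -
    let ?z = "v + of_real s * (q - v)"
    have "ball q r \<subseteq> P" using r that by fastforce
    then have "ennreal (pi * (s * r)\<^sup>2) * ennreal (norm (f ?z) powr p)
      \<le> (\<integral>\<^sup>+w. indicator (ball ?z (s * r)) w * (indicator P w * ennreal (norm (f w) powr p)) \<partial>lborel)"
      using norm_powr_le_integral r that by blast
    also have "\<dots> \<le> I" unfolding I_def
      by (intro nn_integral_mono) (auto simp: indicator_def)
    finally have "pi * (s * r)\<^sup>2 * norm (f ?z) powr p \<le> enn2real I"
      by (subst (asm) I) (simp add: ennreal_mult[symmetric])
    then have "norm (f ?z) powr p \<le> enn2real I / (pi * r\<^sup>2) * s powr (- 2)"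
      using that r by (simp add: field_simps powr_minus power2_eq_square)
    then have "(norm (f ?z) powr p) powr (1 / p) \<le> (enn2real I / (pi * r\<^sup>2) * s powr (- 2)) powr (1 / p)"
      using p by (intro powr_mono2) auto
    moreover have "(A * s powr (- 2)) powr (1 / p) = A powr (1 / p) * s powr (- 2 / p)" if "0 \<le> A" for A
      using that by (simp add: powr_mult powr_powr)
    ultimately show ?thesis using p by (simp add: powr_powr C_def del: times_divide_eq_left)
  qed
  then show ?thesis using that[of C] by (simp add: C_def)
qed

end

section \<open>Integrals along a leg and the logarithm\<close>

text \<open>If the quotient were a real \<open>l \<le> 0\<close>, then \<open>z\<close> would divide
  the segment with weight \<open>1 / (1 - l)\<close> at \<open>b\<close>. So the principal logarithm
  of the quotient is holomorphic in \<open>z\<close> off the segment.\<close>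

lemma quotient_notin_nonpos_Reals:
  fixes a b z :: complex
  assumes "z \<notin> closed_segment a b"
  shows "(b - z) / (a - z) \<notin> \<real>\<^sub>\<le>\<^sub>0"
proof
  assume "(b - z) / (a - z) \<in> \<real>\<^sub>\<le>\<^sub>0"
  then obtain l :: real where l: "(b - z) / (a - z) = of_real l" "l \<le> 0"
    by (auto elim!: nonpos_Reals_cases)
  have "a \<noteq> z" using assms by auto
  then have "b - z = of_real l * (a - z)" using l by (simp add: field_simps)
  then have *: "z * (1 - of_real l) = b - of_real l * a" by (simp add: algebra_simps)
  have "1 - complex_of_real l \<noteq> 0" using l by (auto simp: complex_eq_iff)
  define u where "u = 1 / (1 - l)"
  have u: "0 \<le> u" "u \<le> 1" using l by (auto simp: u_def field_simps)
  have "z = (1 - 1 / (1 - complex_of_real l)) * a + (1 / (1 - of_real l)) * b"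
    using * \<open>1 - complex_of_real l \<noteq> 0\<close> by (simp add: divide_simps)
  then have "z = (1 - u) *\<^sub>R a + u *\<^sub>R b" by (simp add: scaleR_conv_of_real u_def)
  then show False using assms u unfolding closed_segment_def by blast
qed

lemma integrable_indicator_powr:
  fixes a :: real
  assumes "- 1 < a"
  shows "integrable lborel (\<lambda>s. indicator {0<..1} s * s powr a)"
proof -
  have "set_integrable lborel {0..1} (\<lambda>t::real. t powr a)"
    using has_integral_powr_from_0[of a 1] assms
    by (intro set_integrable_has_integral_nonneg) auto
  then have "set_integrable lborel {0<..1} (\<lambda>t::real. t powr a)"
    by (rule set_integrable_subset) auto
  then show ?thesis by (simp add: set_integrable_def)
qed

definition ray :: "complex \<Rightarrow> complex \<Rightarrow> real \<Rightarrow> complex" where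
  "ray v q s = v + of_real s * (q - v)"

text \<open>The contour integral over the segment directed from \<open>q\<close> to
  \<open>v\<close>. Since \<open>ray\<close> runs the other way, the factor is \<open>v - q\<close>.
  The parameter 0 is left out because it corresponds to \<open>v\<close>, a point where
  \<open>f\<close> is not controlled.\<close>

definition leg_integral :: "complex \<Rightarrow> complex \<Rightarrow> (complex \<Rightarrow> complex) \<Rightarrow> complex" where
  "leg_integral q v g = (v - q) * (\<integral>s. indicator {0<..1} s *\<^sub>R g (ray v q s) \<partial>lborel)"

lemma ray_in_segment: "0 \<le> s \<Longrightarrow> s \<le> 1 \<Longrightarrow> ray v q s \<in> closed_segment q v"
  unfolding closed_segment_def ray_def
  by (rule CollectI, rule exI[of _ "1 - s"]) (auto simp: scaleR_conv_of_real algebra_simps)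

lemma norm_ray: "0 \<le> s \<Longrightarrow> norm (ray v q s - v) = s * norm (q - v)"
  by (simp add: ray_def norm_mult)

lemma continuous_ray [continuous_intros]: "continuous_on A (ray v q)"
  unfolding ray_def by (intro continuous_intros)

lemma has_vector_derivative_ray: "(ray v q has_vector_derivative (q - v)) (at s within A)"
  unfolding ray_def by (auto intro!: derivative_eq_intros)

text \<open>A primitive in \<open>t\<close> is \<open>Ln ((t - z) / (q - z))\<close>: the part of
  the leg from \<open>q\<close> to \<open>t\<close> misses \<open>z\<close>, so the branch cut is
  never met, and the value at \<open>t = q\<close> is \<open>Ln 1 = 0\<close>.\<close>

lemma leg_integral_inverse:
  assumes z: "z \<notin> closed_segment q v"
  shows "integrable lborel (\<lambda>s. indicator {0<..1} s *\<^sub>R (1 / (ray v q s - z)))"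
    and "leg_integral q v (\<lambda>t. 1 / (t - z)) = Ln ((v - z) / (q - z))"
proof -
  let ?g = "\<lambda>s. 1 / (ray v q s - z)"
  have ne: "ray v q s - z \<noteq> 0" if "s \<in> {0..1}" for s
    using z ray_in_segment[of s v q] that by auto
  have cont: "continuous_on {0..1} ?g"
    by (intro continuous_intros) (use ne in auto)
  have int: "set_integrable lborel {0..1} ?g" by (rule borel_integrable_atLeastAtMost'[OF cont])
  then have int': "set_integrable lborel {0<..1} ?g" by (rule set_integrable_subset) auto
  then show "integrable lborel (\<lambda>s. indicator {0<..1} s *\<^sub>R ?g s)" by (simp add: set_integrable_def)
  have qz: "q - z \<noteq> 0" using z by auto
  have "((\<lambda>s. (q - v) * ?g s) has_integral Ln ((ray v q 1 - z) / (q - z)) - Ln ((ray v q 0 - z) / (q - z))) {0..1}"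
  proof (rule fundamental_theorem_of_calculus)
    fix s :: real assume s: "s \<in> {0..1}"
    have "closed_segment q (ray v q s) \<subseteq> closed_segment q v"
      using ray_in_segment[of s v q] s by (simp add: subset_closed_segment)
    then have "(ray v q s - z) / (q - z) \<notin> \<real>\<^sub>\<le>\<^sub>0" using z quotient_notin_nonpos_Reals by blast
    then have "((\<lambda>t. Ln ((t - z) / (q - z))) has_field_derivative 1 / (ray v q s - z)) (at (ray v q s))"
      using qz ne[OF s] by (auto intro!: derivative_eq_intros simp: divide_simps)
    from field_vector_diff_chain_within[OF has_vector_derivative_ray[of v q s "{0..1}"] has_field_derivative_at_within[OF this]]
    show "((\<lambda>s. Ln ((ray v q s - z) / (q - z))) has_vector_derivative (q - v) * ?g s) (at s within {0..1})"
      by (simp add: o_def)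
  qed simp
  then have "integral {0..1} (\<lambda>s. (q - v) * ?g s) = - Ln ((v - z) / (q - z))"
    using qz by (simp add: integral_unique ray_def)
  moreover have "integral {0..1} (\<lambda>s. (q - v) * ?g s) = (q - v) * integral {0..1} ?g" by (rule integral_mult_right)
  moreover have "integral {0..1} ?g = (LINT s:{0..1}|lborel. ?g s)"
    by (rule set_borel_integral_eq_integral(2)[OF int, symmetric])
  moreover have "(LINT s:{0..1}|lborel. ?g s) = (LINT s:{0<..1}|lborel. ?g s)"
    unfolding set_lebesgue_integral_def
    by (rule integral_cong_AE) (use int int' in \<open>auto simp: set_integrable_def AE_lborel_singleton indicator_def
      intro!: eventually_mono[OF AE_lborel_singleton[of "0::real"]]\<close>)
  ultimately have "(q - v) * (LINT s:{0<..1}|lborel. ?g s) = - Ln ((v - z) / (q - z))"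
    by metis
  then show "leg_integral q v (\<lambda>t. 1 / (t - z)) = Ln ((v - z) / (q - z))"
    unfolding leg_integral_def set_lebesgue_integral_def by (simp add: left_diff_distrib eq_neg_iff_add_eq_0 algebra_simps)
qed

section \<open>The leg integral J with the reflected kernel\<close>

context bergman_corner
begin

lemma ray_in: "q \<in> P \<Longrightarrow> 0 < s \<Longrightarrow> s \<le> 1 \<Longrightarrow> ray v q s \<in> P"
  unfolding ray_def by (rule leg_in)

text \<open>Otherwise \<open>v\<close> would be the midpoint of two points of the convex set
  \<open>P\<close>.\<close>

lemma reflection_nonzero:
  assumes "z \<in> P" "t \<in> P" shows "t + z - 2 * v \<noteq> 0"
proof
  assume "t + z - 2 * v = 0"
  then have "t = 2 * v - z" by (simp add: algebra_simps)
  then have "v = (1 / 2) *\<^sub>R t + (1 / 2) *\<^sub>R z" by (simp add: scaleR_conv_of_real field_simps)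
  also have "\<dots> \<in> P" using convexP assms by (intro convexD) auto
  finally show False using vP by simp
qed

text \<open>\<open>K z t\<close> is \<open>1 / (t - z) + 1 / (t + z - 2 * v)\<close>, and \<open>M z t\<close> is \<open>f t * K z t\<close> with the pole at
  \<open>t = z\<close> subtracted, so that \<open>M z\<close> is holomorphic on \<open>P\<close>.\<close>

definition K :: "complex \<Rightarrow> complex \<Rightarrow> complex" where
  "K z t = 2 * (t - v) / ((t - z) * (t + z - 2 * v))"

definition M :: "complex \<Rightarrow> complex \<Rightarrow> complex" where
  "M z t = (if t = z then deriv f z else (f t - f z) / (t - z)) + f t / (t + z - 2 * v)"

definition J :: "complex \<Rightarrow> complex \<Rightarrow> complex" where
  "J q z = leg_integral q v (\<lambda>t. f t * K z t)"

definition N :: "complex \<Rightarrow> complex \<Rightarrow> complex" where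
  "N q z = leg_integral q v (M z)"

lemma reflection_eq: "t + z = 2 * v \<longleftrightarrow> t = 2 * v - z"
  by (auto simp: algebra_simps)

lemma growth_ray:
  assumes "q \<in> P"
  obtains C where "0 \<le> C" "\<And>s. 0 < s \<Longrightarrow> s \<le> 1 \<Longrightarrow> norm (f (ray v q s)) \<le> C * s powr (- 2 / p)"
proof -
  have "compact {q}" "{q} \<subseteq> P" using assms by auto
  then obtain C where "0 \<le> C" "\<And>q' s. q' \<in> {q} \<Longrightarrow> 0 < s \<Longrightarrow> s \<le> 1 \<Longrightarrow> norm (f (v + of_real s * (q' - v))) \<le> C * s powr (- 2 / p)"
    using growth by blast
  then show ?thesis using that[of C] by (simp add: ray_def)
qed

lemma M_eq: "t \<noteq> z \<Longrightarrow> t + z - 2 * v \<noteq> 0 \<Longrightarrow> M z t = f t * K z t - f z / (t - z)"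
  by (simp add: M_def K_def divide_simps) (simp add: algebra_simps)

lemma measurable_on_ray:
  fixes g :: "complex \<Rightarrow> 'a::real_normed_vector"
  assumes "continuous_on A g" "\<And>s. 0 < s \<Longrightarrow> s \<le> 1 \<Longrightarrow> ray v q s \<in> A"
  shows "(\<lambda>s. indicator {0<..1} s *\<^sub>R g (ray v q s)) \<in> borel_measurable borel"
  by (rule borel_measurable_continuous_on_indicator)
    (use assms in \<open>auto intro!: continuous_on_compose2[OF assms(1)] continuous_intros\<close>)

lemma contf: "continuous_on P f"
  using holf by (rule holomorphic_on_imp_continuous_on)

text \<open>The zero of \<open>K z\<close> at \<open>t = v\<close> gains a factor \<open>s\<close>
  against the growth of \<open>f\<close>, and \<open>s powr (1 - 2 / p)\<close> is integrable. The
  majorant depends on \<open>z\<close> only through \<open>r\<close>, as holomorphy in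
  \<open>z\<close> requires.\<close>

lemma J_integrand_bound:
  assumes q: "q \<in> P" and r: "0 < r"
  obtains h where "integrable lborel h"
    "\<And>z s. (\<And>t. t \<in> closed_segment q v \<Longrightarrow> r \<le> norm (t - z) \<and> r \<le> norm (t + z - 2 * v)) \<Longrightarrow>
      norm (indicator {0<..1} s *\<^sub>R (f (ray v q s) * K z (ray v q s))) \<le> h s"
proof -
  obtain C where C: "0 \<le> C" "\<And>s. 0 < s \<Longrightarrow> s \<le> 1 \<Longrightarrow> norm (f (ray v q s)) \<le> C * s powr (- 2 / p)"
    using growth_ray[OF q] by blast
  define h where "h s = (C * (2 * norm (q - v) / r\<^sup>2)) * (indicator {0<..1} s * s powr (1 - 2 / p))" for s
  have "integrable lborel h"
    unfolding h_def using p by (intro integrable_mult_right integrable_indicator_powr) (simp add: field_simps)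
  moreover have "norm (indicator {0<..1} s *\<^sub>R (f (ray v q s) * K z (ray v q s))) \<le> h s"
    if z: "\<And>t. t \<in> closed_segment q v \<Longrightarrow> r \<le> norm (t - z) \<and> r \<le> norm (t + z - 2 * v)" for z s
  proof (cases "s \<in> {0<..1}")
    case True
    let ?t = "ray v q s"
    have t: "r \<le> norm (?t - z)" "r \<le> norm (?t + z - 2 * v)"
      using z[OF ray_in_segment[of s v q]] True by auto
    have "r\<^sup>2 \<le> norm (?t - z) * norm (?t + z - 2 * v)"
      unfolding power2_eq_square using t r by (intro mult_mono) auto
    then have "norm (K z ?t) \<le> 2 * (s * norm (q - v)) / r\<^sup>2"
      unfolding K_def norm_divide norm_mult
      using True r by (intro frac_le) (auto simp: norm_ray)
    then have "norm (f ?t) * norm (K z ?t) \<le> (C * s powr (- 2 / p)) * (2 * (s * norm (q - v)) / r\<^sup>2)"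
      using C True by (intro mult_mono) auto
    also have "\<dots> = (C * (2 * norm (q - v) / r\<^sup>2)) * (s powr (- 2 / p) * s)" by simp
    also have "s powr (- 2 / p) * s = s powr (1 - 2 / p)"
      using True by (simp add: powr_diff powr_minus field_simps)
    finally show ?thesis using True by (simp add: h_def norm_mult)
  qed (simp add: h_def)
  ultimately show ?thesis using that by blast
qed

lemma J_measurable:
  assumes q: "q \<in> P" and z: "z \<notin> closed_segment q v" "2 * v - z \<notin> closed_segment q v"
  shows "(\<lambda>s. indicator {0<..1} s *\<^sub>R (f (ray v q s) * K z (ray v q s))) \<in> borel_measurable borel"
proof (rule measurable_on_ray[where A = "P \<inter> closed_segment q v"])
  show "continuous_on (P \<inter> closed_segment q v) (\<lambda>t. f t * K z t)"
    unfolding K_def using z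
    by (intro continuous_intros continuous_on_subset[OF contf]) (auto simp: reflection_eq)
qed (use ray_in[OF q] ray_in_segment in \<open>auto simp: less_imp_le\<close>)

lemma open_off_leg: "open {z. z \<notin> closed_segment q v \<and> 2 * v - z \<notin> closed_segment q v}"
proof -
  have "{z. z \<notin> closed_segment q v \<and> 2 * v - z \<notin> closed_segment q v}
      = - closed_segment q v \<inter> (\<lambda>z. 2 * v - z) -` (- closed_segment q v)" by auto
  moreover have "open ((\<lambda>z. 2 * v - z) -` (- closed_segment q v))"
    by (rule open_vimage) (auto intro!: continuous_intros simp: open_Compl)
  ultimately show ?thesis by (simp add: open_Int open_Compl)
qed

lemma off_leg_ball:
  assumes z0: "z0 \<notin> closed_segment q v" "2 * v - z0 \<notin> closed_segment q v"
  obtains r where "0 < r" "\<And>z t. z \<in> ball z0 r \<Longrightarrow> t \<in> closed_segment q v \<Longrightarrow> r \<le> norm (t - z) \<and> r \<le> norm (t + z - 2 * v)"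
proof -
  obtain e where e: "e > 0" "ball z0 e \<subseteq> {z. z \<notin> closed_segment q v \<and> 2 * v - z \<notin> closed_segment q v}"
    using open_off_leg[of q] z0 openE[of _ z0] by (metis (mono_tags, lifting) mem_Collect_eq)
  have "e / 2 \<le> norm (t - z) \<and> e / 2 \<le> norm (t + z - 2 * v)" if z: "z \<in> ball z0 (e / 2)" and t: "t \<in> closed_segment q v" for z t
  proof -
    have "t \<notin> ball z0 e" using e t by auto
    moreover have "2 * v - t \<notin> ball z0 e" using e t by auto
    moreover have "dist z0 t \<le> dist z0 z + dist z t" "dist z0 (2 * v - t) \<le> dist z0 z + dist z (2 * v - t)"
      by (rule dist_triangle)+
    moreover have "dist z (2 * v - t) = norm (t + z - 2 * v)" by (simp add: dist_norm algebra_simps)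
    ultimately show ?thesis using z by (auto simp: dist_norm norm_minus_commute)
  qed
  then show ?thesis using that[of "e / 2"] e by auto
qed

lemma J_integrable:
  assumes q: "q \<in> P" and z: "z \<notin> closed_segment q v" "2 * v - z \<notin> closed_segment q v"
  shows "integrable lborel (\<lambda>s. indicator {0<..1} s *\<^sub>R (f (ray v q s) * K z (ray v q s)))"
proof -
  obtain r where r: "0 < r" "\<And>t. t \<in> closed_segment q v \<Longrightarrow> r \<le> norm (t - z) \<and> r \<le> norm (t + z - 2 * v)"
    using off_leg_ball[OF z] by (metis centre_in_ball)
  obtain h where h: "integrable lborel h" "\<And>s. norm (indicator {0<..1} s *\<^sub>R (f (ray v q s) * K z (ray v q s))) \<le> h s"
    using J_integrand_bound[OF q r(1)] r(2) by (metis (lifting))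
  show ?thesis
    by (rule Bochner_Integration.integrable_bound[OF h(1)])
      (use J_measurable[OF q z] h(2) in \<open>auto intro!: AE_I2 intro: order_trans[OF _ abs_ge_self]\<close>)
qed

lemma J_holomorphic:
  assumes q: "q \<in> P"
  shows "J q holomorphic_on {z. z \<notin> closed_segment q v \<and> 2 * v - z \<notin> closed_segment q v}"
  unfolding J_def leg_integral_def
proof (intro holomorphic_on_mult holomorphic_on_const holomorphic_on_integral_dominated open_off_leg)
  let ?U = "{z. z \<notin> closed_segment q v \<and> 2 * v - z \<notin> closed_segment q v}"
  show "(\<lambda>s. indicator {0<..1} s *\<^sub>R (f (ray v q s) * K z (ray v q s))) \<in> borel_measurable lborel" if "z \<in> ?U" for z
    using J_measurable[OF q] that by simp
  show "(\<lambda>z. indicator {0<..1} s *\<^sub>R (f (ray v q s) * K z (ray v q s))) holomorphic_on ?U" for s :: real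
  proof (cases "s \<in> {0<..1}")
    case True
    then have "ray v q s \<in> closed_segment q v" using ray_in_segment by auto
    then have "ray v q s \<noteq> z" "ray v q s + z - 2 * v \<noteq> 0" if "z \<in> ?U" for z
      using that by (auto simp: reflection_eq)
    then show ?thesis using True unfolding K_def by (auto intro!: holomorphic_intros)
  qed simp
  fix z0 assume "z0 \<in> ?U"
  then obtain r where r: "0 < r" "\<And>z t. z \<in> ball z0 r \<Longrightarrow> t \<in> closed_segment q v \<Longrightarrow> r \<le> norm (t - z) \<and> r \<le> norm (t + z - 2 * v)"
    using off_leg_ball by blast
  obtain h where h: "integrable lborel h"
    "\<And>z s. (\<And>t. t \<in> closed_segment q v \<Longrightarrow> r \<le> norm (t - z) \<and> r \<le> norm (t + z - 2 * v)) \<Longrightarrow>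
      norm (indicator {0<..1} s *\<^sub>R (f (ray v q s) * K z (ray v q s))) \<le> h s"
    using J_integrand_bound[OF q r(1)] by blast
  have U: "z \<in> ?U" if "z \<in> ball z0 r" for z
  proof -
    have "z \<notin> closed_segment q v" using r(1) r(2)[OF that, of z] by auto
    moreover have "2 * v - z \<notin> closed_segment q v" using r(1) r(2)[OF that, of "2 * v - z"] by auto
    ultimately show ?thesis by simp
  qed
  have "\<forall>z\<in>ball z0 r. z \<in> ?U \<and>
      (\<forall>s\<in>space lborel. norm (indicator {0<..1} s *\<^sub>R (f (ray v q s) * K z (ray v q s))) \<le> h s)"
    by (intro ballI conjI U h(2) r(2))
  then show "\<exists>r>0. \<exists>h. integrable lborel h \<and> (\<forall>z\<in>ball z0 r. z \<in> ?U \<and>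
      (\<forall>s\<in>space lborel. norm (indicator {0<..1} s *\<^sub>R (f (ray v q s) * K z (ray v q s))) \<le> h s))"
    by (intro exI[of _ r] exI[of _ h] conjI r(1) h(1))
qed

end

lemma compact_norm_bound:
  fixes f :: "complex \<Rightarrow> complex"
  assumes "continuous_on S f" "compact S"
  obtains B where "0 \<le> B" "\<And>z. z \<in> S \<Longrightarrow> norm (f z) \<le> B"
proof -
  have "bounded (f ` S)" using assms by (intro compact_imp_bounded compact_continuous_image)
  then obtain B where "\<And>z. z \<in> S \<Longrightarrow> norm (f z) \<le> B" by (auto simp: bounded_iff)
  then have "\<And>z. z \<in> S \<Longrightarrow> norm (f z) \<le> max 0 B" by fastforce
  then show ?thesis using that[of "max 0 B"] by simp
qed

section \<open>Continuation across the leg and change of leg\<close>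

context bergman_corner
begin

text \<open>For \<open>t\<close> near \<open>z0\<close> the difference quotient is bounded by the
  derivative of \<open>f\<close> on a compact disc. For the other \<open>t\<close> the term with
  \<open>f z\<close> is split off by \<open>M_eq\<close>, and \<open>K\<close> supplies the factor
  \<open>t - v\<close>. That factor is kept in the majorant because \<open>f\<close> alone may fail
  to be integrable along a leg.\<close>

lemma M_local_bound:
  assumes z0: "z0 \<in> P"
  obtains r B where "0 < r" "ball z0 r \<subseteq> P" "0 \<le> B"
    "\<And>z t. z \<in> ball z0 r \<Longrightarrow> t \<in> P \<Longrightarrow> norm (M z t) \<le> B * (1 + norm (f t) * norm (t - v))"
proof -
  obtain r' where r': "r' > 0" "cball z0 r' \<subseteq> P" using openP z0 open_contains_cball by blast
  \<comment> \<open>The point \<open>z\<close> ranges over radius \<open>r\<close>, the near range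
    of \<open>t\<close> has radius \<open>2 * r\<close>, and radius \<open>3 * r\<close> is still
    inside \<open>P\<close>. This leaves a gap \<open>r\<close> between \<open>z\<close> and the far
    \<open>t\<close>, and a gap \<open>2 * r\<close> between \<open>z\<close> and the reflection of
    \<open>t\<close>, which lies outside \<open>P\<close>.\<close>
  define r where "r = r' / 3"
  have r: "r > 0" "cball z0 (3 * r) \<subseteq> P" using r' by (auto simp: r_def)
  have sub2: "cball z0 (2 * r) \<subseteq> cball z0 (3 * r)" using r by (simp add: subset_cball)
  obtain B0 where B01: "0 \<le> B0" and B0: "\<And>z. z \<in> cball z0 (3 * r) \<Longrightarrow> norm (f z) \<le> B0"
    using compact_norm_bound[OF continuous_on_subset[OF contf r(2)] compact_cball] by blast
  have hold: "deriv f holomorphic_on P" using holf openP by (rule holomorphic_deriv)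
  obtain B1 where B11: "0 \<le> B1" and B1: "\<And>z. z \<in> cball z0 (3 * r) \<Longrightarrow> norm (deriv f z) \<le> B1"
    using compact_norm_bound[OF continuous_on_subset[OF holomorphic_on_imp_continuous_on[OF hold] r(2)] compact_cball] by blast
  note B01 = B01 B11
  define B where "B = B1 + B0 / (2 * r) + B0 / r + 1 / (r * r)"
  have "0 \<le> B0 / (2 * r)" "0 \<le> B0 / r" "0 \<le> 1 / (r * r)" using B01 r by simp_all
  then have B_ge: "B1 + B0 / (2 * r) \<le> B" "0 \<le> B" "B0 / r \<le> B" "1 / (r * r) \<le> B"
    unfolding B_def using B01 by linarith+
  have "norm (M z t) \<le> B * (1 + norm (f t) * norm (t - v))" if z: "z \<in> ball z0 r" and t: "t \<in> P" for z t
  proof -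
    have zP: "z \<in> cball z0 (3 * r)" using z r by auto
    have "2 * v - t \<notin> P" using reflection_nonzero[of "2 * v - t" t] t by auto
    then have "2 * v - t \<notin> cball z0 (3 * r)" using r by blast
    then have "3 * r < dist z0 z + dist z (2 * v - t)" using dist_triangle[of z0 "2 * v - t" z] by simp
    then have far: "2 * r \<le> norm (t + z - 2 * v)"
      using z by (simp add: dist_norm algebra_simps)
    have ne: "t + z - 2 * v \<noteq> 0" using far r by auto
    show ?thesis
    proof (cases "t \<in> cball z0 (2 * r)")
      case True
      have t3: "t \<in> cball z0 (3 * r)" using True sub2 by blast
      have "norm (if t = z then deriv f z else (f t - f z) / (t - z)) \<le> B1"
      proof (cases "t = z")
        case False
        have "norm (f t - f z) \<le> B1 * norm (t - z)"
        proof (rule field_differentiable_bound[OF convex_cball[of z0 "3 * r"] _ B1])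
          fix w assume "w \<in> cball z0 (3 * r)"
          then show "(f has_field_derivative deriv f w) (at w within cball z0 (3 * r))"
            using r holomorphic_derivI[OF holf openP] has_field_derivative_at_within by blast
        qed (use t3 zP in auto)
        then show ?thesis using False by (simp add: norm_divide divide_le_eq)
      qed (use B1[OF zP] in simp)
      moreover have "norm (f t / (t + z - 2 * v)) \<le> B0 / (2 * r)"
        unfolding norm_divide using B0[OF t3] B01 far r by (intro frac_le) auto
      ultimately have "norm (M z t) \<le> B1 + B0 / (2 * r)"
        unfolding M_def by (rule norm_triangle_mono)
      also note B_ge(1)
      also have "B \<le> B * (1 + norm (f t) * norm (t - v))"
        using mult_left_mono[of 1 "1 + norm (f t) * norm (t - v)" B] B_ge by simp
      finally show ?thesis .
    next
      case False
      then have "2 * r < dist z0 z + dist z t" using dist_triangle[of z0 t z] by simp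
      then have near: "r \<le> norm (t - z)" using z by (simp add: dist_norm norm_minus_commute)
      then have "t \<noteq> z" using r by auto
      have "r * (2 * r) \<le> norm (t - z) * norm (t + z - 2 * v)"
        using near far r by (intro mult_mono) auto
      then have "norm (K z t) \<le> 2 * norm (t - v) / (r * (2 * r))"
        unfolding K_def norm_divide norm_mult using r by (intro frac_le) auto
      then have "norm (f t * K z t) \<le> norm (f t) * (2 * norm (t - v) / (r * (2 * r)))"
        unfolding norm_mult by (rule mult_left_mono) simp
      also have "\<dots> = (1 / (r * r)) * (norm (f t) * norm (t - v))" by simp
      finally have "norm (f t * K z t) \<le> (1 / (r * r)) * (norm (f t) * norm (t - v))" .
      moreover have "norm (f z / (t - z)) \<le> B0 / r"
        unfolding norm_divide using B0[OF zP] B01 near r by (intro frac_le) auto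
      ultimately have "norm (M z t) \<le> (1 / (r * r)) * (norm (f t) * norm (t - v)) + B0 / r"
        unfolding M_eq[OF \<open>t \<noteq> z\<close> ne] by (rule order_trans[OF norm_triangle_ineq4 add_mono])
      also have "\<dots> \<le> B * (norm (f t) * norm (t - v)) + B"
        using B_ge by (intro add_mono mult_right_mono) auto
      finally show ?thesis by (simp add: algebra_simps)
    qed
  qed
  moreover have "ball z0 r \<subseteq> P"
    using r(2) by (rule order_trans[rotated]) (use r(1) in auto)
  ultimately show ?thesis using that[of r B] r(1) B_ge(2) by blast
qed

lemma M_bound:
  assumes z0: "z0 \<in> P"
  obtains B where "0 \<le> B" "\<And>t. t \<in> P \<Longrightarrow> norm (M z0 t) \<le> B * (1 + norm (f t) * norm (t - v))"
  using M_local_bound[OF z0] by (metis centre_in_ball)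

lemma M_holomorphic:
  assumes z: "z \<in> P"
  shows "M z holomorphic_on P"
  unfolding M_def[abs_def]
proof (intro holomorphic_on_add holomorphic_on_divide)
  show "(\<lambda>t. if t = z then deriv f z else (f t - f z) / (t - z)) holomorphic_on P"
    by (rule pole_lemma_open[OF holf openP])
qed (use holf z reflection_nonzero in \<open>auto intro!: holomorphic_intros\<close>)

text \<open>The difference quotient is symmetric in \<open>t\<close> and \<open>z\<close>, so the
  singularity at \<open>z = t\<close> is removable for the same reason as the one at
  \<open>t = z\<close>.\<close>

lemma M_holomorphic_param:
  assumes t: "t \<in> P"
  shows "(\<lambda>z. M z t) holomorphic_on P"
proof -
  have "(\<lambda>z. (if z = t then deriv f t else (f z - f t) / (z - t)) + f t / (t + z - 2 * v)) holomorphic_on P"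
    using reflection_nonzero[OF _ t] reflection_nonzero[OF t]
    by (intro holomorphic_on_add holomorphic_on_divide pole_lemma_open[OF holf openP] holomorphic_intros)
      (auto simp: algebra_simps)
  moreover have "(if z = t then deriv f t else (f z - f t) / (z - t)) = (if t = z then deriv f z else (f t - f z) / (t - z))" for z
    by (auto simp: divide_simps) (auto simp: algebra_simps)
  ultimately show ?thesis by (simp add: M_def)
qed

lemma ray_dominated:
  assumes q: "q \<in> P" and B: "0 \<le> B"
  obtains h where "integrable lborel h"
    "\<And>g s. (\<And>t. t \<in> P \<Longrightarrow> norm (g t) \<le> B * (1 + norm (f t) * norm (t - v))) \<Longrightarrow>
      norm (indicator {0<..1} s *\<^sub>R (g (ray v q s) :: complex)) \<le> h s"
proof -
  obtain C where C: "0 \<le> C" "\<And>s. 0 < s \<Longrightarrow> s \<le> 1 \<Longrightarrow> norm (f (ray v q s)) \<le> C * s powr (- 2 / p)"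
    using growth_ray[OF q] by blast
  define h where "h s = B * (indicator {0<..1} s * s powr 0)
    + B * (C * norm (q - v)) * (indicator {0<..1} s * s powr (1 - 2 / p))" for s
  have "integrable lborel h"
    unfolding h_def using p
    by (intro Bochner_Integration.integrable_add integrable_mult_right integrable_indicator_powr) (auto simp: field_simps)
  moreover have "norm (indicator {0<..1} s *\<^sub>R g (ray v q s)) \<le> h s"
    if g: "\<And>t. t \<in> P \<Longrightarrow> norm (g t) \<le> B * (1 + norm (f t) * norm (t - v))" for g :: "complex \<Rightarrow> complex" and s
  proof (cases "s \<in> {0<..1}")
    case True
    let ?t = "ray v q s"
    have "norm (g ?t) \<le> B * (1 + norm (f ?t) * norm (?t - v))" using g ray_in[OF q] True by auto
    also have "\<dots> \<le> B * (1 + (C * s powr (- 2 / p)) * (s * norm (q - v)))"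
      using B C True by (intro mult_left_mono add_left_mono mult_mono) (auto simp: norm_ray)
    also have "(C * s powr (- 2 / p)) * (s * norm (q - v)) = (C * norm (q - v)) * (s powr (- 2 / p) * s)" by simp
    also have "s powr (- 2 / p) * s = s powr (1 - 2 / p)"
      using True by (simp add: powr_diff powr_minus field_simps)
    finally show ?thesis using True by (simp add: h_def algebra_simps)
  qed (simp add: h_def)
  ultimately show ?thesis using that by blast
qed

lemma M_integrable:
  assumes q: "q \<in> P" and z: "z \<in> P"
  shows "integrable lborel (\<lambda>s. indicator {0<..1} s *\<^sub>R M z (ray v q s))"
proof -
  obtain B where B: "0 \<le> B" "\<And>t. t \<in> P \<Longrightarrow> norm (M z t) \<le> B * (1 + norm (f t) * norm (t - v))"
    using M_bound[OF z] by blast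
  obtain h where h: "integrable lborel h" "\<And>s. norm (indicator {0<..1} s *\<^sub>R M z (ray v q s)) \<le> h s"
    using ray_dominated[OF q B(1)] B(2) by (metis (lifting))
  show ?thesis
  proof (rule Bochner_Integration.integrable_bound[OF h(1)])
    show "(\<lambda>s. indicator {0<..1} s *\<^sub>R M z (ray v q s)) \<in> borel_measurable lborel"
      using measurable_on_ray[OF holomorphic_on_imp_continuous_on[OF M_holomorphic[OF z]] ray_in[OF q]] by simp
  qed (use h(2) in \<open>auto intro!: AE_I2 intro: order_trans[OF _ abs_ge_self]\<close>)
qed

text \<open>In contrast to \<open>J\<close>, points of the leg are not exceptional, since
  \<open>M z t\<close> has no pole at \<open>t = z\<close>. The local majorant is therefore
  available on all of \<open>P\<close>.\<close>

lemma N_holomorphic: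
  assumes q: "q \<in> P"
  shows "N q holomorphic_on P"
  unfolding N_def leg_integral_def
proof (intro holomorphic_on_mult holomorphic_on_const holomorphic_on_integral_dominated openP)
  show "(\<lambda>s. indicator {0<..1} s *\<^sub>R M z (ray v q s)) \<in> borel_measurable lborel" if "z \<in> P" for z
    using M_integrable[OF q that] by (rule borel_measurable_integrable)
  show "(\<lambda>z. indicator {0<..1} s *\<^sub>R M z (ray v q s)) holomorphic_on P" for s :: real
    using M_holomorphic_param[OF ray_in[OF q, of s]] by (cases "s \<in> {0<..1}") (auto simp: scaleR_conv_of_real)
  fix z0 assume z0: "z0 \<in> P"
  obtain r B where r: "0 < r" "ball z0 r \<subseteq> P" and B: "0 \<le> B"
    "\<And>z t. z \<in> ball z0 r \<Longrightarrow> t \<in> P \<Longrightarrow> norm (M z t) \<le> B * (1 + norm (f t) * norm (t - v))"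
    using M_local_bound[OF z0] by blast
  obtain h where h: "integrable lborel h"
    "\<And>g s. (\<And>t. t \<in> P \<Longrightarrow> norm (g t) \<le> B * (1 + norm (f t) * norm (t - v))) \<Longrightarrow>
      norm (indicator {0<..1} s *\<^sub>R (g (ray v q s) :: complex)) \<le> h s"
    using ray_dominated[OF q B(1)] by blast
  have "\<forall>z\<in>ball z0 r. z \<in> P \<and> (\<forall>s\<in>space lborel. norm (indicator {0<..1} s *\<^sub>R M z (ray v q s)) \<le> h s)"
    using r(2) h(2) B(2) by blast
  then show "\<exists>r>0. \<exists>h. integrable lborel h \<and> (\<forall>z\<in>ball z0 r. z \<in> P \<and>
      (\<forall>s\<in>space lborel. norm (indicator {0<..1} s *\<^sub>R M z (ray v q s)) \<le> h s))"
    using r(1) h(1) by blast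
qed

lemma segment_reflection:
  assumes "z \<in> P" "q \<in> P" shows "2 * v - z \<notin> closed_segment q v"
proof
  assume "2 * v - z \<in> closed_segment q v"
  then obtain u where u: "0 \<le> u" "u \<le> 1" "2 * v - z = (1 - u) *\<^sub>R q + u *\<^sub>R v"
    by (auto simp: closed_segment_def)
  show False
  proof (cases "u = 1")
    case True then show ?thesis using u assms vP by simp
  next
    case False
    then have "2 * v - z = ray v q (1 - u)" using u by (simp add: ray_def scaleR_conv_of_real algebra_simps)
    then have "2 * v - z \<in> P" using ray_in[OF assms(2), of "1 - u"] u False by simp
    then show False using reflection_nonzero[OF assms(1), of "2 * v - z"] by simp
  qed
qed

text \<open>Off the leg the subtracted term \<open>f z / (t - z)\<close> can be integrated on its
  own, and its integral is \<open>f z\<close> times a logarithm.\<close>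

lemma N_eq_J:
  assumes q: "q \<in> P" and z: "z \<in> P" "z \<notin> closed_segment q v"
  shows "N q z = J q z - f z * Ln ((v - z) / (q - z))"
proof -
  have refl: "2 * v - z \<notin> closed_segment q v" by (rule segment_reflection[OF z(1) q])
  have eq: "indicator {0<..1} s *\<^sub>R M z (ray v q s)
      = indicator {0<..1} s *\<^sub>R (f (ray v q s) * K z (ray v q s)) - f z * (indicator {0<..1} s *\<^sub>R (1 / (ray v q s - z)))" for s
  proof (cases "s \<in> {0<..1}")
    case True
    then have "ray v q s \<noteq> z" "ray v q s + z - 2 * v \<noteq> 0"
      using ray_in_segment[of s v q] z ray_in[OF q, of s] reflection_nonzero by auto
    then show ?thesis using True by (simp add: M_eq)
  qed simp
  have "N q z = (v - q) * ((\<integral>s. indicator {0<..1} s *\<^sub>R (f (ray v q s) * K z (ray v q s)) \<partial>lborel)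
      - f z * (\<integral>s. indicator {0<..1} s *\<^sub>R (1 / (ray v q s - z)) \<partial>lborel))"
    unfolding N_def leg_integral_def eq
    by (subst Bochner_Integration.integral_diff[OF J_integrable[OF q z(2) refl] integrable_mult_right[OF leg_integral_inverse(1)[OF z(2)]]])
      (simp only: integral_mult_right_zero)
  also have "\<dots> = J q z - f z * leg_integral q v (\<lambda>t. 1 / (t - z))"
    by (simp add: J_def leg_integral_def algebra_simps)
  finally show ?thesis by (simp add: leg_integral_inverse(2)[OF z(2)])
qed

text \<open>The primitive is only given on \<open>P\<close>, so the fundamental theorem of calculus
  is applied to the leg cut off at parameter \<open>1 / Suc n\<close>; integrability of
  \<open>M z\<close> along the whole leg gives the limit.\<close>

lemma N_eq_primitive_limit:
  assumes q: "q \<in> P" and z: "z \<in> P"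
    and G: "\<And>t. t \<in> P \<Longrightarrow> (G has_field_derivative M z t) (at t)"
  shows "(\<lambda>n. G (ray v q (1 / Suc n)) - G q) \<longlonglongrightarrow> N q z"
proof -
  define i where "i n s = indicator {1 / real (Suc n)..1} s *\<^sub>R M z (ray v q s)" for n s
  have i_eq: "i n s = indicator {1 / real (Suc n)..1} s *\<^sub>R (indicator {0<..1} s *\<^sub>R M z (ray v q s))" for n s
    by (auto simp: i_def indicator_def intro: less_le_trans[rotated])
  have "(\<lambda>n. \<integral>s. i n s \<partial>lborel) \<longlonglongrightarrow> (\<integral>s. indicator {0<..1} s *\<^sub>R M z (ray v q s) \<partial>lborel)"
  proof (rule integral_dominated_convergence)
    let ?w = "\<lambda>s. norm (indicator {0<..1} s *\<^sub>R M z (ray v q s))"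
    note int = M_integrable[OF q z]
    show "integrable lborel ?w" using int by (rule integrable_norm)
    show "(\<lambda>s. indicator {0<..1} s *\<^sub>R M z (ray v q s)) \<in> borel_measurable lborel"
      using int by (rule borel_measurable_integrable)
    show "i n \<in> borel_measurable lborel" for n
      unfolding i_eq[abs_def] using borel_measurable_integrable[OF int] by measurable
    show "AE s in lborel. norm (i n s) \<le> ?w s" for n
      unfolding i_eq by (intro AE_I2) (auto simp: indicator_def)
    show "AE s in lborel. (\<lambda>n. i n s) \<longlonglongrightarrow> indicator {0<..1} s *\<^sub>R M z (ray v q s)"
    proof (intro AE_I2)
      fix s :: real
      show "(\<lambda>n. i n s) \<longlonglongrightarrow> indicator {0<..1} s *\<^sub>R M z (ray v q s)"
      proof (cases "s \<in> {0<..1}")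
        case True
        then obtain n0 where n0: "1 / real (Suc n0) < s" using nat_approx_posE by (metis greaterThanAtMost_iff)
        have "\<forall>\<^sub>F n in sequentially. i n s = indicator {0<..1} s *\<^sub>R M z (ray v q s)"
          using eventually_ge_at_top[of n0]
        proof eventually_elim
          case (elim n)
          then have "1 / real (Suc n) \<le> 1 / real (Suc n0)" by (simp add: field_simps)
          then show ?case using True n0 by (simp add: i_def)
        qed
        then show ?thesis by (rule tendsto_eventually)
      qed (simp add: i_eq)
    qed
  qed
  then have lim: "(\<lambda>n. (v - q) * (\<integral>s. i n s \<partial>lborel)) \<longlonglongrightarrow> N q z"
    unfolding N_def leg_integral_def by (rule tendsto_mult_left)
  have "(v - q) * (\<integral>s. i n s \<partial>lborel) = G (ray v q (1 / Suc n)) - G q" for n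
  proof -
    let ?e = "1 / real (Suc n)"
    have in_P: "ray v q s \<in> P" if "s \<in> {?e..1}" for s
    proof -
      have "0 < ?e" by simp
      then have "0 < s" using that by (simp only: atLeastAtMost_iff) linarith
      then show ?thesis using that ray_in[OF q, of s] by simp
    qed
    have cont: "continuous_on {?e..1} (\<lambda>s. M z (ray v q s))"
      by (rule continuous_on_compose2[OF holomorphic_on_imp_continuous_on[OF M_holomorphic[OF z]] continuous_ray])
        (use in_P in auto)
    have "((\<lambda>s. (q - v) * M z (ray v q s)) has_integral G (ray v q 1) - G (ray v q ?e)) {?e..1}"
    proof (rule fundamental_theorem_of_calculus)
      fix s assume s: "s \<in> {?e..1}"
      from field_vector_diff_chain_within[OF has_vector_derivative_ray[of v q s "{?e..1}"] has_field_derivative_at_within[OF G[OF in_P[OF s]]]]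
      show "((\<lambda>s. G (ray v q s)) has_vector_derivative (q - v) * M z (ray v q s)) (at s within {?e..1})"
        by (simp add: o_def)
    qed simp
    then have "(q - v) * integral {?e..1} (\<lambda>s. M z (ray v q s)) = G q - G (ray v q ?e)"
      by (simp add: integral_unique ray_def flip: integral_mult_right)
    moreover have "integral {?e..1} (\<lambda>s. M z (ray v q s)) = (\<integral>s. i n s \<partial>lborel)"
      using set_borel_integral_eq_integral(2)[OF borel_integrable_atLeastAtMost'[OF cont]]
      by (simp add: set_lebesgue_integral_def i_def)
    ultimately show ?thesis by (simp add: algebra_simps)
  qed
  then show ?thesis using lim by simp
qed

lemma closed_segment_ray:
  assumes "t \<in> closed_segment (ray v a s) (ray v b s)"
  obtains y where "y \<in> closed_segment a b" "t = ray v y s"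
proof -
  obtain u where u: "0 \<le> u" "u \<le> 1" "t = (1 - u) *\<^sub>R ray v a s + u *\<^sub>R ray v b s"
    using assms by (auto simp: closed_segment_def)
  have "t = ray v ((1 - u) *\<^sub>R a + u *\<^sub>R b) s"
    by (simp add: u(3) ray_def scaleR_conv_of_real algebra_simps)
  then show ?thesis using that[of "(1 - u) *\<^sub>R a + u *\<^sub>R b"] u by (auto simp: closed_segment_def)
qed

text \<open>Cauchy's theorem for the triangle with corners \<open>v\<close>, \<open>c\<close>,
  \<open>q\<close>, truncated near \<open>v\<close>. The cross cut at parameter \<open>s\<close> has
  length of order \<open>s\<close>, and the integrand there is of order
  \<open>1 + s powr (1 - 2 / p)\<close>, so its contribution vanishes in the limit because p > 1.
  What is left is the integral over the segment from \<open>c\<close> to \<open>q\<close>.\<close>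

lemma N_change_leg:
  assumes c: "c \<in> P" and q: "q \<in> P" and z: "z \<in> P"
    and B: "\<And>t. t \<in> closed_segment c q \<Longrightarrow> norm (M z t) \<le> B"
  shows "norm (N c z - N q z) \<le> B * norm (c - q)"
proof -
  obtain G where G': "\<And>t. t \<in> P \<Longrightarrow> (G has_field_derivative M z t) (at t within P)"
    using holomorphic_convex_primitive'[OF convexP openP M_holomorphic[OF z]] by blast
  have G: "(G has_field_derivative M z t) (at t)" if "t \<in> P" for t
    using G'[OF that] at_within_open[OF that openP] by simp
  have seg: "closed_segment c q \<subseteq> P" using convexP c q by (simp add: closed_segment_subset)
  obtain B0 where B0: "0 \<le> B0" "\<And>t. t \<in> P \<Longrightarrow> norm (M z t) \<le> B0 * (1 + norm (f t) * norm (t - v))"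
    using M_bound[OF z] by blast
  have "compact (closed_segment c q)" by simp
  then obtain C where C: "0 \<le> C" "\<And>y s. y \<in> closed_segment c q \<Longrightarrow> 0 < s \<Longrightarrow> s \<le> 1 \<Longrightarrow> norm (f (v + of_real s * (y - v))) \<le> C * s powr (- 2 / p)"
    using growth[OF _ seg] by blast
  have "continuous_on (closed_segment c q) (\<lambda>y. y - v)" by (intro continuous_intros)
  then obtain D where D: "0 \<le> D" "\<And>y. y \<in> closed_segment c q \<Longrightarrow> norm (y - v) \<le> D"
    using compact_norm_bound[OF _ compact_segment] by blast
  let ?E = "\<lambda>s::real. B0 * (s + C * D * s powr (2 - 2 / p)) * norm (c - q)"
  have diff: "norm (G (ray v c s) - G (ray v q s)) \<le> ?E s" if s: "0 < s" "s \<le> 1" for s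
  proof -
    have "norm (G (ray v c s) - G (ray v q s)) \<le> (B0 * (1 + C * D * s powr (1 - 2 / p))) * norm (ray v c s - ray v q s)"
    proof (rule field_differentiable_bound[where S = "closed_segment (ray v c s) (ray v q s)"])
      fix t assume "t \<in> closed_segment (ray v c s) (ray v q s)"
      then obtain y where y: "y \<in> closed_segment c q" "t = ray v y s" by (rule closed_segment_ray)
      have tP: "t \<in> P" using y seg ray_in s by blast
      then show "(G has_field_derivative M z t) (at t within closed_segment (ray v c s) (ray v q s))"
        by (rule has_field_derivative_at_within[OF G])
      have "norm (M z t) \<le> B0 * (1 + norm (f t) * norm (t - v))" using B0(2)[OF tP] .
      also have "\<dots> \<le> B0 * (1 + (C * s powr (- 2 / p)) * (s * D))"
        using C(2)[OF y(1) s] D(2)[OF y(1)] B0(1) C(1) s y(2)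
        by (intro mult_left_mono add_left_mono mult_mono) (auto simp: norm_ray ray_def norm_mult)
      also have "(C * s powr (- 2 / p)) * (s * D) = C * D * (s powr (- 2 / p) * s)" by simp
      also have "s powr (- 2 / p) * s = s powr (1 - 2 / p)"
        using s by (simp add: powr_diff powr_minus field_simps)
      finally show "norm (M z t) \<le> B0 * (1 + C * D * s powr (1 - 2 / p))" .
    qed auto
    also have "ray v c s - ray v q s = of_real s * (c - q)" by (simp add: ray_def algebra_simps)
    also have "norm (of_real s * (c - q)) = s * norm (c - q)" using s by (simp add: norm_mult)
    also have "(B0 * (1 + C * D * s powr (1 - 2 / p))) * (s * norm (c - q))
        = B0 * (s + C * D * (s powr (1 - 2 / p) * s)) * norm (c - q)" by (simp add: algebra_simps)
    also have "s powr (1 - 2 / p) * s = s powr (2 - 2 / p)"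
      using s by (simp add: powr_diff field_simps power2_eq_square)
    finally show ?thesis .
  qed
  have s_lim: "(\<lambda>n. 1 / real (Suc n)) \<longlonglongrightarrow> 0" using LIMSEQ_inverse_real_of_nat by (simp add: inverse_eq_divide)
  have "0 < 2 - 2 / p" using p by (simp add: field_simps)
  then have pow_lim: "(\<lambda>n. (1 / real (Suc n)) powr (2 - 2 / p)) \<longlonglongrightarrow> 0 powr (2 - 2 / p)"
    by (intro tendsto_powr'[OF s_lim tendsto_const]) simp
  have "(\<lambda>n. ?E (1 / real (Suc n))) \<longlonglongrightarrow> B0 * (0 + C * D * (0 powr (2 - 2 / p))) * norm (c - q)"
    by (intro tendsto_mult tendsto_add tendsto_const s_lim pow_lim)
  then have E_lim: "(\<lambda>n. ?E (1 / real (Suc n))) \<longlonglongrightarrow> 0" by simp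
  have "(\<lambda>n. G (ray v c (1 / Suc n)) - G (ray v q (1 / Suc n))) \<longlonglongrightarrow> 0"
    by (rule Lim_null_comparison[OF _ E_lim]) (auto intro!: always_eventually diff)
  moreover have "(\<lambda>n. (G (ray v c (1 / Suc n)) - G c) - (G (ray v q (1 / Suc n)) - G q)) \<longlonglongrightarrow> N c z - N q z"
    by (intro tendsto_diff N_eq_primitive_limit c q z G)
  ultimately have "(\<lambda>n. (G (ray v c (1 / Suc n)) - G (ray v q (1 / Suc n)))
      - ((G (ray v c (1 / Suc n)) - G c) - (G (ray v q (1 / Suc n)) - G q))) \<longlonglongrightarrow> 0 - (N c z - N q z)"
    by (rule tendsto_diff)
  then have "(\<lambda>n::nat. G c - G q) \<longlonglongrightarrow> 0 - (N c z - N q z)" by (simp add: algebra_simps)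
  then have "G c - G q = - (N c z - N q z)" by (simp add: LIMSEQ_const_iff)
  then have "norm (N c z - N q z) = norm (G c - G q)" by (metis norm_minus_cancel)
  also have "\<dots> \<le> B * norm (c - q)"
    by (rule field_differentiable_bound[where S = "closed_segment c q", OF _ _ B])
      (use G seg in \<open>auto intro: has_field_derivative_at_within\<close>)
  finally show ?thesis .
qed

section \<open>Domination of J by a Hardy operator\<close>

definition \<phi> :: "complex \<Rightarrow> real \<Rightarrow> real" where
  "\<phi> q s = indicator {0<..1} s * norm (f (ray v q s))"

text \<open>The Hardy transform of \<open>\<phi> q\<close>, centred at \<open>v\<close> and written
  in the form treated by \<open>hardy_estimate\<close>.\<close>

definition \<Phi> :: "complex \<Rightarrow> complex \<Rightarrow> real" where
  "\<Phi> q z = (\<integral>s. indicator {0<..} s * (\<phi> q s * s / (s + norm (z - v))\<^sup>2) \<partial>lborel)"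

lemma \<phi>_measurable: "q \<in> P \<Longrightarrow> \<phi> q \<in> borel_measurable borel"
  using measurable_on_ray[where A = P and q = q and g = "\<lambda>t. norm (f t)"] contf ray_in
  by (simp add: \<phi>_def[abs_def] continuous_on_norm)

lemma \<Phi>_measurable: "q \<in> P \<Longrightarrow> \<Phi> q \<in> borel_measurable borel"
proof -
  assume "q \<in> P"
  then have [measurable]: "\<phi> q \<in> borel_measurable borel" by (rule \<phi>_measurable)
  show ?thesis unfolding \<Phi>_def[abs_def] by measurable
qed

lemma \<Phi>_nonneg: "0 \<le> \<Phi> q z"
  unfolding \<Phi>_def by (intro integral_nonneg_AE AE_I2) (auto simp: indicator_def \<phi>_def)

text \<open>Mean value inequality on a disc of radius \<open>s * \<eta>\<close> about the point of
  the leg. As \<open>\<eta>\<close> is at most half of \<open>norm (q - v)\<close>, the disc fits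
  into an annulus about \<open>v\<close> with radii proportional to \<open>s\<close>; after this
  enlargement the averaging kernel depends on \<open>w\<close> only through
  \<open>norm (w - v)\<close>.\<close>

lemma \<phi>_bound:
  assumes q: "q \<in> P"
  obtains \<eta> where "0 < \<eta>" "\<And>s. 0 < s \<Longrightarrow> ennreal (\<phi> q s powr p)
    \<le> ennreal (1 / (pi * (s * \<eta>)\<^sup>2)) * (\<integral>\<^sup>+w. indicator {s * norm (q - v) / 2 .. 2 * (s * norm (q - v))} (norm (w - v))
       * (indicator P w * ennreal (norm (f w) powr p)) \<partial>lborel)"
proof -
  obtain e where e: "e > 0" "ball q e \<subseteq> P" using openP q openE by blast
  have qv: "norm (q - v) > 0" using q vP by auto
  define \<eta> where "\<eta> = min e (norm (q - v) / 2)"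
  have \<eta>: "\<eta> > 0" "\<eta> \<le> norm (q - v) / 2" "ball q \<eta> \<subseteq> P"
    using e qv by (auto simp: \<eta>_def subset_iff)
  have "ennreal (\<phi> q s powr p) \<le> ennreal (1 / (pi * (s * \<eta>)\<^sup>2)) * (\<integral>\<^sup>+w. indicator {s * norm (q - v) / 2 .. 2 * (s * norm (q - v))} (norm (w - v))
       * (indicator P w * ennreal (norm (f w) powr p)) \<partial>lborel)" (is "_ \<le> _ * ?I") if s: "0 < s" for s
  proof (cases "s \<le> 1")
    case True
    have c: "0 < pi * (s * \<eta>)\<^sup>2" using s \<eta> by simp
    have "ennreal (pi * (s * \<eta>)\<^sup>2) * ennreal (norm (f (ray v q s)) powr p)
      \<le> (\<integral>\<^sup>+w. indicator (ball (ray v q s) (s * \<eta>)) w * (indicator P w * ennreal (norm (f w) powr p)) \<partial>lborel)"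
      unfolding ray_def by (rule norm_powr_le_integral) (use \<eta> s True in auto)
    also have "\<dots> \<le> ?I"
    proof (intro nn_integral_mono mult_right_mono)
      fix w
      show "indicator (ball (ray v q s) (s * \<eta>)) w \<le> (indicator {s * norm (q - v) / 2 .. 2 * (s * norm (q - v))} (norm (w - v)) :: ennreal)"
      proof (cases "w \<in> ball (ray v q s) (s * \<eta>)")
        case True
        then have "norm (ray v q s - w) < s * \<eta>" by (simp add: dist_norm)
        moreover have "s * \<eta> \<le> s * norm (q - v) / 2" using \<eta>(2) s by simp
        moreover have "norm (ray v q s - v) = s * norm (q - v)" using s by (simp add: norm_ray)
        moreover have "norm (ray v q s - v) \<le> norm (ray v q s - w) + norm (w - v)"
          "norm (w - v) \<le> norm (ray v q s - w) + norm (ray v q s - v)"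
          using norm_triangle_ineq[of "ray v q s - w" "w - v"] norm_triangle_ineq[of "w - ray v q s" "ray v q s - v"]
          by (auto simp: norm_minus_commute)
        moreover have "0 \<le> s * norm (q - v)" using s by simp
        ultimately have "s * norm (q - v) / 2 \<le> norm (w - v)" "norm (w - v) \<le> 2 * (s * norm (q - v))"
          by linarith+
        then show ?thesis by (simp add: indicator_def)
      qed simp
    qed simp
    finally have "ennreal (1 / (pi * (s * \<eta>)\<^sup>2)) * (ennreal (pi * (s * \<eta>)\<^sup>2) * ennreal (norm (f (ray v q s)) powr p)) \<le> ennreal (1 / (pi * (s * \<eta>)\<^sup>2)) * ?I"
      by (rule mult_left_mono) simp
    then show ?thesis using s True c \<eta>(1)
      by (simp add: \<phi>_def mult.assoc[symmetric] ennreal_mult[symmetric] del: ennreal_mult')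
  qed (simp add: \<phi>_def)
  then show ?thesis using that \<eta>(1) by blast
qed

text \<open>Although \<open>\<phi> q\<close> only sees \<open>f\<close> on one segment, its radial
  extension is controlled by the area integral of \<open>f\<close>. After the exchange of integrals,
  the \<open>z\<close> that interact with a given \<open>w\<close> have modulus comparable to
  \<open>norm (w - v)\<close>, so their area and the factor \<open>1 / (norm z * \<eta>)^2\<close>
  balance to a constant.\<close>

lemma \<phi>_norm_Lp:
  assumes q: "q \<in> P"
  shows "(\<integral>\<^sup>+z. ennreal (\<phi> q (norm z) powr p) \<partial>(lborel :: complex measure)) < \<infinity>"
proof -
  obtain \<eta> where \<eta>: "0 < \<eta>" and bound: "\<And>s. 0 < s \<Longrightarrow> ennreal (\<phi> q s powr p)
    \<le> ennreal (1 / (pi * (s * \<eta>)\<^sup>2)) * (\<integral>\<^sup>+w. indicator {s * norm (q - v) / 2 .. 2 * (s * norm (q - v))} (norm (w - v))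
       * (indicator P w * ennreal (norm (f w) powr p)) \<partial>lborel)"
    using \<phi>_bound[OF q] by blast
  define e where "e = norm (q - v)"
  have e: "e > 0" using q vP by (auto simp: e_def)
  define F where "F w = indicator P w * ennreal (norm (f w) powr p)" for w
  have [measurable]: "F \<in> borel_measurable borel"
  proof -
    have "(\<lambda>w. indicator P w *\<^sub>R (norm (f w) powr p)) \<in> borel_measurable borel"
      using intf by (simp add: set_integrable_def borel_measurable_integrable[of lborel, simplified])
    then have "(\<lambda>w. ennreal (indicator P w *\<^sub>R (norm (f w) powr p))) \<in> borel_measurable borel" by measurable
    also have "(\<lambda>w. ennreal (indicator P w *\<^sub>R (norm (f w) powr p))) = F"
      by (auto simp: F_def indicator_def)
    finally show ?thesis .
  qed
  define k where "k z w = ennreal (1 / (pi * (norm z * \<eta>)\<^sup>2)) * indicator {norm z * e / 2 .. 2 * (norm z * e)} (norm (w - v))" for z w :: complex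
  have k_meas [measurable]: "case_prod k \<in> borel_measurable (lborel \<Otimes>\<^sub>M lborel)"
  proof -
    have "case_prod k = (\<lambda>x. ennreal (1 / (pi * (norm (fst x) * \<eta>)\<^sup>2)) * (if norm (fst x) * e / 2 \<le> norm (snd x - v) \<and> norm (snd x - v) \<le> 2 * (norm (fst x) * e) then 1 else 0))"
      by (auto simp: k_def indicator_def fun_eq_iff)
    then show ?thesis by simp
  qed
  have k_int: "(\<integral>\<^sup>+z. k z w \<partial>lborel) \<le> ennreal (16 / \<eta>\<^sup>2)" if w: "w \<in> P" for w
  proof -
    \<comment> \<open>The kernel vanishes unless \<open>norm z\<close> is between
      \<open>R / 2\<close> and \<open>2 * R\<close>. The lower end bounds the kernel, the upper end
      the area, and the product of both is \<open>16 / \<eta>^2\<close>.\<close>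
    define R where "R = norm (w - v) / e"
    have "w \<noteq> v" using w vP by auto
    then have R: "R > 0" using e by (simp add: R_def)
    have "k z w \<le> ennreal (1 / (pi * (R / 2 * \<eta>)\<^sup>2)) * indicator (cball 0 (2 * R)) z" for z
    proof (cases "norm z * e / 2 \<le> norm (w - v) \<and> norm (w - v) \<le> 2 * (norm z * e)")
      case True
      then have z: "norm z \<le> 2 * R" "R / 2 \<le> norm z" using e by (auto simp: R_def field_simps)
      have "1 / (pi * (norm z * \<eta>)\<^sup>2) \<le> 1 / (pi * (R / 2 * \<eta>)\<^sup>2)"
        using z R \<eta> by (intro divide_left_mono mult_left_mono power_mono mult_right_mono mult_pos_pos) auto
      then show ?thesis using z by (auto simp: k_def indicator_def intro: ennreal_leI)
    qed (auto simp: k_def indicator_def)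
    then have "(\<integral>\<^sup>+z. k z w \<partial>lborel) \<le> (\<integral>\<^sup>+z. ennreal (1 / (pi * (R / 2 * \<eta>)\<^sup>2)) * indicator (cball 0 (2 * R)) z \<partial>(lborel :: complex measure))"
      by (intro nn_integral_mono)
    also have "\<dots> = ennreal (1 / (pi * (R / 2 * \<eta>)\<^sup>2)) * emeasure lborel (cball (0::complex) (2 * R))"
      by (rule nn_integral_cmult_indicator) simp
    also have "emeasure lborel (cball (0::complex) (2 * R)) = ennreal (pi * (2 * R)\<^sup>2)"
      using R by (simp add: emeasure_cball unit_ball_vol_2)
    also have "ennreal (1 / (pi * (R / 2 * \<eta>)\<^sup>2)) * ennreal (pi * (2 * R)\<^sup>2) = ennreal (16 / \<eta>\<^sup>2)"
      using R \<eta> by (subst ennreal_mult[symmetric]) (auto simp: power_mult_distrib power_divide field_simps)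
    finally show ?thesis .
  qed
  have "(\<integral>\<^sup>+z. ennreal (\<phi> q (norm z) powr p) \<partial>(lborel :: complex measure)) \<le> (\<integral>\<^sup>+z. (\<integral>\<^sup>+w. k z w * F w \<partial>lborel) \<partial>lborel)"
  proof (rule nn_integral_mono)
    fix z :: complex
    show "ennreal (\<phi> q (norm z) powr p) \<le> (\<integral>\<^sup>+w. k z w * F w \<partial>lborel)"
    proof (cases "z = 0")
      case False
      then have "ennreal (\<phi> q (norm z) powr p) \<le> ennreal (1 / (pi * (norm z * \<eta>)\<^sup>2)) * (\<integral>\<^sup>+w. indicator {norm z * e / 2 .. 2 * (norm z * e)} (norm (w - v)) * F w \<partial>lborel)"
        using bound[of "norm z"] by (simp add: F_def e_def)
      also have "\<dots> = (\<integral>\<^sup>+w. k z w * F w \<partial>lborel)"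
        unfolding k_def mult.assoc by (rule nn_integral_cmult[symmetric]) measurable
      finally show ?thesis .
    qed (simp add: \<phi>_def)
  qed
  also have "\<dots> = (\<integral>\<^sup>+w. (\<integral>\<^sup>+z. k z w * F w \<partial>lborel) \<partial>lborel)"
    by (rule lborel_pair.Fubini') measurable
  also have "\<dots> \<le> (\<integral>\<^sup>+w. ennreal (16 / \<eta>\<^sup>2) * F w \<partial>lborel)"
  proof (rule nn_integral_mono)
    fix w
    have "(\<integral>\<^sup>+z. k z w * F w \<partial>lborel) = (\<integral>\<^sup>+z. k z w \<partial>lborel) * F w"
      by (rule nn_integral_multc) (use k_meas in measurable)
    also have "\<dots> \<le> ennreal (16 / \<eta>\<^sup>2) * F w"
      using k_int[of w] by (cases "w \<in> P") (auto simp: F_def intro: mult_right_mono)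
    finally show "(\<integral>\<^sup>+z. k z w * F w \<partial>lborel) \<le> ennreal (16 / \<eta>\<^sup>2) * F w" .
  qed
  also have "\<dots> = ennreal (16 / \<eta>\<^sup>2) * (\<integral>\<^sup>+w. F w \<partial>lborel)"
    by (rule nn_integral_cmult) measurable
  also have "\<dots> < \<infinity>" using integral_f_finite by (simp add: F_def ennreal_mult_less_top)
  finally show ?thesis .
qed

lemma \<Phi>_Lp:
  assumes q: "q \<in> P"
  shows "(\<integral>\<^sup>+z. ennreal (\<Phi> q z powr p) \<partial>lborel) < \<infinity>"
proof -
  note [measurable] = \<Phi>_measurable[OF q]
  obtain C where C: "(\<integral>\<^sup>+z. ennreal ((\<integral>s. indicator {0<..} s * (\<phi> q s * s / (s + norm z)\<^sup>2) \<partial>lborel) powr p) \<partial>(lborel :: complex measure))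
      \<le> ennreal C * (\<integral>\<^sup>+z. ennreal (\<phi> q (norm z) powr p) \<partial>(lborel :: complex measure))"
    by (rule hardy_estimate[OF \<phi>_measurable[OF q] _ p]) (auto simp: \<phi>_def)
  have "(\<integral>\<^sup>+z. ennreal (\<Phi> q z powr p) \<partial>lborel) = (\<integral>\<^sup>+z. ennreal (\<Phi> q z powr p) \<partial>distr lborel borel (\<lambda>x. v + x))"
    by (subst lborel_distr_plus) simp
  also have "\<dots> = (\<integral>\<^sup>+z. ennreal (\<Phi> q (v + z) powr p) \<partial>lborel)"
    by (subst nn_integral_distr) auto
  also have "\<dots> \<le> ennreal C * (\<integral>\<^sup>+z. ennreal (\<phi> q (norm z) powr p) \<partial>(lborel :: complex measure))"
    using C by (simp add: \<Phi>_def)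
  also have "\<dots> < \<infinity>" using \<phi>_norm_Lp[OF q] by (simp add: ennreal_mult_less_top)
  finally show ?thesis .
qed

text \<open>If \<open>z\<close> and its reflection stay at distance of order
  \<open>s + norm (z - v)\<close> from the point of the leg with parameter \<open>s\<close>, then
  \<open>K\<close> is at most a constant times the Hardy kernel
  \<open>s / (s + norm (z - v))^2\<close>.\<close>

lemma J_le_\<Phi>:
  assumes q: "q \<in> P" and z: "z \<noteq> v" and c: "0 < c"
    and K1: "\<And>s. 0 < s \<Longrightarrow> s \<le> 1 \<Longrightarrow> c * (s + norm (z - v)) \<le> norm (ray v q s - z)"
    and K2: "\<And>s. 0 < s \<Longrightarrow> s \<le> 1 \<Longrightarrow> c * (s + norm (z - v)) \<le> norm (ray v q s + z - 2 * v)"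
  shows "norm (J q z) \<le> 2 * (norm (q - v))\<^sup>2 / c\<^sup>2 * \<Phi> q z"
proof -
  define r where "r = norm (z - v)"
  have r: "r > 0" using z by (simp add: r_def)
  define e where "e = norm (q - v)"
  obtain C where C: "0 \<le> C" "\<And>s. 0 < s \<Longrightarrow> s \<le> 1 \<Longrightarrow> norm (f (ray v q s)) \<le> C * s powr (- 2 / p)"
    using growth_ray[OF q] by blast
  have int: "integrable lborel (\<lambda>s. indicator {0<..} s * (\<phi> q s * s / (s + r)\<^sup>2))"
  proof (rule Bochner_Integration.integrable_bound)
    show "integrable lborel (\<lambda>s. (C / r\<^sup>2) * (indicator {0<..1} s * s powr (1 - 2 / p)))"
      using p by (intro integrable_mult_right integrable_indicator_powr) (simp add: field_simps)
    show "AE s in lborel. norm (indicator {0<..} s * (\<phi> q s * s / (s + r)\<^sup>2)) \<le> norm ((C / r\<^sup>2) * (indicator {0<..1} s * s powr (1 - 2 / p)))"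
    proof (intro AE_I2)
      fix s :: real
      show "norm (indicator {0<..} s * (\<phi> q s * s / (s + r)\<^sup>2)) \<le> norm ((C / r\<^sup>2) * (indicator {0<..1} s * s powr (1 - 2 / p)))"
      proof (cases "s \<in> {0<..1}")
        case True
        have "norm (f (ray v q s)) * s / (s + r)\<^sup>2 \<le> (C * s powr (- 2 / p)) * s / r\<^sup>2"
          using True C r by (intro frac_le mult_right_mono power_mono) auto
        also have "(C * s powr (- 2 / p)) * s = C * (s powr (- 2 / p) * s)" by simp
        also have "s powr (- 2 / p) * s = s powr (1 - 2 / p)"
          using True by (simp add: powr_diff powr_minus field_simps)
        finally show ?thesis using True C r by (simp add: \<phi>_def)
      qed (simp add: \<phi>_def)
    qed
  qed (use \<phi>_measurable[OF q] in measurable)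
  have pt: "norm (indicator {0<..1} s *\<^sub>R (f (ray v q s) * K z (ray v q s)))
      \<le> (2 * e / c\<^sup>2) * (indicator {0<..} s * (\<phi> q s * s / (s + r)\<^sup>2))" for s
  proof (cases "s \<in> {0<..1}")
    case True
    have "(c * (s + r))\<^sup>2 \<le> norm (ray v q s - z) * norm (ray v q s + z - 2 * v)"
      unfolding power2_eq_square using K1[of s] K2[of s] True c r
      by (intro mult_mono) (auto simp: r_def)
    then have "norm (K z (ray v q s)) \<le> 2 * (s * e) / (c * (s + r))\<^sup>2"
      unfolding K_def norm_divide norm_mult e_def
      using True c r by (intro frac_le) (auto simp: norm_ray)
    then have "norm (f (ray v q s)) * norm (K z (ray v q s)) \<le> norm (f (ray v q s)) * (2 * (s * e) / (c * (s + r))\<^sup>2)"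
      by (rule mult_left_mono) simp
    also have "\<dots> = (2 * e / c\<^sup>2) * (norm (f (ray v q s)) * s / (s + r)\<^sup>2)"
      by (simp add: power_mult_distrib)
    finally show ?thesis using True by (simp add: \<phi>_def norm_mult)
  qed (simp add: \<phi>_def)
  have "norm (\<integral>s. indicator {0<..1} s *\<^sub>R (f (ray v q s) * K z (ray v q s)) \<partial>lborel)
      \<le> (\<integral>s. (2 * e / c\<^sup>2) * (indicator {0<..} s * (\<phi> q s * s / (s + r)\<^sup>2)) \<partial>lborel)"
  proof (cases "integrable lborel (\<lambda>s. indicator {0<..1} s *\<^sub>R (f (ray v q s) * K z (ray v q s)))")
    case True
    then show ?thesis
      by (rule Bochner_Integration.integral_norm_bound_integral[OF _ integrable_mult_right[OF int] pt])
  next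
    \<comment> \<open>The Bochner integral is then 0 by convention, while the integral of the
      majorant is nonnegative.\<close>
    case False
    then have "(\<integral>s. indicator {0<..1} s *\<^sub>R (f (ray v q s) * K z (ray v q s)) \<partial>lborel) = 0"
      by (rule not_integrable_integral_eq)
    then show ?thesis using order_trans[OF norm_ge_zero pt]
      by (simp only: norm_zero) (intro integral_nonneg_AE AE_I2)
  qed
  also have "\<dots> = (2 * e / c\<^sup>2) * \<Phi> q z" by (simp only: integral_mult_right_zero \<Phi>_def r_def)
  finally have "norm (v - q) * norm (\<integral>s. indicator {0<..1} s *\<^sub>R (f (ray v q s) * K z (ray v q s)) \<partial>lborel)
      \<le> norm (v - q) * ((2 * e / c\<^sup>2) * \<Phi> q z)" by (rule mult_left_mono) simp
  then show ?thesis
    by (simp add: J_def leg_integral_def norm_mult e_def norm_minus_commute power2_eq_square mult_ac)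
qed

end

section \<open>Estimates at a vertex\<close>

text \<open>After division by \<open>e\<close> the difference has real part \<open>s - t\<close> and
  imaginary part \<open>- \<eta> * t\<close>. The imaginary part controls \<open>t\<close>, and then
  the real part controls \<open>s + t = (s - t) + 2 * t\<close>.\<close>

lemma two_rays_separated:
  fixes e :: complex and \<eta> s t :: real
  assumes "0 < \<eta>" "0 \<le> s" "0 \<le> t"
  shows "norm e / (1 + 2 / \<eta>) * (s + t) \<le> norm (of_real s * e - of_real t * (e * (1 + \<i> * of_real \<eta>)))"
proof -
  define X where "X = norm (Complex (s - t) (- (\<eta> * t)))"
  have "\<bar>s - t\<bar> \<le> X" "\<bar>\<eta> * t\<bar> \<le> X"
    using abs_Re_le_cmod[of "Complex (s - t) (- (\<eta> * t))"] abs_Im_le_cmod[of "Complex (s - t) (- (\<eta> * t))"]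
    by (auto simp: X_def)
  then have "s - t \<le> X" "t \<le> X / \<eta>" using assms by (auto simp: field_simps)
  then have "s + t \<le> X + 2 * (X / \<eta>)" by linarith
  also have "\<dots> = X * (1 + 2 / \<eta>)" by (simp add: field_simps)
  finally have "(s + t) / (1 + 2 / \<eta>) \<le> X" using assms by (subst pos_divide_le_eq) (auto intro: add_pos_pos)
  then have "norm e * ((s + t) / (1 + 2 / \<eta>)) \<le> norm e * X" by (rule mult_left_mono) simp
  also have "norm e * X = norm (e * Complex (s - t) (- (\<eta> * t)))" by (simp add: X_def norm_mult)
  also have "e * Complex (s - t) (- (\<eta> * t)) = of_real s * e - of_real t * (e * (1 + \<i> * of_real \<eta>))"
    by (simp add: complex_eq_iff algebra_simps)
  finally show ?thesis by simp
qed

locale bergman_corner_half_plane = bergman_corner +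
  fixes n :: complex and b :: real
  assumes P_sub: "\<And>z. z \<in> P \<Longrightarrow> n \<bullet> z < b" and v_line: "n \<bullet> v = b"
begin

text \<open>The component along the normal \<open>n\<close> is negative for \<open>z - v\<close> and
  equal to \<open>- s * m\<close> for the point of the leg, both measured from \<open>v\<close>, so
  the two vectors cannot cancel. This works for every \<open>z\<close> of the half plane, also
  outside \<open>P\<close>.\<close>

lemma reflected_bound:
  assumes q: "q \<in> P"
  obtains \<kappa> where "0 < \<kappa>" "\<And>z s. n \<bullet> z < b \<Longrightarrow> 0 < s \<Longrightarrow> s \<le> 1 \<Longrightarrow> \<kappa> * (s + norm (z - v)) \<le> norm (ray v q s + z - 2 * v)"
proof -
  define m where "m = b - n \<bullet> q"
  have m: "m > 0" using P_sub[OF q] by (simp add: m_def)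
  have n: "norm n > 0" using P_sub[OF q] v_line by auto
  define A where "A = norm n / m + (1 + norm (q - v) * norm n / m)"
  have A: "A > 0" using m n by (auto simp: A_def intro!: add_pos_pos add_pos_nonneg)
  have "1 / A * (s + norm (z - v)) \<le> norm (ray v q s + z - 2 * v)" if z: "n \<bullet> z < b" and s: "0 < s" "s \<le> 1" for z s
  proof -
    define X where "X = norm (ray v q s + z - 2 * v)"
    have ray: "ray v q s = v + s *\<^sub>R (q - v)" by (simp add: ray_def scaleR_conv_of_real)
    have "s * m \<le> - (n \<bullet> (ray v q s + z - 2 * v))"
      using z v_line unfolding ray
      by (simp add: m_def inner_diff_right inner_add_right inner_scaleR_right algebra_simps
          scaleR_conv_of_real[symmetric] mult_2)
    also have "\<dots> \<le> norm n * X" unfolding X_def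
      using Cauchy_Schwarz_ineq2[of n "ray v q s + z - 2 * v"] by linarith
    finally have 1: "s \<le> X * (norm n / m)" using m by (simp add: field_simps)
    have "norm (z - v) \<le> X + norm (ray v q s - v)"
      unfolding X_def using norm_triangle_ineq4[of "ray v q s + z - 2 * v" "ray v q s - v"] by (simp add: algebra_simps)
    then have "norm (z - v) \<le> X + s * norm (q - v)" using s by (simp add: norm_ray)
    also have "s * norm (q - v) \<le> (X * (norm n / m)) * norm (q - v)" using 1 by (rule mult_right_mono) simp
    finally have "s + norm (z - v) \<le> X * A" using 1 by (simp add: A_def algebra_simps)
    then show ?thesis using A by (simp add: X_def field_simps)
  qed
  then show ?thesis using that[of "1 / A"] A by simp
qed

lemma J_le_\<Phi>_of_good:
  assumes q: "q \<in> P" and k: "0 < \<kappa>"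
  obtains C where "0 \<le> C" "\<And>z. n \<bullet> z < b \<Longrightarrow> (\<And>s. 0 < s \<Longrightarrow> s \<le> 1 \<Longrightarrow> \<kappa> * (s + norm (z - v)) \<le> norm (ray v q s - z))
    \<Longrightarrow> norm (J q z) \<le> C * \<Phi> q z"
proof -
  obtain k' where k': "0 < k'" "\<And>z s. n \<bullet> z < b \<Longrightarrow> 0 < s \<Longrightarrow> s \<le> 1 \<Longrightarrow> k' * (s + norm (z - v)) \<le> norm (ray v q s + z - 2 * v)"
    using reflected_bound[OF q] by blast
  define c where "c = min \<kappa> k'"
  have c: "0 < c" using k k' by (simp add: c_def)
  have "norm (J q z) \<le> 2 * (norm (q - v))\<^sup>2 / c\<^sup>2 * \<Phi> q z"
    if z: "n \<bullet> z < b" and good: "\<And>s. 0 < s \<Longrightarrow> s \<le> 1 \<Longrightarrow> \<kappa> * (s + norm (z - v)) \<le> norm (ray v q s - z)" for z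
  proof (rule J_le_\<Phi>[OF q _ c])
    show "z \<noteq> v" using z v_line by auto
    fix s :: real assume s: "0 < s" "s \<le> 1"
    have pos: "0 \<le> s + norm (z - v)" using s by simp
    have "c * (s + norm (z - v)) \<le> \<kappa> * (s + norm (z - v))" "c * (s + norm (z - v)) \<le> k' * (s + norm (z - v))"
      using pos by (auto intro!: mult_right_mono simp: c_def)
    then show "c * (s + norm (z - v)) \<le> norm (ray v q s - z)" "c * (s + norm (z - v)) \<le> norm (ray v q s + z - 2 * v)"
      using good[OF s] k'(2)[OF z s] by linarith+
  qed
  then show ?thesis using that[of "2 * (norm (q - v))\<^sup>2 / c\<^sup>2"] by simp
qed

text \<open>Far from \<open>v\<close> the distance from \<open>z\<close> to the leg is comparable to
  \<open>norm (z - v)\<close> by the triangle inequality alone, so \<open>J\<close> inherits the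
  decay of \<open>\<Phi>\<close> at infinity.\<close>

lemma J_far:
  assumes q: "q \<in> P"
  obtains C where "0 \<le> C" "\<And>z. n \<bullet> z < b \<Longrightarrow> 2 * norm (q - v) + 1 \<le> norm (z - v) \<Longrightarrow> norm (J q z) \<le> C * \<Phi> q z"
proof -
  obtain C where C: "0 \<le> C" "\<And>z. n \<bullet> z < b \<Longrightarrow> (\<And>s. 0 < s \<Longrightarrow> s \<le> 1 \<Longrightarrow> 1 / 4 * (s + norm (z - v)) \<le> norm (ray v q s - z))
    \<Longrightarrow> norm (J q z) \<le> C * \<Phi> q z"
    using J_le_\<Phi>_of_good[OF q, of "1 / 4"] by (metis zero_less_divide_1_iff zero_less_numeral)
  have "norm (J q z) \<le> C * \<Phi> q z" if z: "n \<bullet> z < b" "2 * norm (q - v) + 1 \<le> norm (z - v)" for z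
  proof (rule C(2)[OF z(1)])
    fix s :: real assume s: "0 < s" "s \<le> 1"
    have "norm (z - v) \<le> norm (ray v q s - z) + norm (ray v q s - v)"
      using norm_triangle_ineq4[of "ray v q s - v" "ray v q s - z"] by (simp add: algebra_simps)
    moreover have "norm (ray v q s - v) \<le> norm (q - v)" using s by (simp add: norm_ray mult_left_le_one_le)
    ultimately have "s + norm (z - v) \<le> 4 * norm (ray v q s - z)"
      using z(2) s norm_ge_zero[of "z - v"] by linarith
    then show "1 / 4 * (s + norm (z - v)) \<le> norm (ray v q s - z)" by simp
  qed
  then show ?thesis using that C(1) by blast
qed

lemma good_off_segment:
  assumes z: "n \<bullet> z < b" and k: "0 < \<kappa>"
    and good: "\<And>s. 0 < s \<Longrightarrow> s \<le> 1 \<Longrightarrow> \<kappa> * (s + norm (z - v)) \<le> norm (ray v q s - z)"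
  shows "z \<notin> closed_segment q v"
proof
  assume "z \<in> closed_segment q v"
  then obtain u where u: "0 \<le> u" "u \<le> 1" "z = (1 - u) *\<^sub>R q + u *\<^sub>R v" by (auto simp: closed_segment_def)
  then have eq: "z = ray v q (1 - u)" by (simp add: ray_def scaleR_conv_of_real algebra_simps)
  have "u \<noteq> 1" using u z v_line by auto
  then have "\<kappa> * ((1 - u) + norm (z - v)) \<le> 0" using good[of "1 - u"] u eq by simp
  moreover have "0 < \<kappa> * ((1 - u) + norm (z - v))" using k u \<open>u \<noteq> 1\<close> by (intro mult_pos_pos add_pos_nonneg) auto
  ultimately show False by simp
qed

text \<open>The leg integral from \<open>c\<close> is uncontrolled only for \<open>z\<close> close to that leg; such \<open>z\<close> lie in \<open>P\<close> and
  stay away from a leg with slightly rotated direction, to which Cauchy's theorem moves the integral.\<close>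

lemma corner_dichotomy:
  assumes c: "c \<in> P"
  obtains q \<kappa> where "q \<in> P" "0 < \<kappa>"
    "\<And>z. (\<forall>s. 0 < s \<longrightarrow> s \<le> 1 \<longrightarrow> \<kappa> * (s + norm (z - v)) \<le> norm (ray v c s - z))
      \<or> z \<in> P \<and> (\<forall>s. 0 < s \<longrightarrow> s \<le> 1 \<longrightarrow> \<kappa> * (s + norm (z - v)) \<le> norm (ray v q s - z))"
proof -
  obtain r where r: "r > 0" "ball c r \<subseteq> P" using openP c openE by blast
  define e where "e = c - v"
  have e: "norm e > 0" using c vP by (auto simp: e_def)
  \<comment> \<open>This makes \<open>norm (q - c)\<close> equal to \<open>r / 2\<close>, so that
    \<open>q\<close> remains in the disc around \<open>c\<close>.\<close>
  define \<eta> where "\<eta> = r / (2 * norm e)"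
  have \<eta>: "\<eta> > 0" using r e by (simp add: \<eta>_def)
  define q where "q = v + e * (1 + \<i> * of_real \<eta>)"
  have "q - c = e * (\<i> * of_real \<eta>)" by (simp add: q_def e_def algebra_simps)
  then have "norm (q - c) = norm e * \<eta>" using \<eta> by (simp add: norm_mult)
  also have "\<dots> < r" using r e by (simp add: \<eta>_def)
  finally have q: "q \<in> P" using r by (auto simp: dist_norm norm_minus_commute)
  define \<kappa>0 where "\<kappa>0 = norm e / (1 + 2 / \<eta>)"
  have k0: "\<kappa>0 > 0" using e \<eta> by (auto simp: \<kappa>0_def intro!: divide_pos_pos add_pos_pos)
  \<comment> \<open>Absorbs the factors \<open>2 + 2 * norm e\<close> and
    \<open>3 + 4 * norm e\<close> that arise below from
    \<open>norm (z - v) \<le> s0 * (2 * norm e + 1)\<close>.\<close>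
  define A where "A = 5 + 4 * norm e"
  have A: "A > 0" using e unfolding A_def by linarith
  define \<kappa> where "\<kappa> = min (1 / 2) (min (\<kappa>0 / A) (r / A))"
  have k: "0 < \<kappa>" "\<kappa> \<le> 1 / 2" "\<kappa> * A \<le> \<kappa>0" "\<kappa> * A \<le> r"
  proof -
    show "0 < \<kappa>" using k0 A r by (simp add: \<kappa>_def)
    have "\<kappa> \<le> \<kappa>0 / A" "\<kappa> \<le> r / A" by (auto simp: \<kappa>_def)
    then show "\<kappa> * A \<le> \<kappa>0" "\<kappa> * A \<le> r" using A by (simp_all only: pos_le_divide_eq)
  qed (unfold \<kappa>_def, rule min.cobounded1)
  have "(\<forall>s. 0 < s \<longrightarrow> s \<le> 1 \<longrightarrow> \<kappa> * (s + norm (z - v)) \<le> norm (ray v c s - z))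
      \<or> z \<in> P \<and> (\<forall>s. 0 < s \<longrightarrow> s \<le> 1 \<longrightarrow> \<kappa> * (s + norm (z - v)) \<le> norm (ray v q s - z))" for z
  proof (rule disj_imp[THEN iffD2], rule impI)
    assume "\<not> (\<forall>s. 0 < s \<longrightarrow> s \<le> 1 \<longrightarrow> \<kappa> * (s + norm (z - v)) \<le> norm (ray v c s - z))"
    then obtain s0 where s0: "0 < s0" "s0 \<le> 1" "norm (ray v c s0 - z) < \<kappa> * (s0 + norm (z - v))" by force
    let ?u = "norm (z - v)"
    have "?u \<le> norm (ray v c s0 - z) + norm (ray v c s0 - v)"
      using norm_triangle_ineq4[of "ray v c s0 - v" "ray v c s0 - z"] by (simp add: algebra_simps)
    also have "norm (ray v c s0 - v) = s0 * norm e" using s0 by (simp add: norm_ray e_def)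
    finally have "?u \<le> \<kappa> * (s0 + ?u) + s0 * norm e" using s0 by linarith
    also have "\<kappa> * (s0 + ?u) \<le> 1 / 2 * (s0 + ?u)" using k s0 by (intro mult_right_mono) auto
    finally have u: "?u \<le> s0 * (2 * norm e + 1)" by (simp add: algebra_simps)
    have "\<kappa> * (s0 + ?u) \<le> \<kappa> * (s0 + s0 * (2 * norm e + 1))"
      using u k(1) by (intro mult_left_mono add_left_mono) auto
    then have "norm (ray v c s0 - z) < \<kappa> * (s0 + s0 * (2 * norm e + 1))"
      using s0(3) by linarith
    also have "\<dots> = s0 * (\<kappa> * (2 + 2 * norm e))" by (simp add: algebra_simps)
    also have "\<dots> \<le> s0 * (\<kappa> * A)" using k s0 by (intro mult_left_mono) (auto simp: A_def)
    also have "\<dots> \<le> s0 * r" using k s0 by (intro mult_left_mono) auto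
    \<comment> \<open>Closeness to the leg is measured relative to the parameter \<open>s0\<close>,
      and the disc of radius \<open>s0 * r\<close> about that point of the leg lies in
      \<open>P\<close>.\<close>
    finally have "z \<in> ball (v + of_real s0 * (c - v)) (s0 * r)" by (simp add: dist_norm ray_def)
    then have zP: "z \<in> P" using ball_homothety_subset_convex[OF openP convexP v r(2) s0(1,2)] by blast
    \<comment> \<open>A point close to both legs would bring them nearer to each other than
      \<open>two_rays_separated\<close> allows.\<close>
    have "\<kappa> * (s + ?u) \<le> norm (ray v q s - z)" if s: "0 < s" "s \<le> 1" for s
    proof (rule ccontr)
      assume "\<not> \<kappa> * (s + ?u) \<le> norm (ray v q s - z)"
      then have bad: "norm (ray v q s - z) < \<kappa> * (s + ?u)" by simp
      have "\<kappa>0 * (s0 + s) \<le> norm (of_real s0 * e - of_real s * (e * (1 + \<i> * of_real \<eta>)))"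
        unfolding \<kappa>0_def by (rule two_rays_separated) (use \<eta> s0 s in auto)
      also have "of_real s0 * e - of_real s * (e * (1 + \<i> * of_real \<eta>)) = (ray v c s0 - z) - (ray v q s - z)"
        by (simp add: ray_def e_def q_def)
      also have "norm \<dots> \<le> norm (ray v c s0 - z) + norm (ray v q s - z)" by (rule norm_triangle_ineq4)
      also have "\<dots> < \<kappa> * (s0 + ?u) + \<kappa> * (s + ?u)" using s0(3) bad by linarith
      also have "\<dots> = \<kappa> * (s0 + s + 2 * ?u)" by (simp add: algebra_simps)
      also have "\<dots> \<le> \<kappa> * ((s0 + s) * A)"
      proof (rule mult_left_mono)
        have "s0 + s + 2 * ?u \<le> s0 + s + 2 * (s0 * (2 * norm e + 1))" using u by simp
        also have "\<dots> \<le> (s0 + s) * A"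
          using s0 s e by (simp add: A_def algebra_simps add_nonneg_nonneg)
        finally show "s0 + s + 2 * ?u \<le> (s0 + s) * A" .
      qed (use k in simp)
      also have "\<dots> = (s0 + s) * (\<kappa> * A)" by simp
      also have "\<dots> \<le> (s0 + s) * \<kappa>0" using k s0 s by (intro mult_left_mono) auto
      finally show False by (simp add: mult.commute)
    qed
    then show "z \<in> P \<and> (\<forall>s. 0 < s \<longrightarrow> s \<le> 1 \<longrightarrow> \<kappa> * (s + norm (z - v)) \<le> norm (ray v q s - z))"
      using zP by blast
  qed
  then show ?thesis using that[of q \<kappa>] q k(1) by blast
qed

text \<open>The segment from \<open>c\<close> to \<open>q\<close> has positive distance from
  \<open>v\<close>, hence also from \<open>z\<close> and its reflection once \<open>z\<close> is
  near \<open>v\<close>. On it both denominators in \<open>M z\<close> are bounded below, and the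
  subtracted value accounts for the term \<open>norm (f z)\<close>.\<close>

lemma N_change_leg_near:
  assumes c: "c \<in> P" and q: "q \<in> P"
  obtains \<epsilon> C where "0 < \<epsilon>" "0 \<le> C" "\<And>z. z \<in> P \<Longrightarrow> norm (z - v) < \<epsilon> \<Longrightarrow> norm (N c z - N q z) \<le> C * (1 + norm (f z))"
proof -
  have seg: "closed_segment c q \<subseteq> P" using convexP c q by (simp add: closed_segment_subset)
  then have "v \<in> - closed_segment c q" using vP by auto
  then obtain d where d: "d > 0" "ball v d \<subseteq> - closed_segment c q"
    using openE[of "- closed_segment c q" v] by (auto simp: open_Compl)
  define \<epsilon> where "\<epsilon> = d / 2"
  have \<epsilon>: "\<epsilon> > 0" using d by (simp add: \<epsilon>_def)
  obtain F where F: "0 \<le> F" "\<And>t. t \<in> closed_segment c q \<Longrightarrow> norm (f t) \<le> F"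
    using compact_norm_bound[OF continuous_on_subset[OF contf seg] compact_segment] by blast
  have "norm (N c z - N q z) \<le> (2 * F + 1) / \<epsilon> * norm (c - q) * (1 + norm (f z))" if z: "z \<in> P" "norm (z - v) < \<epsilon>" for z
  proof -
    have "norm (N c z - N q z) \<le> ((2 * F + norm (f z)) / \<epsilon>) * norm (c - q)"
    proof (rule N_change_leg[OF c q z(1)])
      fix t assume t: "t \<in> closed_segment c q"
      have "t \<notin> ball v d" using t d by auto
      then have tv: "2 * \<epsilon> \<le> norm (t - v)" by (simp add: dist_norm norm_minus_commute \<epsilon>_def)
      have 1: "\<epsilon> \<le> norm (t - z)"
        using tv z(2) norm_triangle_ineq[of "t - z" "z - v"] by simp
      have 2: "\<epsilon> \<le> norm (t + z - 2 * v)"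
        using tv z(2) norm_triangle_ineq4[of "t + z - 2 * v" "z - v"] by (simp add: algebra_simps)
      have "t \<noteq> z" using 1 \<epsilon> by auto
      have "norm (f t - f z) \<le> F + norm (f z)" using F(2)[OF t] norm_triangle_ineq4[of "f t" "f z"] by linarith
      then have a: "norm ((f t - f z) / (t - z)) \<le> (F + norm (f z)) / \<epsilon>"
        unfolding norm_divide using 1 \<epsilon> F by (intro frac_le) auto
      have b: "norm (f t / (t + z - 2 * v)) \<le> F / \<epsilon>"
        unfolding norm_divide using 2 \<epsilon> F(1) F(2)[OF t] by (intro frac_le) auto
      have "norm (M z t) \<le> (F + norm (f z)) / \<epsilon> + F / \<epsilon>"
        using \<open>t \<noteq> z\<close> norm_triangle_mono[OF a b] by (simp add: M_def)
      also have "\<dots> = (2 * F + norm (f z)) / \<epsilon>" by (simp add: add_divide_distrib)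
      finally show "norm (M z t) \<le> (2 * F + norm (f z)) / \<epsilon>" .
    qed
    also have "\<dots> \<le> ((2 * F + 1) * (1 + norm (f z)) / \<epsilon>) * norm (c - q)"
    proof (intro mult_right_mono divide_right_mono)
      have "0 \<le> F * norm (f z)" using F by simp
      then show "2 * F + norm (f z) \<le> (2 * F + 1) * (1 + norm (f z))" by (simp add: algebra_simps)
    qed (use \<epsilon> in auto)
    finally show ?thesis by (simp add: mult_ac)
  qed
  then show ?thesis using that[of \<epsilon> "(2 * F + 1) / \<epsilon> * norm (c - q)"] \<epsilon> F by auto
qed

end

section \<open>The contribution of one side\<close>

lemma Ln_quotient_right_half_plane:
  assumes "0 < Re x" "0 < Re y"
  shows "Ln (y / x) = Ln y - Ln x"
proof (rule Ln_unique)
  have ne: "x \<noteq> 0" "y \<noteq> 0" using assms by auto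
  then show "exp (Ln y - Ln x) = y / x" by (simp add: exp_diff)
  have "\<bar>Im (Ln x)\<bar> < pi / 2" "\<bar>Im (Ln y)\<bar> < pi / 2" using assms Re_Ln_pos_lt_imp by auto
  then show "- pi < Im (Ln y - Ln x)" "Im (Ln y - Ln x) \<le> pi" by auto
qed

text \<open>A line separating \<open>z\<close> from the triangle puts the three vectors from
  \<open>z\<close> to the corners into one open half plane, turned into the right half plane by
  \<open>cnj e\<close>. There arguments differ by less than pi, so the logarithm of a quotient is a
  difference of logarithms.\<close>

lemma Ln_triangle:
  assumes z: "z \<notin> convex hull {a, b, c}"
  shows "Ln ((b - z) / (a - z)) + Ln ((c - z) / (b - z)) = Ln ((c - z) / (a - z))"
proof -
  have "closed (convex hull {a, b, c})" by (intro compact_imp_closed finite_imp_compact_convex_hull) simp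
  then obtain e r where e: "e \<bullet> z < r" "\<And>x. x \<in> convex hull {a, b, c} \<Longrightarrow> r < e \<bullet> x"
    using separating_hyperplane_closed_point[OF convex_convex_hull _ z] by blast
  have pos: "0 < Re ((x - z) * cnj e)" if "x \<in> {a, b, c}" for x
  proof -
    have "e \<bullet> z < e \<bullet> x" using e hull_inc[OF that, of convex] by force
    moreover have "Re ((x - z) * cnj e) = e \<bullet> x - e \<bullet> z" by (simp add: inner_complex_def algebra_simps)
    ultimately show ?thesis by simp
  qed
  have "e \<noteq> 0" using pos[of a] by auto
  then have "(x - z) / (y - z) = ((x - z) * cnj e) / ((y - z) * cnj e)" for x y by simp
  then have "Ln ((x - z) / (y - z)) = Ln ((x - z) * cnj e) - Ln ((y - z) * cnj e)"
    if "x \<in> {a, b, c}" "y \<in> {a, b, c}" for x y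
    using Ln_quotient_right_half_plane[OF pos[OF that(2)] pos[OF that(1)]] by simp
  then show ?thesis by simp
qed

lemma norm_Ln_le:
  assumes "x \<noteq> 0" shows "norm (Ln x) \<le> \<bar>ln (norm x)\<bar> + pi"
proof -
  have "norm (Ln x) \<le> \<bar>Re (Ln x)\<bar> + \<bar>Im (Ln x)\<bar>" by (rule cmod_le)
  also have "\<bar>Im (Ln x)\<bar> \<le> pi" using Im_Ln_le_pi[OF assms] mpi_less_Im_Ln[OF assms] by linarith
  finally show ?thesis using assms by simp
qed

text \<open>Each logarithm blows up as \<open>y\<close> tends to 0, but \<open>ln (norm y)\<close>
  cancels in the real part and imaginary parts are bounded by pi anyway. It serves with
  \<open>y = v - z\<close> for \<open>z\<close> near \<open>v\<close>.\<close>

lemma norm_Ln_sum_le: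
  assumes "x \<noteq> 0" "y \<noteq> 0" "u \<noteq> 0"
  shows "norm (Ln (x / y) + Ln (y / u)) \<le> \<bar>ln (norm x) - ln (norm u)\<bar> + 2 * pi"
proof -
  have "norm (Ln (x / y) + Ln (y / u)) \<le> \<bar>Re (Ln (x / y) + Ln (y / u))\<bar> + \<bar>Im (Ln (x / y) + Ln (y / u))\<bar>"
    by (rule cmod_le)
  also have "Re (Ln (x / y) + Ln (y / u)) = ln (norm x) - ln (norm u)"
    using assms by (simp add: norm_divide ln_div)
  also have "\<bar>Im (Ln (x / y) + Ln (y / u))\<bar> \<le> 2 * pi"
    using Im_Ln_le_pi[of "x / y"] mpi_less_Im_Ln[of "x / y"] Im_Ln_le_pi[of "y / u"] mpi_less_Im_Ln[of "y / u"] assms by simp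
  finally show ?thesis by simp
qed

lemma isCont_locally_bounded:
  fixes h :: "complex \<Rightarrow> 'a::real_normed_vector"
  assumes "isCont h z0"
  obtains \<epsilon> C where "0 < \<epsilon>" "0 \<le> C" "\<And>z. norm (z - z0) < \<epsilon> \<Longrightarrow> norm (h z) \<le> C"
proof -
  obtain d where d: "d > 0" "\<And>z. dist z z0 < d \<Longrightarrow> dist (h z) (h z0) < 1"
    using assms unfolding continuous_at_eps_delta by (metis zero_less_one)
  have "norm (h z) \<le> norm (h z0) + 1" if "norm (z - z0) < d" for z
    using d(2)[of z] that norm_triangle_ineq2[of "h z" "h z0"] by (simp add: dist_norm)
  then show ?thesis using that[of d "norm (h z0) + 1"] d(1) by simp
qed

text \<open>\<open>Ln\<close> may jump near \<open>z0\<close>, but its imaginary part is bounded and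
  the modulus of the quotient is continuous and nonzero there.\<close>

lemma Ln_quotient_locally_bounded:
  fixes z0 a b :: complex
  assumes "z0 \<noteq> a" "z0 \<noteq> b"
  obtains \<epsilon> C where "0 < \<epsilon>" "0 \<le> C" "\<And>z. norm (z - z0) < \<epsilon> \<Longrightarrow> norm (Ln ((a - z) / (b - z))) \<le> C"
proof -
  have "isCont (\<lambda>z. \<bar>ln (norm ((a - z) / (b - z)))\<bar> + pi) z0"
    using assms by (intro continuous_intros) auto
  then obtain \<epsilon> C where \<epsilon>: "0 < \<epsilon>" "0 \<le> C" "\<And>z. norm (z - z0) < \<epsilon> \<Longrightarrow> norm (\<bar>ln (norm ((a - z) / (b - z)))\<bar> + pi) \<le> C"
    using isCont_locally_bounded by blast
  define \<delta> where "\<delta> = min \<epsilon> (min (norm (a - z0)) (norm (b - z0)))"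
  have "norm (Ln ((a - z) / (b - z))) \<le> C" if z: "norm (z - z0) < \<delta>" for z
  proof -
    have "z \<noteq> a" "z \<noteq> b" using z by (auto simp: \<delta>_def norm_minus_commute)
    then have "norm (Ln ((a - z) / (b - z))) \<le> \<bar>ln (norm ((a - z) / (b - z)))\<bar> + pi" by (intro norm_Ln_le) auto
    also have "\<dots> \<le> C" using \<epsilon>(3)[of z] z by (simp add: \<delta>_def)
    finally show ?thesis .
  qed
  then show ?thesis using that[of \<delta> C] \<epsilon> assms by (simp add: \<delta>_def)
qed

lemma Ln_sum_locally_bounded:
  fixes v w q :: complex
  assumes "v \<noteq> w" "v \<noteq> q"
  obtains \<epsilon> C where "0 < \<epsilon>" "0 \<le> C"
    "\<And>z. norm (z - v) < \<epsilon> \<Longrightarrow> z \<noteq> v \<Longrightarrow> norm (Ln ((w - z) / (v - z)) + Ln ((v - z) / (q - z))) \<le> C"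
proof -
  have "isCont (\<lambda>z. \<bar>ln (norm (w - z)) - ln (norm (q - z))\<bar> + 2 * pi) v"
    using assms by (intro continuous_intros) auto
  then obtain \<epsilon> C where \<epsilon>: "0 < \<epsilon>" "0 \<le> C" "\<And>z. norm (z - v) < \<epsilon> \<Longrightarrow> norm (\<bar>ln (norm (w - z)) - ln (norm (q - z))\<bar> + 2 * pi) \<le> C"
    using isCont_locally_bounded by blast
  define \<delta> where "\<delta> = min \<epsilon> (min (norm (w - v)) (norm (q - v)))"
  have "norm (Ln ((w - z) / (v - z)) + Ln ((v - z) / (q - z))) \<le> C" if z: "norm (z - v) < \<delta>" "z \<noteq> v" for z
  proof -
    have "z \<noteq> w" "z \<noteq> q" using z by (auto simp: \<delta>_def norm_minus_commute)
    then have "norm (Ln ((w - z) / (v - z)) + Ln ((v - z) / (q - z))) \<le> \<bar>ln (norm (w - z)) - ln (norm (q - z))\<bar> + 2 * pi"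
      using z by (intro norm_Ln_sum_le) auto
    also have "\<dots> \<le> C" using \<epsilon>(3)[of z] z by (simp add: \<delta>_def)
    finally show ?thesis .
  qed
  then show ?thesis using that[of \<delta> C] \<epsilon> assms by (simp add: \<delta>_def)
qed

context bergman_corner_half_plane
begin

lemma segment_meets_line:
  assumes q: "q \<in> P" and x: "x \<in> closed_segment q v" "n \<bullet> x = b"
  shows "x = v"
proof -
  obtain u where u: "0 \<le> u" "u \<le> 1" "x = (1 - u) *\<^sub>R q + u *\<^sub>R v" using x by (auto simp: closed_segment_def)
  have "n \<bullet> x = (1 - u) * (n \<bullet> q) + u * b" unfolding u(3) using v_line by (simp add: inner_add_right)
  then have "(1 - u) * (n \<bullet> q - b) = 0" using x(2) by (simp add: algebra_simps)
  then have "u = 1" using P_sub[OF q] by simp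
  then show ?thesis using u by simp
qed

lemma segment_below_line:
  assumes q: "q \<in> P" and x: "x \<in> closed_segment q v"
  shows "n \<bullet> x \<le> b"
proof -
  have "closed_segment q v \<subseteq> {x. n \<bullet> x \<le> b}"
    using P_sub[OF q] v_line by (intro closed_segment_subset convex_halfspace_le) auto
  then show ?thesis using x by blast
qed

text \<open>Reflection in \<open>v\<close> takes the closed half plane to the opposite one, which
  the leg meets only in \<open>v\<close>.\<close>

lemma off_reflected_leg:
  assumes q: "q \<in> P" and z: "n \<bullet> z \<le> b" "z \<noteq> v"
  shows "2 * v - z \<notin> closed_segment q v"
proof
  assume A: "2 * v - z \<in> closed_segment q v"
  have "2 * v - z = v + v - z" by simp
  then have "n \<bullet> (2 * v - z) = 2 * b - n \<bullet> z"
    using v_line by (simp only: inner_diff_right inner_add_right)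
  moreover from this have "n \<bullet> (2 * v - z) = b" using segment_below_line[OF q A] z by linarith
  ultimately have "2 * v - z = v" using segment_meets_line[OF q A] by simp
  then show False using z by (simp add: algebra_simps)
qed

lemma J_isCont:
  assumes q: "q \<in> P" and z: "n \<bullet> z \<le> b" "z \<noteq> v" "z \<notin> closed_segment q v"
  shows "isCont (J q) z"
proof -
  let ?U = "{z. z \<notin> closed_segment q v \<and> 2 * v - z \<notin> closed_segment q v}"
  have "z \<in> ?U" using z off_reflected_leg[OF q z(1,2)] by simp
  with continuous_on_eq_continuous_at[OF open_off_leg, THEN iffD1,
      OF holomorphic_on_imp_continuous_on[OF J_holomorphic[OF q]], rule_format]
  show ?thesis by this
qed

end

section \<open>The function belonging to two boundary points on one line\<close>

locale bergman_edge =
  V: bergman_corner_half_plane p P f v n b + W: bergman_corner_half_plane p P f w n b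
  for p P f v w n b +
  fixes c :: complex
  assumes c: "c \<in> P" and vw: "v \<noteq> w"
begin

text \<open>The second formula is forced: outside the triangle \<open>T\<close> the logarithms
  cancel and the first formula turns into \<open>W.J c z - V.J c z\<close>, which makes sense in the
  whole half plane off \<open>T\<close>. On \<open>P\<close> the \<open>N\<close> terms carry the
  function across the legs.\<close>

definition edge_part :: "complex \<Rightarrow> complex" where
  "edge_part z = (if z \<in> P then f z * Ln ((w - z) / (v - z)) - V.N c z + W.N c z else W.J c z - V.J c z)"

abbreviation "T \<equiv> convex hull {c, v, w}"

text \<open>A point of the triangle strictly below the line has positive weight at the interior
  point \<open>c\<close>, and the other weights only involve the closure of \<open>P\<close>. Hence
  \<open>P\<close> and the complement of \<open>T\<close> together cover the half plane, which is
  the cover used for holomorphy.\<close>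

lemma T_subset: "x \<in> T \<Longrightarrow> n \<bullet> x < b \<Longrightarrow> x \<in> P"
proof -
  assume x: "x \<in> T" "n \<bullet> x < b"
  obtain \<alpha> \<beta> \<gamma> where abc: "0 \<le> \<alpha>" "0 \<le> \<beta>" "0 \<le> \<gamma>" "\<alpha> + \<beta> + \<gamma> = 1" "x = \<alpha> *\<^sub>R c + \<beta> *\<^sub>R v + \<gamma> *\<^sub>R w"
    using x(1) unfolding convex_hull_3 by blast
  have "\<alpha> \<noteq> 0"
  proof
    assume "\<alpha> = 0"
    then have "n \<bullet> x = (\<beta> + \<gamma>) * b"
      unfolding abc(5) using V.v_line W.v_line by (simp add: inner_add_right distrib_right)
    then show False using x abc(4) \<open>\<alpha> = 0\<close> by simp
  qed
  show ?thesis
  proof (cases "\<alpha> = 1")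
    case True then show ?thesis using abc c by (simp add: add_nonneg_eq_0_iff)
  next
    case False
    define y where "y = (\<beta> / (1 - \<alpha>)) *\<^sub>R v + (\<gamma> / (1 - \<alpha>)) *\<^sub>R w"
    have \<alpha>: "0 < \<alpha>" "\<alpha> < 1" using abc False \<open>\<alpha> \<noteq> 0\<close> by auto
    have "y \<in> closure P" unfolding y_def
      using \<alpha> abc V.v W.v by (intro convexD convex_closure V.convexP) (auto simp: add_divide_distrib[symmetric])
    moreover have "c \<in> interior P" using c V.openP by (simp add: interior_open)
    ultimately have "y - \<alpha> *\<^sub>R (y - c) \<in> interior P"
      using \<alpha> by (intro mem_interior_closure_convex_shrink[OF V.convexP]) auto
    also have "y - \<alpha> *\<^sub>R (y - c) = (1 - \<alpha>) *\<^sub>R y + \<alpha> *\<^sub>R c" by (simp add: algebra_simps)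
    also have "\<dots> = x" using \<alpha> by (simp add: y_def abc(5) scaleR_add_right)
    finally show ?thesis using interior_subset by blast
  qed
qed

lemma segments_in_T: "closed_segment c v \<subseteq> T" "closed_segment c w \<subseteq> T" "closed_segment v w \<subseteq> T"
  unfolding segment_convex_hull by (rule hull_mono, simp)+

lemma edge_part_outside:
  assumes z: "n \<bullet> z < b" "z \<notin> T"
  shows "edge_part z = W.J c z - V.J c z"
proof (cases "z \<in> P")
  case True
  have "V.N c z = V.J c z - f z * Ln ((v - z) / (c - z))"
    using segments_in_T z by (intro V.N_eq_J c True) auto
  moreover have "W.N c z = W.J c z - f z * Ln ((w - z) / (c - z))"
    using segments_in_T z by (intro W.N_eq_J c True) auto
  ultimately have "edge_part z
      = f z * (Ln ((w - z) / (v - z)) + Ln ((v - z) / (c - z)) - Ln ((w - z) / (c - z))) + (W.J c z - V.J c z)"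
    using True by (simp add: edge_part_def algebra_simps)
  moreover have "Ln ((v - z) / (c - z)) + Ln ((w - z) / (v - z)) = Ln ((w - z) / (c - z))"
    using z(2) by (rule Ln_triangle)
  ultimately show ?thesis by (simp add: add.commute)
qed (simp add: edge_part_def)

lemma quotient_off_slit:
  assumes "n \<bullet> z < b" shows "(w - z) / (v - z) \<notin> \<real>\<^sub>\<le>\<^sub>0"
proof (rule quotient_notin_nonpos_Reals)
  have "closed_segment v w \<subseteq> {x. n \<bullet> x = b}"
    using V.v_line W.v_line by (intro closed_segment_subset convex_hyperplane) auto
  then show "z \<notin> closed_segment v w" using assms by auto
qed

lemma edge_part_holomorphic: "edge_part holomorphic_on {z. n \<bullet> z < b}"
proof -
  have openH: "open {z. n \<bullet> z < b}" by (rule open_halfspace_lt)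
  have "closed T" by (intro compact_imp_closed finite_imp_compact_convex_hull) simp
  then have openO: "open ({z. n \<bullet> z < b} - T)" using openH by (rule open_Diff[rotated])
  have "edge_part holomorphic_on P"
  proof (rule holomorphic_transform[of "\<lambda>z. f z * Ln ((w - z) / (v - z)) - V.N c z + W.N c z"])
    have "z \<noteq> v" if "z \<in> P" for z using that V.vP by auto
    then show "(\<lambda>z. f z * Ln ((w - z) / (v - z)) - V.N c z + W.N c z) holomorphic_on P"
      using quotient_off_slit V.P_sub
      by (intro holomorphic_intros V.holf V.N_holomorphic W.N_holomorphic c) auto
  qed (simp add: edge_part_def)
  moreover have "edge_part holomorphic_on {z. n \<bullet> z < b} - T"
  proof (rule holomorphic_transform[of "\<lambda>z. W.J c z - V.J c z"])
    have "z \<notin> closed_segment c v \<and> 2 * v - z \<notin> closed_segment c v \<and> z \<notin> closed_segment c w \<and> 2 * w - z \<notin> closed_segment c w"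
      if "z \<in> {z. n \<bullet> z < b} - T" for z
    proof -
      have "z \<noteq> v" "z \<noteq> w" using that V.v_line W.v_line by auto
      then show ?thesis using that segments_in_T V.off_reflected_leg[OF c] W.off_reflected_leg[OF c] by auto
    qed
    then show "(\<lambda>z. W.J c z - V.J c z) holomorphic_on {z. n \<bullet> z < b} - T"
      by (intro holomorphic_on_diff holomorphic_on_subset[OF V.J_holomorphic[OF c]] holomorphic_on_subset[OF W.J_holomorphic[OF c]]) auto
  qed (simp add: edge_part_outside)
  ultimately have "edge_part holomorphic_on P \<union> ({z. n \<bullet> z < b} - T)"
    using V.openP openO by (rule holomorphic_on_Un)
  moreover have "P \<union> ({z. n \<bullet> z < b} - T) = {z. n \<bullet> z < b}"
    using V.P_sub T_subset by auto
  ultimately show ?thesis by simp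
qed

text \<open>Both legs keep a positive distance from \<open>z0\<close>, so the \<open>J\<close> terms
  are continuous there, and inside \<open>P\<close> the logarithms multiplying \<open>f z\<close>
  are bounded. The modulus of \<open>f\<close> stays in the bound, since \<open>f\<close> itself
  need not be bounded near the side.\<close>

lemma edge_part_near_line:
  assumes z0: "n \<bullet> z0 = b" "z0 \<noteq> v" "z0 \<noteq> w"
  obtains \<epsilon> C where "0 < \<epsilon>" "0 \<le> C"
    "\<And>z. norm (z - z0) < \<epsilon> \<Longrightarrow> n \<bullet> z < b \<Longrightarrow> norm (edge_part z) \<le> C * (1 + indicator P z * norm (f z))"
proof -
  have off: "z0 \<notin> closed_segment c v" "z0 \<notin> closed_segment c w"
    using V.segment_meets_line[OF c _ z0(1)] W.segment_meets_line[OF c _ z0(1)] z0(2,3) by blast+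
  have z0c: "z0 \<noteq> c" using V.P_sub[OF c] z0 by auto
  obtain e1 C1 where 1: "0 < e1" "0 \<le> C1" "\<And>z. norm (z - z0) < e1 \<Longrightarrow> norm (V.J c z) \<le> C1"
    using isCont_locally_bounded[OF V.J_isCont[OF c eq_refl[OF z0(1)] z0(2) off(1)]] by blast
  obtain e2 C2 where 2: "0 < e2" "0 \<le> C2" "\<And>z. norm (z - z0) < e2 \<Longrightarrow> norm (W.J c z) \<le> C2"
    using isCont_locally_bounded[OF W.J_isCont[OF c eq_refl[OF z0(1)] z0(3) off(2)]] by blast
  obtain e3 C3 where 3: "0 < e3" "0 \<le> C3" "\<And>z. norm (z - z0) < e3 \<Longrightarrow> norm (Ln ((w - z) / (v - z))) \<le> C3"
    using Ln_quotient_locally_bounded[OF z0(3,2)] by blast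
  obtain e4 C4 where 4: "0 < e4" "0 \<le> C4" "\<And>z. norm (z - z0) < e4 \<Longrightarrow> norm (Ln ((v - z) / (c - z))) \<le> C4"
    using Ln_quotient_locally_bounded[OF z0(2) z0c] by blast
  obtain e5 C5 where 5: "0 < e5" "0 \<le> C5" "\<And>z. norm (z - z0) < e5 \<Longrightarrow> norm (Ln ((w - z) / (c - z))) \<le> C5"
    using Ln_quotient_locally_bounded[OF z0(3) z0c] by blast
  have "open (- closed_segment c v \<inter> - closed_segment c w)" by (intro open_Int) (auto simp: open_Compl)
  then obtain e6 where 6: "0 < e6" "ball z0 e6 \<subseteq> - closed_segment c v \<inter> - closed_segment c w"
    using off by (metis ComplI IntI openE)
  define \<epsilon> where "\<epsilon> = Min {e1, e2, e3, e4, e5, e6}"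
  define C where "C = C1 + C2 + (C3 + C4 + C5)"
  have "norm (edge_part z) \<le> C * (1 + indicator P z * norm (f z))" if z: "norm (z - z0) < \<epsilon>" "n \<bullet> z < b" for z
  proof -
    have J: "norm (V.J c z) \<le> C1" "norm (W.J c z) \<le> C2" using 1 2 z by (auto simp: \<epsilon>_def)
    show ?thesis
    proof (cases "z \<in> P")
      case True
      let ?l = "Ln ((w - z) / (v - z)) + Ln ((v - z) / (c - z)) - Ln ((w - z) / (c - z))"
      have off: "z \<notin> closed_segment c v" "z \<notin> closed_segment c w"
        using 6 z by (auto simp: \<epsilon>_def dist_norm norm_minus_commute subset_iff)
      have eq: "edge_part z = f z * ?l - V.J c z + W.J c z"
        using True V.N_eq_J[OF c True off(1)] W.N_eq_J[OF c True off(2)] by (simp add: edge_part_def algebra_simps)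
      have "norm (Ln ((w - z) / (v - z))) \<le> C3" "norm (Ln ((v - z) / (c - z))) \<le> C4" "norm (Ln ((w - z) / (c - z))) \<le> C5"
        using 3 4 5 z by (auto simp: \<epsilon>_def)
      then have l: "norm ?l \<le> C3 + C4 + C5"
        using norm_triangle_ineq4[of "Ln ((w - z) / (v - z)) + Ln ((v - z) / (c - z))" "Ln ((w - z) / (c - z))"]
          norm_triangle_ineq[of "Ln ((w - z) / (v - z))" "Ln ((v - z) / (c - z))"] by linarith
      have "norm (edge_part z) \<le> norm (f z * ?l) + norm (V.J c z) + norm (W.J c z)"
        unfolding eq using norm_triangle_ineq[of "f z * ?l - V.J c z" "W.J c z"] norm_triangle_ineq4[of "f z * ?l" "V.J c z"] by linarith
      also have "norm (f z * ?l) \<le> norm (f z) * (C3 + C4 + C5)" unfolding norm_mult using l by (rule mult_left_mono) simp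
      finally have "norm (edge_part z) \<le> norm (f z) * (C3 + C4 + C5) + C1 + C2" using J by linarith
      also have "\<dots> \<le> norm (f z) * C + C" using 1 2 3 4 5 by (intro order_trans[OF _ add_mono[OF mult_left_mono[of "C3 + C4 + C5" C] order_refl]]) (auto simp: C_def)
      finally show ?thesis using True by (simp add: algebra_simps)
    next
      case False
      then show ?thesis using J 3 4 5 norm_triangle_ineq4[of "W.J c z" "V.J c z"] by (simp add: edge_part_def C_def)
    qed
  qed
  moreover have "0 < \<epsilon>" "0 \<le> C" using 1 2 3 4 5 6 by (auto simp: \<epsilon>_def C_def)
  ultimately show ?thesis using that by blast
qed

text \<open>The two logarithms that are singular at \<open>v\<close> are combined before estimating,
  which leaves a bounded factor of \<open>f z\<close>. When \<open>z\<close> is too close to the leg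
  from \<open>c\<close>, \<open>V.N c\<close> is exchanged for \<open>V.N q\<close> at the price of
  \<open>N_change_leg_near\<close>, and \<open>V.J q\<close> is estimated instead of
  \<open>V.J c\<close>.\<close>

lemma edge_part_near_vertex:
  obtains q \<epsilon> C where "q \<in> P" "0 < \<epsilon>" "0 \<le> C"
    "\<And>z. norm (z - v) < \<epsilon> \<Longrightarrow> n \<bullet> z < b \<Longrightarrow> norm (edge_part z) \<le> C * (1 + indicator P z * norm (f z) + V.\<Phi> c z + V.\<Phi> q z)"
proof -
  obtain q \<kappa> where q: "q \<in> P" and \<kappa>: "0 < \<kappa>" and dich:
    "\<And>z. (\<forall>s. 0 < s \<longrightarrow> s \<le> 1 \<longrightarrow> \<kappa> * (s + norm (z - v)) \<le> norm (ray v c s - z))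
      \<or> z \<in> P \<and> (\<forall>s. 0 < s \<longrightarrow> s \<le> 1 \<longrightarrow> \<kappa> * (s + norm (z - v)) \<le> norm (ray v q s - z))"
    using V.corner_dichotomy[OF c] by blast
  have off: "v \<notin> closed_segment c w" using W.segment_meets_line[OF c _ V.v_line] vw by blast
  have ne: "v \<noteq> c" "v \<noteq> q" using V.vP c q by auto
  obtain C1 where 1: "0 \<le> C1" "\<And>z. n \<bullet> z < b \<Longrightarrow> (\<And>s. 0 < s \<Longrightarrow> s \<le> 1 \<Longrightarrow> \<kappa> * (s + norm (z - v)) \<le> norm (ray v c s - z))
    \<Longrightarrow> norm (V.J c z) \<le> C1 * V.\<Phi> c z"
    using V.J_le_\<Phi>_of_good[OF c \<kappa>] by blast
  obtain C2 where 2: "0 \<le> C2" "\<And>z. n \<bullet> z < b \<Longrightarrow> (\<And>s. 0 < s \<Longrightarrow> s \<le> 1 \<Longrightarrow> \<kappa> * (s + norm (z - v)) \<le> norm (ray v q s - z))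
    \<Longrightarrow> norm (V.J q z) \<le> C2 * V.\<Phi> q z"
    using V.J_le_\<Phi>_of_good[OF q \<kappa>] by blast
  obtain e3 C3 where 3: "0 < e3" "0 \<le> C3" "\<And>z. z \<in> P \<Longrightarrow> norm (z - v) < e3 \<Longrightarrow> norm (V.N c z - V.N q z) \<le> C3 * (1 + norm (f z))"
    using V.N_change_leg_near[OF c q] by blast
  obtain e4 C4 where 4: "0 < e4" "0 \<le> C4" "\<And>z. norm (z - v) < e4 \<Longrightarrow> norm (W.J c z) \<le> C4"
    using isCont_locally_bounded[OF W.J_isCont[OF c eq_refl[OF V.v_line] vw off]] by blast
  obtain e5 C5 where 5: "0 < e5" "0 \<le> C5" "\<And>z. norm (z - v) < e5 \<Longrightarrow> norm (Ln ((w - z) / (c - z))) \<le> C5"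
    using Ln_quotient_locally_bounded[OF vw ne(1)] by blast
  obtain e6 C6 where 6: "0 < e6" "0 \<le> C6" "\<And>z. norm (z - v) < e6 \<Longrightarrow> z \<noteq> v \<Longrightarrow> norm (Ln ((w - z) / (v - z)) + Ln ((v - z) / (c - z))) \<le> C6"
    using Ln_sum_locally_bounded[OF vw ne(1)] by blast
  obtain e7 C7 where 7: "0 < e7" "0 \<le> C7" "\<And>z. norm (z - v) < e7 \<Longrightarrow> z \<noteq> v \<Longrightarrow> norm (Ln ((w - z) / (v - z)) + Ln ((v - z) / (q - z))) \<le> C7"
    using Ln_sum_locally_bounded[OF vw ne(2)] by blast
  have "open (- closed_segment c w)" by (simp add: open_Compl)
  then obtain e8 where 8: "0 < e8" "ball v e8 \<subseteq> - closed_segment c w"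
    using off by (metis ComplI openE)
  define \<epsilon> where "\<epsilon> = Min {e3, e4, e5, e6, e7, e8}"
  define C where "C = C1 + C2 + C3 + C4 + C5 + C6 + C7"
  have "norm (edge_part z) \<le> C * (1 + indicator P z * norm (f z) + V.\<Phi> c z + V.\<Phi> q z)"
    if z: "norm (z - v) < \<epsilon>" "n \<bullet> z < b" for z
  proof -
    have zv: "z \<noteq> v" using z V.v_line by auto
    have JW: "norm (W.J c z) \<le> C4" using 4 z by (auto simp: \<epsilon>_def)
    note \<Phi>0 = V.\<Phi>_nonneg[of c z] V.\<Phi>_nonneg[of q z]
    have a: "C1 * V.\<Phi> c z \<le> C * V.\<Phi> c z" "C2 * V.\<Phi> q z \<le> C * V.\<Phi> q z"
      using \<Phi>0 1(1) 2(1) 3(2) 4(2) 5(2) 6(2) 7(2) by (auto intro!: mult_right_mono simp: C_def)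
    have a0: "0 \<le> C1 * V.\<Phi> c z" "0 \<le> C2 * V.\<Phi> q z" using \<Phi>0 1(1) 2(1) by auto
    show ?thesis
    proof (cases "z \<in> P")
      case True
      have offw: "z \<notin> closed_segment c w" using 8 z by (auto simp: \<epsilon>_def dist_norm norm_minus_commute subset_iff)
      have NW: "W.N c z = W.J c z - f z * Ln ((w - z) / (c - z))" by (rule W.N_eq_J[OF c True offw])
      have L5: "norm (Ln ((w - z) / (c - z))) \<le> C5" using 5 z by (auto simp: \<epsilon>_def)
      \<comment> \<open>A common shape for both alternatives: \<open>l\<close> is a bounded
        combination of logarithms, \<open>R\<close> collects the leg integrals, and \<open>Y\<close>
        is the share of a Hardy majorant.\<close>
      have "\<exists>l R Y. edge_part z = f z * l + R \<and> norm l \<le> C5 + C6 + C7 \<and> norm R \<le> C4 + C3 * (1 + norm (f z)) + Y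
          \<and> Y \<le> C1 * V.\<Phi> c z + C2 * V.\<Phi> q z"
      proof (cases "\<forall>s. 0 < s \<longrightarrow> s \<le> 1 \<longrightarrow> \<kappa> * (s + norm (z - v)) \<le> norm (ray v c s - z)")
        case good: True
        have offv: "z \<notin> closed_segment c v" using V.good_off_segment[OF z(2) \<kappa>] good by blast
        have JV: "norm (V.J c z) \<le> C1 * V.\<Phi> c z" using 1(2)[OF z(2)] good by blast
        let ?l = "Ln ((w - z) / (v - z)) + Ln ((v - z) / (c - z)) - Ln ((w - z) / (c - z))"
        have "edge_part z = f z * ?l + (W.J c z - V.J c z)"
          using True NW V.N_eq_J[OF c True offv] by (simp add: edge_part_def algebra_simps)
        moreover have "norm (Ln ((w - z) / (v - z)) + Ln ((v - z) / (c - z))) \<le> C6" using 6 z zv by (auto simp: \<epsilon>_def)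
        then have "norm ?l \<le> C5 + C6 + C7"
          using L5 7(2) norm_triangle_ineq4[of "Ln ((w - z) / (v - z)) + Ln ((v - z) / (c - z))" "Ln ((w - z) / (c - z))"] by linarith
        moreover have "0 \<le> C3 * (1 + norm (f z))" using 3(2) by simp
        then have "norm (W.J c z - V.J c z) \<le> C4 + C3 * (1 + norm (f z)) + C1 * V.\<Phi> c z"
          using norm_triangle_ineq4[of "W.J c z" "V.J c z"] JW JV by linarith
        ultimately show ?thesis using a0 by (intro exI[of _ ?l] exI[of _ "W.J c z - V.J c z"] exI[of _ "C1 * V.\<Phi> c z"]) auto
      next
        case False
        then have good: "\<And>s. 0 < s \<Longrightarrow> s \<le> 1 \<Longrightarrow> \<kappa> * (s + norm (z - v)) \<le> norm (ray v q s - z)"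
          using dich[of z] by blast
        have offv: "z \<notin> closed_segment q v" using V.good_off_segment[OF z(2) \<kappa>] good by blast
        have JV: "norm (V.J q z) \<le> C2 * V.\<Phi> q z" using 2(2)[OF z(2)] good by blast
        have D: "norm (V.N c z - V.N q z) \<le> C3 * (1 + norm (f z))" using 3(3)[OF True] z by (auto simp: \<epsilon>_def)
        let ?l = "Ln ((w - z) / (v - z)) + Ln ((v - z) / (q - z)) - Ln ((w - z) / (c - z))"
        let ?R = "W.J c z - V.J q z - (V.N c z - V.N q z)"
        have "edge_part z = f z * ?l + ?R"
          using True NW V.N_eq_J[OF q True offv] by (simp add: edge_part_def algebra_simps)
        moreover have "norm (Ln ((w - z) / (v - z)) + Ln ((v - z) / (q - z))) \<le> C7" using 7 z zv by (auto simp: \<epsilon>_def)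
        then have "norm ?l \<le> C5 + C6 + C7"
          using L5 6(2) norm_triangle_ineq4[of "Ln ((w - z) / (v - z)) + Ln ((v - z) / (q - z))" "Ln ((w - z) / (c - z))"] by linarith
        moreover have "norm ?R \<le> C4 + C3 * (1 + norm (f z)) + C2 * V.\<Phi> q z"
          using norm_triangle_ineq4[of "W.J c z - V.J q z" "V.N c z - V.N q z"] norm_triangle_ineq4[of "W.J c z" "V.J q z"] JW JV D by linarith
        ultimately show ?thesis using a0 by (intro exI[of _ ?l] exI[of _ ?R] exI[of _ "C2 * V.\<Phi> q z"]) auto
      qed
      then obtain l R Y where eq: "edge_part z = f z * l + R" and l: "norm l \<le> C5 + C6 + C7"
        and R: "norm R \<le> C4 + C3 * (1 + norm (f z)) + Y" and Y: "Y \<le> C1 * V.\<Phi> c z + C2 * V.\<Phi> q z" by blast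
      have "norm (edge_part z) \<le> norm (f z) * norm l + norm R"
        unfolding eq using norm_triangle_ineq[of "f z * l" R] by (simp add: norm_mult)
      also have "norm (f z) * norm l \<le> norm (f z) * (C5 + C6 + C7)" using l by (rule mult_left_mono) simp
      finally have "norm (edge_part z) \<le> (C3 + C4) + norm (f z) * (C3 + C5 + C6 + C7) + (C * V.\<Phi> c z + C * V.\<Phi> q z)"
        using R Y a by (simp add: algebra_simps)
      also have "norm (f z) * (C3 + C5 + C6 + C7) \<le> norm (f z) * C"
        using 1(1) 2(1) 4(2) by (intro mult_left_mono) (auto simp: C_def)
      also have "C3 + C4 \<le> C" using 1(1) 2(1) 5(2) 6(2) 7(2) by (simp add: C_def)
      finally show ?thesis using True by (simp add: algebra_simps)
    next
      case False
      \<comment> \<open>Outside \<open>P\<close> the second alternative of the dichotomy is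
        excluded.\<close>
      then have "norm (V.J c z) \<le> C1 * V.\<Phi> c z" using dich[of z] 1(2)[OF z(2)] by blast
      then have "norm (edge_part z) \<le> C4 + C * V.\<Phi> c z"
        using False JW a norm_triangle_ineq4[of "W.J c z" "V.J c z"] by (simp add: edge_part_def)
      also have "C4 \<le> C" using 1(1) 2(1) 3(2) 5(2) 6(2) 7(2) by (simp add: C_def)
      finally show ?thesis using False a a0 by (simp add: algebra_simps)
    qed
  qed
  moreover have "0 < \<epsilon>" "0 \<le> C" using 1(1) 2(1) 3(1,2) 4(1,2) 5(1,2) 6(1,2) 7(1,2) 8(1) by (auto simp: \<epsilon>_def C_def)
  ultimately show ?thesis using that[OF q] by blast
qed

end

section \<open>From pointwise majorants to membership in the Bergman space\<close>

lemma powr_add_le: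
  fixes x y p :: real
  assumes "0 \<le> x" "0 \<le> y" "0 < p"
  shows "(x + y) powr p \<le> 2 powr p * (x powr p + y powr p)"
proof -
  have "(x + y) powr p \<le> (2 * max x y) powr p" using assms by (intro powr_mono2) auto
  also have "\<dots> = 2 powr p * max x y powr p" using assms by (simp add: powr_mult)
  also have "max x y powr p \<le> x powr p + y powr p" by (simp add: max_def)
  finally show ?thesis by simp
qed

lemma integrable_powr_add:
  fixes g h :: "complex \<Rightarrow> real"
  assumes [measurable]: "g \<in> borel_measurable borel" "h \<in> borel_measurable borel"
    and nonneg: "\<And>z. 0 \<le> g z" "\<And>z. 0 \<le> h z" and p: "0 < p"
    and int: "integrable lborel (\<lambda>z. g z powr p)" "integrable lborel (\<lambda>z. h z powr p)"
  shows "integrable lborel (\<lambda>z. (g z + h z) powr p)"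
proof (rule Bochner_Integration.integrable_bound)
  show "integrable lborel (\<lambda>z. 2 powr p * (g z powr p + h z powr p))"
    using int by (intro integrable_mult_right Bochner_Integration.integrable_add)
  show "AE z in lborel. norm ((g z + h z) powr p) \<le> norm (2 powr p * (g z powr p + h z powr p))"
    using powr_add_le[OF nonneg p] by (intro AE_I2) auto
qed measurable

lemma compact_uniform_bound:
  fixes K :: "'a::metric_space set" and Q :: "real \<Rightarrow> 'a \<Rightarrow> bool"
  assumes K: "compact K" and mono: "\<And>C C' z. Q C z \<Longrightarrow> C \<le> C' \<Longrightarrow> Q C' z"
    and loc: "\<And>z0. z0 \<in> K \<Longrightarrow> \<exists>\<epsilon>>0. \<exists>C. \<forall>z. dist z z0 < \<epsilon> \<longrightarrow> Q C z"
  obtains C where "0 \<le> C" "\<And>z. z \<in> K \<Longrightarrow> Q C z"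
proof -
  obtain \<epsilon> C where \<epsilon>: "\<And>z0. z0 \<in> K \<Longrightarrow> \<epsilon> z0 > 0" and C: "\<And>z0 z. z0 \<in> K \<Longrightarrow> dist z z0 < \<epsilon> z0 \<Longrightarrow> Q (C z0) z"
    using loc by metis
  have "K \<subseteq> (\<Union>z0\<in>K. ball z0 (\<epsilon> z0))" using \<epsilon> by fastforce
  then obtain F where F: "F \<subseteq> K" "finite F" "K \<subseteq> (\<Union>z0\<in>F. ball z0 (\<epsilon> z0))"
    using compactE_image[OF K, of K "\<lambda>z0. ball z0 (\<epsilon> z0)"] by auto
  define M where "M = Max (insert 0 (C ` F))"
  have "Q M z" if "z \<in> K" for z
  proof -
    obtain z0 where z0: "z0 \<in> F" "dist z z0 < \<epsilon> z0" using F(3) \<open>z \<in> K\<close> by (auto simp: dist_commute)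
    then have "Q (C z0) z" using C F(1) by blast
    moreover have "C z0 \<le> M" unfolding M_def using F(2) z0(1) by (intro Max_ge) auto
    ultimately show ?thesis by (rule mono)
  qed
  moreover have "0 \<le> M" unfolding M_def using F(2) by (intro Max_ge) auto
  ultimately show ?thesis using that by blast
qed

lemma bergman_spaceI_bound:
  fixes h :: "complex \<Rightarrow> real"
  assumes H: "open H" and g: "g holomorphic_on H" and p: "0 < p"
    and int: "integrable lborel (\<lambda>z. h z powr p)"
    and bound: "\<And>z. z \<in> H \<Longrightarrow> norm (g z) \<le> C * h z" and nonneg: "\<And>z. 0 \<le> h z" "0 \<le> C"
  shows "restrict g H \<in> bergman_space p H"
proof -
  have "set_integrable lborel H (\<lambda>z. norm (g z) powr p)"
    unfolding set_integrable_def
  proof (rule Bochner_Integration.integrable_bound)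
    show "integrable lborel (\<lambda>z. C powr p * h z powr p)" using int by (rule integrable_mult_right)
    have "continuous_on H (\<lambda>z. norm (g z) powr p)"
      using p by (intro continuous_on_powr' continuous_on_norm holomorphic_on_imp_continuous_on[OF g] continuous_on_const) auto
    then show "(\<lambda>z. indicator H z *\<^sub>R (norm (g z) powr p)) \<in> borel_measurable lborel"
      using H by (simp add: borel_measurable_continuous_on_indicator del: real_scaleR_def)
    show "AE z in lborel. norm (indicator H z *\<^sub>R (norm (g z) powr p)) \<le> norm (C powr p * h z powr p)"
    proof (intro AE_I2)
      fix z
      show "norm (indicator H z *\<^sub>R (norm (g z) powr p)) \<le> norm (C powr p * h z powr p)"
      proof (cases "z \<in> H")
        case True
        then have "norm (g z) powr p \<le> (C * h z) powr p" using bound p by (intro powr_mono2) auto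
        then show ?thesis using True nonneg by (simp add: powr_mult)
      qed simp
    qed
  qed
  then have "set_integrable lborel H (\<lambda>z. norm (restrict g H z) powr p)"
    by (subst set_integrable_cong[OF refl refl, of _ _ "\<lambda>z. norm (g z) powr p"]) auto
  moreover have "restrict g H holomorphic_on H" using g by (rule holomorphic_transform) auto
  ultimately show ?thesis by (simp add: bergman_space_def)
qed

lemma (in bergman_corner) \<Phi>_integrable:
  assumes q: "q \<in> P" shows "integrable lborel (\<lambda>z. \<Phi> q z powr p)"
  using \<Phi>_Lp[OF q] \<Phi>_measurable[OF q] by (intro integrableI_bounded) auto

context bergman_edge
begin

text \<open>In a large disc the local estimates at interior points, line points and the two end
  points are merged by compactness of the part in the closed half plane; beyond it
  \<open>J_far\<close> takes over. There the constant 1 must disappear, because it is not integrable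
  over the half plane, so it is replaced by the indicator of the disc.\<close>

lemma edge_part_bound:
  obtains R C q q' where "q \<in> P" "q' \<in> P" "0 \<le> C" "0 \<le> R"
    "\<And>z. n \<bullet> z < b \<Longrightarrow> norm (edge_part z)
      \<le> C * (indicator (cball 0 R) z + indicator P z * norm (f z) + V.\<Phi> c z + V.\<Phi> q z + W.\<Phi> c z + W.\<Phi> q' z)"
proof -
  \<comment> \<open>Exchanging \<open>v\<close> and \<open>w\<close> only changes the sign of
    \<open>edge_part\<close> on the half plane, so the estimate at the first end point also yields
    the one at the second.\<close>
  interpret S: bergman_edge p P f w v n b c by unfold_locales (use c vw in auto)
  have S: "S.edge_part z = - edge_part z" if "n \<bullet> z < b" for z
  proof (cases "z \<in> P")
    case True
    have "Ln ((v - z) / (w - z)) = - Ln ((w - z) / (v - z))"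
      using Ln_inverse[OF quotient_off_slit[OF that]] by simp
    then show ?thesis using True by (simp add: S.edge_part_def edge_part_def)
  qed (simp add: S.edge_part_def edge_part_def)
  obtain q ev Cv where q: "q \<in> P" and Cv: "0 < ev" "0 \<le> Cv"
    "\<And>z. norm (z - v) < ev \<Longrightarrow> n \<bullet> z < b \<Longrightarrow> norm (edge_part z) \<le> Cv * (1 + indicator P z * norm (f z) + V.\<Phi> c z + V.\<Phi> q z)"
    using edge_part_near_vertex by blast
  obtain q' ew Cw where q': "q' \<in> P" and Cw: "0 < ew" "0 \<le> Cw"
    "\<And>z. norm (z - w) < ew \<Longrightarrow> n \<bullet> z < b \<Longrightarrow> norm (S.edge_part z) \<le> Cw * (1 + indicator P z * norm (f z) + W.\<Phi> c z + W.\<Phi> q' z)"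
    using S.edge_part_near_vertex by blast
  define E where "E z = indicator P z * norm (f z) + V.\<Phi> c z + V.\<Phi> q z + W.\<Phi> c z + W.\<Phi> q' z" for z
  have E0: "0 \<le> E z" and \<Phi>0: "0 \<le> V.\<Phi> c z" "0 \<le> V.\<Phi> q z" "0 \<le> W.\<Phi> c z" "0 \<le> W.\<Phi> q' z" "0 \<le> indicator P z * norm (f z)" for z
    by (auto simp: E_def intro!: add_nonneg_nonneg V.\<Phi>_nonneg W.\<Phi>_nonneg)
  have openH: "open {z. n \<bullet> z < b}" by (rule open_halfspace_lt)
  have local: "\<exists>\<epsilon>>0. \<exists>C. \<forall>z. dist z z0 < \<epsilon> \<longrightarrow> (n \<bullet> z < b \<longrightarrow> norm (edge_part z) \<le> C * (1 + E z))"
    if z0: "n \<bullet> z0 \<le> b" for z0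
  proof -
    consider "z0 = v" | "z0 = w" | "n \<bullet> z0 = b" "z0 \<noteq> v" "z0 \<noteq> w" | "n \<bullet> z0 < b" using z0 by force
    then show ?thesis
    proof cases
      case 1
      have "norm (edge_part z) \<le> Cv * (1 + E z)" if z: "dist z z0 < ev" "n \<bullet> z < b" for z
      proof -
        have "norm (edge_part z) \<le> Cv * (1 + indicator P z * norm (f z) + V.\<Phi> c z + V.\<Phi> q z)"
          using Cv(3)[of z] z 1 by (simp add: dist_norm)
        also have "\<dots> \<le> Cv * (1 + E z)" using Cv(2) \<Phi>0(3,4)[of z] by (intro mult_left_mono) (auto simp: E_def)
        finally show ?thesis .
      qed
      then show ?thesis using Cv(1) by blast
    next
      case 2
      have "norm (edge_part z) \<le> Cw * (1 + E z)" if z: "dist z z0 < ew" "n \<bullet> z < b" for z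
      proof -
        have "norm (edge_part z) \<le> Cw * (1 + indicator P z * norm (f z) + W.\<Phi> c z + W.\<Phi> q' z)"
          using Cw(3)[of z] z 2 S[OF z(2)] by (simp add: dist_norm)
        also have "\<dots> \<le> Cw * (1 + E z)" using Cw(2) \<Phi>0(1,2)[of z] by (intro mult_left_mono) (auto simp: E_def)
        finally show ?thesis .
      qed
      then show ?thesis using Cw(1) by blast
    next
      case 3
      then obtain \<epsilon> C where \<epsilon>: "0 < \<epsilon>" "0 \<le> C"
        "\<And>z. norm (z - z0) < \<epsilon> \<Longrightarrow> n \<bullet> z < b \<Longrightarrow> norm (edge_part z) \<le> C * (1 + indicator P z * norm (f z))"
        using edge_part_near_line by blast
      have "norm (edge_part z) \<le> C * (1 + E z)" if z: "dist z z0 < \<epsilon>" "n \<bullet> z < b" for z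
      proof -
        have "norm (edge_part z) \<le> C * (1 + indicator P z * norm (f z))"
          using \<epsilon>(3)[of z] z by (simp add: dist_norm)
        also have "\<dots> \<le> C * (1 + E z)" using \<epsilon>(2) \<Phi>0(1-4)[of z] by (intro mult_left_mono) (auto simp: E_def)
        finally show ?thesis .
      qed
      then show ?thesis using \<epsilon>(1) by blast
    next
      case 4
      have "isCont edge_part z0"
        using continuous_on_eq_continuous_at[OF openH, THEN iffD1, OF holomorphic_on_imp_continuous_on[OF edge_part_holomorphic]] 4 by simp
      then obtain \<epsilon> C where \<epsilon>: "0 < \<epsilon>" "0 \<le> C" "\<And>z. norm (z - z0) < \<epsilon> \<Longrightarrow> norm (edge_part z) \<le> C"
        using isCont_locally_bounded by blast
      have "norm (edge_part z) \<le> C * (1 + E z)" if z: "dist z z0 < \<epsilon>" for z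
        using \<epsilon>(3)[of z] z mult_left_mono[of 1 "1 + E z" C] E0[of z] \<epsilon>(2) by (simp add: dist_norm)
      then show ?thesis using \<epsilon>(1) by blast
    qed
  qed
  have "compact T" by (intro finite_imp_compact_convex_hull) simp
  then obtain RT where RT: "\<And>x. x \<in> T \<Longrightarrow> norm x \<le> RT" using compact_imp_bounded[of T] by (auto simp: bounded_iff)
  \<comment> \<open>Outside this disc \<open>z\<close> avoids \<open>T\<close> and is far enough
    from both \<open>v\<close> and \<open>w\<close> for \<open>J_far\<close>.\<close>
  define R where "R = max RT (max (norm v + (2 * norm (c - v) + 1)) (norm w + (2 * norm (c - w) + 1)))"
  obtain C1 where C1: "0 \<le> C1" "\<And>z. n \<bullet> z < b \<Longrightarrow> 2 * norm (c - v) + 1 \<le> norm (z - v) \<Longrightarrow> norm (V.J c z) \<le> C1 * V.\<Phi> c z"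
    using V.J_far[OF c] by blast
  obtain C2 where C2: "0 \<le> C2" "\<And>z. n \<bullet> z < b \<Longrightarrow> 2 * norm (c - w) + 1 \<le> norm (z - w) \<Longrightarrow> norm (W.J c z) \<le> C2 * W.\<Phi> c z"
    using W.J_far[OF c] by blast
  have "compact (cball 0 R \<inter> {z. n \<bullet> z \<le> b})" by (intro compact_Int_closed closed_halfspace_le) simp
  then obtain C3 where C3: "0 \<le> C3" "\<And>z. z \<in> cball 0 R \<inter> {z. n \<bullet> z \<le> b} \<Longrightarrow> n \<bullet> z < b \<longrightarrow> norm (edge_part z) \<le> C3 * (1 + E z)"
  proof (rule compact_uniform_bound[where Q = "\<lambda>C z. n \<bullet> z < b \<longrightarrow> norm (edge_part z) \<le> C * (1 + E z)"])
    fix C C' :: real and z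
    assume *: "n \<bullet> z < b \<longrightarrow> norm (edge_part z) \<le> C * (1 + E z)" "C \<le> C'"
    have "C * (1 + E z) \<le> C' * (1 + E z)" using *(2) E0[of z] by (intro mult_right_mono) auto
    then show "n \<bullet> z < b \<longrightarrow> norm (edge_part z) \<le> C' * (1 + E z)" using *(1) by linarith
  qed (use local in auto)
  define C where "C = C1 + C2 + C3"
  have "norm (edge_part z) \<le> C * (indicator (cball 0 R) z + E z)" if z: "n \<bullet> z < b" for z
  proof (cases "z \<in> cball 0 R")
    case True
    then have "norm (edge_part z) \<le> C3 * (1 + E z)" using C3(2) z by auto
    also have "\<dots> \<le> C * (1 + E z)" using C1(1) C2(1) E0[of z] by (intro mult_right_mono) (auto simp: C_def)
    finally show ?thesis using True by simp
  next
    case False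
    then have zR: "R < norm z" by simp
    then have "z \<notin> T" using RT[of z] by (auto simp: R_def)
    have "norm z \<le> norm (z - v) + norm v" "norm z \<le> norm (z - w) + norm w"
      using norm_triangle_ineq[of "z - v" v] norm_triangle_ineq[of "z - w" w] by auto
    moreover have "norm v + (2 * norm (c - v) + 1) \<le> R" "norm w + (2 * norm (c - w) + 1) \<le> R" by (auto simp: R_def)
    ultimately have "2 * norm (c - v) + 1 \<le> norm (z - v)" "2 * norm (c - w) + 1 \<le> norm (z - w)" using zR by linarith+
    then have J: "norm (V.J c z) \<le> C1 * V.\<Phi> c z" "norm (W.J c z) \<le> C2 * W.\<Phi> c z" using C1 C2 z by auto
    have "norm (edge_part z) \<le> C1 * V.\<Phi> c z + C2 * W.\<Phi> c z"
      unfolding edge_part_outside[OF z \<open>z \<notin> T\<close>] using norm_triangle_ineq4[of "W.J c z" "V.J c z"] J by linarith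
    also have "\<dots> \<le> C * V.\<Phi> c z + C * W.\<Phi> c z"
      using C1(1) C2(1) C3(1) \<Phi>0[of z] by (intro add_mono mult_right_mono) (auto simp: C_def)
    also have "\<dots> = C * (V.\<Phi> c z + W.\<Phi> c z)" by (simp add: distrib_left)
    also have "\<dots> \<le> C * E z"
      using C1(1) C2(1) C3(1) \<Phi>0[of z] by (intro mult_left_mono) (auto simp: C_def E_def)
    finally show ?thesis using False by simp
  qed
  moreover have "0 \<le> C" using C1(1) C2(1) C3(1) by (simp add: C_def)
  moreover have "0 \<le> norm v + (2 * norm (c - v) + 1)" by simp
  then have "0 \<le> R" unfolding R_def by (rule order_trans) simp
  ultimately show ?thesis using that[OF q q', of C R] unfolding E_def add.assoc by blast
qed

lemma edge_part_in_bergman_space: "restrict edge_part {z. n \<bullet> z < b} \<in> bergman_space p {z. n \<bullet> z < b}"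
proof -
  obtain R C q q' where q: "q \<in> P" "q' \<in> P" and C: "0 \<le> C" "0 \<le> R"
    and bound: "\<And>z. n \<bullet> z < b \<Longrightarrow> norm (edge_part z)
      \<le> C * (indicator (cball 0 R) z + indicator P z * norm (f z) + V.\<Phi> c z + V.\<Phi> q z + W.\<Phi> c z + W.\<Phi> q' z)"
    by (rule edge_part_bound) (rule that)
  have p: "0 < p" using V.p by simp
  have ball: "integrable lborel (\<lambda>z::complex. indicator (cball 0 R) z powr p :: real)"
  proof -
    have "(\<lambda>z::complex. indicator (cball 0 R) z powr p :: real) = indicator (cball 0 R)"
      by (auto simp: indicator_def)
    moreover have "emeasure lborel (cball (0::complex) R) < \<infinity>" using C(2) by (simp add: emeasure_cball)
    ultimately show ?thesis by (simp add: integrable_indicator_iff)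
  qed
  have F_meas: "(\<lambda>z. indicator P z * norm (f z)) \<in> borel_measurable borel"
    using borel_measurable_continuous_on_indicator[OF _ continuous_on_norm[OF V.contf]] V.openP by simp
  have F_int: "integrable lborel (\<lambda>z. (indicator P z * norm (f z)) powr p)"
  proof -
    have "(\<lambda>z. (indicator P z * norm (f z)) powr p) = (\<lambda>z. indicator P z *\<^sub>R (norm (f z) powr p))"
      by (auto simp: indicator_def)
    then show ?thesis using V.intf by (simp add: set_integrable_def)
  qed
  note meas = borel_measurable_add borel_measurable_indicator F_meas
    V.\<Phi>_measurable[OF c] V.\<Phi>_measurable[OF q(1)] W.\<Phi>_measurable[OF c] W.\<Phi>_measurable[OF q(2)]
  note nonneg = add_nonneg_nonneg V.\<Phi>_nonneg W.\<Phi>_nonneg mult_nonneg_nonneg indicator_pos_le norm_ge_zero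
  have "integrable lborel (\<lambda>z. (indicator (cball 0 R) z + indicator P z * norm (f z) + V.\<Phi> c z + V.\<Phi> q z + W.\<Phi> c z + W.\<Phi> q' z) powr p)"
    by (intro integrable_powr_add meas nonneg p ball F_int V.\<Phi>_integrable W.\<Phi>_integrable c q) auto
  then show ?thesis
    by (rule bergman_spaceI_bound[OF open_halfspace_lt edge_part_holomorphic p])
      (auto intro!: bound nonneg C)
qed

end

section \<open>Going around the polygon\<close>

lemma bergman_space_measurable:
  assumes f: "f \<in> bergman_space p \<Omega>" and \<Omega>: "open \<Omega>"
  shows "(\<lambda>z. indicator \<Omega> z * norm (f z)) \<in> borel_measurable borel"
  using borel_measurable_continuous_on_indicator[of \<Omega> "\<lambda>z. norm (f z)"] f \<Omega>
  by (auto simp: bergman_space_def intro: continuous_on_norm holomorphic_on_imp_continuous_on)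

lemma bergman_space_integrable:
  assumes f: "f \<in> bergman_space p \<Omega>"
  shows "integrable lborel (\<lambda>z. (indicator \<Omega> z * norm (f z)) powr p)"
proof -
  have "(\<lambda>z. (indicator \<Omega> z * norm (f z)) powr p) = (\<lambda>z. indicator \<Omega> z *\<^sub>R (norm (f z) powr p))"
    by (auto simp: indicator_def)
  then show ?thesis using f by (simp add: bergman_space_def set_integrable_def)
qed

lemma bergman_space_add:
  assumes f: "f \<in> bergman_space p \<Omega>" and g: "g \<in> bergman_space p \<Omega>" and \<Omega>: "open \<Omega>" and p: "0 < p"
  shows "restrict (\<lambda>z. f z + g z) \<Omega> \<in> bergman_space p \<Omega>"
proof (rule bergman_spaceI_bound[OF \<Omega> _ p, where C = 1])
  show "(\<lambda>z. f z + g z) holomorphic_on \<Omega>" using f g by (intro holomorphic_intros) (auto simp: bergman_space_def)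
  show "integrable lborel (\<lambda>z. (indicator \<Omega> z * norm (f z) + indicator \<Omega> z * norm (g z)) powr p)"
    by (intro integrable_powr_add bergman_space_measurable[OF f \<Omega>] bergman_space_measurable[OF g \<Omega>]
        bergman_space_integrable[OF f] bergman_space_integrable[OF g] p) auto
  show "norm (f z + g z) \<le> 1 * (indicator \<Omega> z * norm (f z) + indicator \<Omega> z * norm (g z))" if "z \<in> \<Omega>" for z
    using that norm_triangle_ineq by simp
qed auto

lemma bergman_space_cmult:
  assumes f: "f \<in> bergman_space p \<Omega>" and \<Omega>: "open \<Omega>" and p: "0 < p"
  shows "restrict (\<lambda>z. a * f z) \<Omega> \<in> bergman_space p \<Omega>"
proof (rule bergman_spaceI_bound[OF \<Omega> _ p bergman_space_integrable[OF f], where C = "norm a"])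
  show "(\<lambda>z. a * f z) holomorphic_on \<Omega>" using f by (intro holomorphic_intros) (auto simp: bergman_space_def)
qed (auto simp: norm_mult)

lemma bergman_space_restrict:
  assumes f: "f \<in> bergman_space p \<Omega>" and \<Omega>: "open \<Omega>'" "\<Omega>' \<subseteq> \<Omega>" and p: "0 < p"
  shows "restrict f \<Omega>' \<in> bergman_space p \<Omega>'"
proof (rule bergman_spaceI_bound[OF \<Omega>(1) _ p bergman_space_integrable[OF f], where C = 1])
  show "f holomorphic_on \<Omega>'" using f \<Omega> by (auto simp: bergman_space_def intro: holomorphic_on_subset)
qed (use \<Omega> in auto)

lemma bergman_space_zero: "restrict (\<lambda>z. 0) \<Omega> \<in> bergman_space p \<Omega>"
proof -
  have "restrict (\<lambda>z. 0) \<Omega> holomorphic_on \<Omega>"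
    by (rule holomorphic_transform[of "\<lambda>z. 0"]) auto
  moreover have "set_integrable lborel \<Omega> (\<lambda>z. norm (restrict (\<lambda>z. 0 :: complex) \<Omega> z) powr p)"
    by (subst set_integrable_cong[OF refl refl, of _ _ "\<lambda>z. 0"]) (auto simp: set_integrable_def)
  ultimately show ?thesis by (simp add: bergman_space_def)
qed

lemma bergman_space_sum:
  assumes "finite I" and "\<And>k. k \<in> I \<Longrightarrow> f k \<in> bergman_space p \<Omega>" and "open \<Omega>" and "0 < p"
  shows "restrict (\<lambda>z. \<Sum>k\<in>I. f k z) \<Omega> \<in> bergman_space p \<Omega>"
  using assms(1,2)
proof (induction I)
  case empty
  show ?case by (simp only: sum.empty bergman_space_zero)
next
  case (insert i I)
  have "restrict (\<lambda>z. f i z + restrict (\<lambda>z. \<Sum>k\<in>I. f k z) \<Omega> z) \<Omega> \<in> bergman_space p \<Omega>"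
    using insert assms(3,4) by (intro bergman_space_add) auto
  also have "restrict (\<lambda>z. f i z + restrict (\<lambda>z. \<Sum>k\<in>I. f k z) \<Omega> z) \<Omega> = restrict (\<lambda>z. \<Sum>k\<in>insert i I. f k z) \<Omega>"
    using insert by (auto simp: restrict_def)
  finally show ?case .
qed

section \<open>Which side is met just after a given direction\<close>

text \<open>The sign is that of \<open>A\<close> by continuity, and that of \<open>B\<close> when
  \<open>A = 0\<close>. Two functions of this form therefore have a definite order immediately to
  the right of 0.\<close>

lemma trig_sign_near_zero:
  fixes A B :: real
  shows "\<exists>d>0. (\<forall>t. 0 \<le> t \<and> t \<le> d \<longrightarrow> 0 \<le> A * cos t + B * sin t) \<or> (\<forall>t. 0 \<le> t \<and> t \<le> d \<longrightarrow> A * cos t + B * sin t \<le> 0)"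
proof -
  have cont: "isCont (\<lambda>t. A * cos t + B * sin t) 0" by (intro continuous_intros)
  show ?thesis
  proof (cases "A = 0")
    case True
    have "0 \<le> sin t" if "0 \<le> t \<and> t \<le> pi" for t using that sin_ge_zero by blast
    then show ?thesis using True
      by (intro exI[of _ pi]) (cases "0 \<le> B", auto simp: mult_nonpos_nonneg)
  next
    case False
    then obtain d where d: "d > 0" "\<And>t. dist t 0 < d \<Longrightarrow> dist (A * cos t + B * sin t) (A * cos 0 + B * sin 0) < \<bar>A\<bar>"
      using cont unfolding continuous_at_eps_delta by (metis zero_less_abs_iff)
    have *: "\<bar>A * cos t + B * sin t - A\<bar> < \<bar>A\<bar>" if "0 \<le> t \<and> t \<le> d / 2" for t
      using d(2)[of t] d(1) that by (simp add: dist_real_def)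
    show ?thesis
    proof (cases "A > 0")
      case True
      then have "0 \<le> A * cos t + B * sin t" if "0 \<le> t \<and> t \<le> d / 2" for t using *[OF that] by linarith
      then show ?thesis using d(1) by (intro exI[of _ "d / 2"]) auto
    next
      case False
      then have "A * cos t + B * sin t \<le> 0" if "0 \<le> t \<and> t \<le> d / 2" for t using *[OF that] by linarith
      then show ?thesis using d(1) by (intro exI[of _ "d / 2"]) auto
    qed
  qed
qed

text \<open>Applied to the values \<open>\<nu> k \<bullet> cis (x + t)\<close> as functions of
  \<open>t\<close>, it says that rays from \<open>c\<close> with direction just after
  \<open>x\<close> all leave the polygon through one side. The induction keeps the current maximum
  or replaces it by the new candidate.\<close>

lemma trig_dominant_near_zero:
  fixes A B :: "'i \<Rightarrow> real"
  assumes "finite I" "I \<noteq> {}"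
  shows "\<exists>k\<in>I. \<exists>d>0. \<forall>t. 0 \<le> t \<and> t \<le> d \<longrightarrow> (\<forall>j\<in>I. A j * cos t + B j * sin t \<le> A k * cos t + B k * sin t)"
  using assms
proof (induction I rule: finite_ne_induct)
  case (singleton x)
  then show ?case by (auto intro: exI[of _ 1])
next
  case (insert i I)
  then obtain k d where k: "k \<in> I" "d > 0"
    and kd: "\<And>t j. 0 \<le> t \<Longrightarrow> t \<le> d \<Longrightarrow> j \<in> I \<Longrightarrow> A j * cos t + B j * sin t \<le> A k * cos t + B k * sin t" by blast
  obtain d' where d': "d' > 0"
    and or: "(\<forall>t. 0 \<le> t \<and> t \<le> d' \<longrightarrow> 0 \<le> (A k - A i) * cos t + (B k - B i) * sin t)
      \<or> (\<forall>t. 0 \<le> t \<and> t \<le> d' \<longrightarrow> (A k - A i) * cos t + (B k - B i) * sin t \<le> 0)"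
    using trig_sign_near_zero by blast
  from or show ?case
  proof
    assume *: "\<forall>t. 0 \<le> t \<and> t \<le> d' \<longrightarrow> 0 \<le> (A k - A i) * cos t + (B k - B i) * sin t"
    have "A j * cos t + B j * sin t \<le> A k * cos t + B k * sin t"
      if "0 \<le> t \<and> t \<le> min d d'" "j \<in> insert i I" for t j
      using that kd[of t j] *[rule_format, of t] by (cases "j = i") (auto simp: left_diff_distrib)
    then show ?thesis using k d' by (intro bexI[of _ k] exI[of _ "min d d'"]) auto
  next
    assume *: "\<forall>t. 0 \<le> t \<and> t \<le> d' \<longrightarrow> (A k - A i) * cos t + (B k - B i) * sin t \<le> 0"
    have ki: "A k * cos t + B k * sin t \<le> A i * cos t + B i * sin t" if "0 \<le> t \<and> t \<le> min d d'" for t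
      using that *[rule_format, of t] by (auto simp: left_diff_distrib)
    have "A j * cos t + B j * sin t \<le> A i * cos t + B i * sin t"
      if "0 \<le> t \<and> t \<le> min d d'" "j \<in> insert i I" for t j
      using that kd[of t j] ki[of t] by (cases "j = i") auto
    then show ?thesis using k d' by (intro bexI[of _ i] exI[of _ "min d d'"]) auto
  qed
qed

section \<open>The boundary parametrised by the angle at c\<close>

locale bergman_polygon =
  fixes p :: real and I :: "'i set" and \<nu> :: "'i \<Rightarrow> complex" and c :: complex and P :: "complex set"
    and f :: "complex \<Rightarrow> complex"
  assumes p: "1 < p" and I: "finite I" and P_def: "P = {z. \<forall>k\<in>I. \<nu> k \<bullet> (z - c) < 1}"
    and bdd: "bounded P" and f: "f \<in> bergman_space p P"
begin

definition H :: "'i \<Rightarrow> complex set" where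
  "H k = {z. \<nu> k \<bullet> z < 1 + \<nu> k \<bullet> c}"

text \<open>The gauge of \<open>P\<close> about \<open>c\<close> in direction
  \<open>cis \<theta>\<close>: all half planes being normalised to level 1,
  \<open>1 / m \<theta>\<close> is the distance from \<open>c\<close> to the boundary.\<close>

definition m :: "real \<Rightarrow> real" where
  "m \<theta> = Max ((\<lambda>k. \<nu> k \<bullet> cis \<theta>) ` I)"

text \<open>The boundary point seen from \<open>c\<close> at angle \<open>\<theta>\<close>; despite
  the name it may lie in the middle of a side.\<close>

definition vtx :: "real \<Rightarrow> complex" where
  "vtx \<theta> = c + (1 / m \<theta>) *\<^sub>R cis \<theta>"

lemma P_eq: "P = (\<Inter>k\<in>I. H k)"
  by (auto simp: P_def H_def inner_diff_right diff_less_eq)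

lemma openH: "open (H k)"
  unfolding H_def by (rule open_halfspace_lt)

lemma openP: "open P"
  unfolding P_eq using I openH by blast

lemma convexP: "convex P"
  unfolding P_eq H_def by (intro convex_INT convex_halfspace_lt)

lemma c_in: "c \<in> P"
  by (simp add: P_def)

text \<open>If no \<open>\<nu> k\<close> had a positive product with \<open>cis \<theta>\<close>,
  the whole ray from \<open>c\<close> in this direction would lie in \<open>P\<close>, against
  boundedness.\<close>

lemma m_pos: "0 < m \<theta>" and I_nonempty: "I \<noteq> {}"
proof -
  have "\<exists>k\<in>I. 0 < \<nu> k \<bullet> cis \<theta>" for \<theta>
  proof (rule ccontr)
    assume "\<not> (\<exists>k\<in>I. 0 < \<nu> k \<bullet> cis \<theta>)"
    then have le: "\<nu> k \<bullet> cis \<theta> \<le> 0" if "k \<in> I" for k using that by force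
    have ray: "c + t *\<^sub>R cis \<theta> \<in> P" if "0 \<le> t" for t
    proof -
      have "t * (\<nu> k \<bullet> cis \<theta>) < 1" if "k \<in> I" for k
        using mult_nonneg_nonpos[OF \<open>0 \<le> t\<close> le[OF that]] by linarith
      then show ?thesis by (simp add: P_def)
    qed
    obtain B where B: "\<And>z. z \<in> P \<Longrightarrow> norm z \<le> B" using bdd by (auto simp: bounded_iff)
    define t where "t = \<bar>B\<bar> + norm c + 1"
    have "norm (t *\<^sub>R cis \<theta>) \<le> norm (c + t *\<^sub>R cis \<theta>) + norm c"
      using norm_triangle_ineq4[of "c + t *\<^sub>R cis \<theta>" c] by simp
    then have "t \<le> B + norm c" using B[OF ray[of t]] by (simp add: t_def)
    then show False by (simp add: t_def)
  qed
  then obtain k where k: "k \<in> I" "0 < \<nu> k \<bullet> cis \<theta>" by blast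
  have "\<nu> k \<bullet> cis \<theta> \<le> m \<theta>" unfolding m_def using I k by (intro Max_ge) auto
  then show "0 < m \<theta>" using k by linarith
  show "I \<noteq> {}" using k by blast
qed

definition active :: "'i \<Rightarrow> real \<Rightarrow> bool" where
  "active k \<theta> \<longleftrightarrow> k \<in> I \<and> \<nu> k \<bullet> cis \<theta> = m \<theta>"

lemma m_ge: "k \<in> I \<Longrightarrow> \<nu> k \<bullet> cis \<theta> \<le> m \<theta>"
  unfolding m_def using I by (intro Max_ge) auto

lemma activeI:
  assumes "k \<in> I" "\<And>j. j \<in> I \<Longrightarrow> \<nu> j \<bullet> cis \<theta> \<le> \<nu> k \<bullet> cis \<theta>"
  shows "active k \<theta>"
  unfolding active_def m_def using assms I by (auto intro!: Max_eqI[symmetric])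

lemma ex_active: "\<exists>k. active k \<theta>"
proof -
  have "m \<theta> \<in> (\<lambda>k. \<nu> k \<bullet> cis \<theta>) ` I" unfolding m_def using I I_nonempty by (intro Max_in) auto
  then show ?thesis by (auto simp: active_def)
qed

lemma vtx_line: "active k \<theta> \<Longrightarrow> \<nu> k \<bullet> vtx \<theta> = 1 + \<nu> k \<bullet> c"
  using m_pos[of \<theta>] by (simp add: active_def vtx_def inner_add_right)

lemma vtx_notin: "vtx \<theta> \<notin> P"
proof -
  obtain k where "active k \<theta>" using ex_active by blast
  then show ?thesis using vtx_line by (force simp: P_eq H_def active_def)
qed

lemma vtx_closure: "vtx \<theta> \<in> closure P"
proof -
  have "(\<lambda>i. c + ((1 - 1 / real (Suc i)) * (1 / m \<theta>)) *\<^sub>R cis \<theta>) \<longlonglongrightarrow> c + ((1 - 0) * (1 / m \<theta>)) *\<^sub>R cis \<theta>"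
    using LIMSEQ_inverse_real_of_nat by (intro tendsto_intros) (simp add: inverse_eq_divide)
  moreover have "c + ((1 - 1 / real (Suc i)) * (1 / m \<theta>)) *\<^sub>R cis \<theta> \<in> P" for i
  proof -
    have "(1 - 1 / real (Suc i)) * (1 / m \<theta>) * (\<nu> k \<bullet> cis \<theta>) < 1" if "k \<in> I" for k
    proof -
      have "(1 - 1 / real (Suc i)) * (1 / m \<theta>) * (\<nu> k \<bullet> cis \<theta>) \<le> (1 - 1 / real (Suc i)) * (1 / m \<theta>) * m \<theta>"
        using m_pos[of \<theta>] m_ge[OF that] by (intro mult_left_mono) (auto intro!: mult_nonneg_nonneg)
      also have "\<dots> = 1 - 1 / real (Suc i)" using m_pos[of \<theta>] by simp
      also have "\<dots> < 1" by simp
      finally show ?thesis .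
    qed
    then show ?thesis by (simp add: P_def)
  qed
  then have "c + ((1 - 1 / real (Suc i)) * (1 / m \<theta>)) *\<^sub>R cis \<theta> \<in> closure P" for i
    using closure_subset by blast
  ultimately have "c + ((1 - 0) * (1 / m \<theta>)) *\<^sub>R cis \<theta> \<in> closure P"
    by (rule closed_sequentially[OF closed_closure, rotated])
  then show ?thesis by (simp add: vtx_def)
qed

abbreviation "N \<theta> \<equiv> bergman_corner.N f (vtx \<theta>) c"

text \<open>In \<open>arc\<close>, \<open>\<Lambda>\<close> is the branch of the logarithm of \<open>(vtx \<beta> - z) / (vtx \<alpha> - z)\<close> fixed by its value
  at \<open>c\<close>; its imaginary part there records the angle swept out.\<close>

definition arc :: "real \<Rightarrow> real \<Rightarrow> bool" where
  "arc \<alpha> \<beta> \<longleftrightarrow> (\<exists>h \<Lambda>. (\<forall>k\<in>I. h k \<in> bergman_space p (H k)) \<and> continuous_on P \<Lambda>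
    \<and> (\<forall>z\<in>P. exp (\<Lambda> z) = (vtx \<beta> - z) / (vtx \<alpha> - z)) \<and> \<Lambda> c = Complex (ln (m \<alpha> / m \<beta>)) (\<beta> - \<alpha>)
    \<and> (\<forall>z\<in>P. (\<Sum>k\<in>I. h k z) = f z * \<Lambda> z - N \<alpha> z + N \<beta> z))"

lemma vtx_ne: "z \<in> P \<Longrightarrow> vtx \<theta> - z \<noteq> 0"
  using vtx_notin by auto

lemma arc_refl: "arc \<alpha> \<alpha>"
  unfolding arc_def
proof (intro exI conjI ballI)
  show "restrict (\<lambda>z. 0) (H k) \<in> bergman_space p (H k)" for k by (rule bergman_space_zero)
  show "continuous_on P (\<lambda>z. 0)" by (rule continuous_on_const)
  show "0 = Complex (ln (m \<alpha> / m \<alpha>)) (\<alpha> - \<alpha>)" using m_pos[of \<alpha>] by (simp add: complex_eq_iff)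
  fix z assume z: "z \<in> P"
  then show "exp 0 = (vtx \<alpha> - z) / (vtx \<alpha> - z)" using vtx_ne by simp
  have "(\<Sum>k\<in>I. restrict (\<lambda>z. 0) (H k) z) = (0::complex)"
    using z by (intro sum.neutral) (auto simp: P_eq)
  then show "(\<Sum>k\<in>I. restrict (\<lambda>z. 0) (H k) z) = f z * 0 - N \<alpha> z + N \<alpha> z" by simp
qed

text \<open>Adding the two decompositions cancels \<open>N \<beta>\<close>. The branches are added
  rather than recomputed from the quotient, so the imaginary part at \<open>c\<close> can grow
  beyond pi.\<close>

lemma arc_trans:
  assumes "arc \<alpha> \<beta>" "arc \<beta> \<gamma>" shows "arc \<alpha> \<gamma>"
proof -
  obtain h1 L1 where 1: "\<forall>k\<in>I. h1 k \<in> bergman_space p (H k)" "continuous_on P L1"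
    "\<forall>z\<in>P. exp (L1 z) = (vtx \<beta> - z) / (vtx \<alpha> - z)" "L1 c = Complex (ln (m \<alpha> / m \<beta>)) (\<beta> - \<alpha>)"
    "\<forall>z\<in>P. (\<Sum>k\<in>I. h1 k z) = f z * L1 z - N \<alpha> z + N \<beta> z"
    using assms(1) unfolding arc_def by blast
  obtain h2 L2 where 2: "\<forall>k\<in>I. h2 k \<in> bergman_space p (H k)" "continuous_on P L2"
    "\<forall>z\<in>P. exp (L2 z) = (vtx \<gamma> - z) / (vtx \<beta> - z)" "L2 c = Complex (ln (m \<beta> / m \<gamma>)) (\<gamma> - \<beta>)"
    "\<forall>z\<in>P. (\<Sum>k\<in>I. h2 k z) = f z * L2 z - N \<beta> z + N \<gamma> z"
    using assms(2) unfolding arc_def by blast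
  define h where "h k = restrict (\<lambda>z. h1 k z + h2 k z) (H k)" for k
  have h: "\<forall>k\<in>I. h k \<in> bergman_space p (H k)"
    unfolding h_def using 1(1) 2(1) openH p by (intro ballI bergman_space_add) auto
  have cont: "continuous_on P (\<lambda>z. L1 z + L2 z)" using 1(2) 2(2) by (rule continuous_on_add)
  have ex: "\<forall>z\<in>P. exp (L1 z + L2 z) = (vtx \<gamma> - z) / (vtx \<alpha> - z)"
    using 1(3) 2(3) vtx_ne[of _ \<beta>] by (auto simp: exp_add)
  have ctr: "L1 c + L2 c = Complex (ln (m \<alpha> / m \<gamma>)) (\<gamma> - \<alpha>)"
    using 1(4) 2(4) m_pos[of \<alpha>] m_pos[of \<beta>] m_pos[of \<gamma>] by (simp add: complex_eq_iff ln_div)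
  have sum: "\<forall>z\<in>P. (\<Sum>k\<in>I. h k z) = f z * (L1 z + L2 z) - N \<alpha> z + N \<gamma> z"
  proof
    fix z assume z: "z \<in> P"
    have "(\<Sum>k\<in>I. h k z) = (\<Sum>k\<in>I. h1 k z + h2 k z)"
      using z by (intro sum.cong) (auto simp: h_def P_eq)
    then show "(\<Sum>k\<in>I. h k z) = f z * (L1 z + L2 z) - N \<alpha> z + N \<gamma> z"
      using 1(5) 2(5) z by (simp add: sum.distrib algebra_simps)
  qed
  show ?thesis unfolding arc_def using h cont ex ctr sum by blast
qed

lemma corner: "active k \<theta> \<Longrightarrow> bergman_corner_half_plane p P f (vtx \<theta>) (\<nu> k) (1 + \<nu> k \<bullet> c)"
proof
  assume k: "active k \<theta>"
  show "f holomorphic_on P" "set_integrable lborel P (\<lambda>z. norm (f z) powr p)"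
    using f by (auto simp: bergman_space_def)
  show "\<nu> k \<bullet> z < 1 + \<nu> k \<bullet> c" if "z \<in> P" for z using that k by (auto simp: P_eq H_def active_def)
  show "\<nu> k \<bullet> vtx \<theta> = 1 + \<nu> k \<bullet> c" using k by (rule vtx_line)
qed (use p openP convexP vtx_closure vtx_notin in auto)

lemma vtx_quotient: "(vtx \<beta> - c) / (vtx \<alpha> - c) = of_real (m \<alpha> / m \<beta>) * cis (\<beta> - \<alpha>)"
  using m_pos[of \<alpha>] m_pos[of \<beta>] by (simp add: vtx_def scaleR_conv_of_real cis_divide[symmetric] field_simps)

text \<open>For an angle below pi the principal branch at \<open>c\<close> has imaginary part
  exactly \<open>\<beta> - \<alpha>\<close>, and distinct angles give distinct points, so
  \<open>edge_part\<close> is available. All summands other than that of \<open>H k\<close> are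
  zero.\<close>

lemma arc_edge:
  assumes k: "active k \<alpha>" "active k \<beta>" and ab: "\<alpha> \<le> \<beta>" "\<beta> < \<alpha> + pi"
  shows "arc \<alpha> \<beta>"
proof (cases "\<alpha> = \<beta>")
  case True then show ?thesis using arc_refl by simp
next
  case False
  have kI: "k \<in> I" using k by (simp add: active_def)
  have ne: "vtx \<alpha> \<noteq> vtx \<beta>"
  proof
    assume "vtx \<alpha> = vtx \<beta>"
    then have "of_real (m \<alpha> / m \<beta>) * cis (\<beta> - \<alpha>) = 1" using vtx_quotient[of \<beta> \<alpha>] vtx_ne[OF c_in] by simp
    then have "Im (of_real (m \<alpha> / m \<beta>) * cis (\<beta> - \<alpha>)) = 0" by simp
    then have "m \<alpha> / m \<beta> * sin (\<beta> - \<alpha>) = 0" by simp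
    moreover have "0 < sin (\<beta> - \<alpha>)" using ab False by (intro sin_gt_zero) auto
    ultimately show False using m_pos[of \<alpha>] m_pos[of \<beta>] by simp
  qed
  interpret E: bergman_edge p P f "vtx \<alpha>" "vtx \<beta>" "\<nu> k" "1 + \<nu> k \<bullet> c" c
    by (intro bergman_edge.intro bergman_edge_axioms.intro corner k c_in ne)
  define h where "h j = (if j = k then restrict E.edge_part (H k) else restrict (\<lambda>z. 0) (H j))" for j
  define \<Lambda> where "\<Lambda> z = Ln ((vtx \<beta> - z) / (vtx \<alpha> - z))" for z
  have "\<forall>j\<in>I. h j \<in> bergman_space p (H j)"
    using E.edge_part_in_bergman_space bergman_space_zero by (simp add: h_def H_def)
  moreover have "continuous_on P \<Lambda>"
    unfolding \<Lambda>_def using E.quotient_off_slit E.V.P_sub vtx_ne by (intro continuous_intros) auto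
  moreover have "exp (\<Lambda> z) = (vtx \<beta> - z) / (vtx \<alpha> - z)" if "z \<in> P" for z
    unfolding \<Lambda>_def using vtx_ne[OF that] by simp
  moreover have "\<Lambda> c = Complex (ln (m \<alpha> / m \<beta>)) (\<beta> - \<alpha>)"
    unfolding \<Lambda>_def
  proof (rule Ln_unique)
    have r: "0 < m \<alpha> / m \<beta>" using m_pos[of \<alpha>] m_pos[of \<beta>] by simp
    show "exp (Complex (ln (m \<alpha> / m \<beta>)) (\<beta> - \<alpha>)) = (vtx \<beta> - c) / (vtx \<alpha> - c)"
      unfolding vtx_quotient using r by (simp add: exp_eq_polar)
  qed (use ab in auto)
  moreover have "(\<Sum>j\<in>I. h j z) = f z * \<Lambda> z - N \<alpha> z + N \<beta> z" if z: "z \<in> P" for z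
  proof -
    have "(\<Sum>j\<in>I. h j z) = (\<Sum>j\<in>I. if j = k then E.edge_part z else 0)"
      using z by (intro sum.cong) (auto simp: h_def P_eq)
    also have "\<dots> = E.edge_part z" using I kI by simp
    finally show ?thesis using z by (simp add: E.edge_part_def \<Lambda>_def)
  qed
  ultimately show ?thesis unfolding arc_def by blast
qed

text \<open>The active side may change at \<open>x\<close>, so the two one-sided neighbourhoods are
  treated separately and joined at \<open>x\<close>; the left one is reduced to the right one by
  reversing the sine coefficients. The radius is kept below pi to meet the condition of
  \<open>arc_edge\<close>.\<close>

lemma arc_local: "\<exists>d>0. \<forall>\<alpha> \<beta>. \<alpha> \<le> x \<and> x \<le> \<beta> \<and> \<beta> - \<alpha> < d \<longrightarrow> arc \<alpha> \<beta>"
proof -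
  define A where "A k = \<nu> k \<bullet> cis x" for k
  define B where "B k = \<nu> k \<bullet> (\<i> * cis x)" for k
  have cis: "\<nu> k \<bullet> cis (x + t) = A k * cos t + B k * sin t" for k t
    by (simp add: A_def B_def inner_complex_def cos_add sin_add algebra_simps)
  obtain k d where k: "k \<in> I" "0 < d"
    "\<And>t j. 0 \<le> t \<Longrightarrow> t \<le> d \<Longrightarrow> j \<in> I \<Longrightarrow> A j * cos t + B j * sin t \<le> A k * cos t + B k * sin t"
    using trig_dominant_near_zero[OF I I_nonempty, of A B] by blast
  have right: "active k (x + t)" if "0 \<le> t" "t \<le> d" for t
    using k(1) k(3)[OF that] by (intro activeI) (auto simp: cis)
  obtain k' d' where k': "k' \<in> I" "0 < d'"
    "\<And>t j. 0 \<le> t \<Longrightarrow> t \<le> d' \<Longrightarrow> j \<in> I \<Longrightarrow> A j * cos t + - B j * sin t \<le> A k' * cos t + - B k' * sin t"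
    using trig_dominant_near_zero[OF I I_nonempty, of A "\<lambda>j. - B j"] by blast
  have left: "active k' (x + - t)" if "0 \<le> t" "t \<le> d'" for t
    unfolding cis using k'(1) k'(3)[OF that] by (intro activeI) (auto simp only: cis cos_minus sin_minus mult_minus_right mult_minus_left)
  have "arc \<alpha> \<beta>" if "\<alpha> \<le> x \<and> x \<le> \<beta> \<and> \<beta> - \<alpha> < min pi (min d d')" for \<alpha> \<beta>
  proof (rule arc_trans)
    show "arc \<alpha> x" using left[of "x - \<alpha>"] left[of 0] that k' by (intro arc_edge[of k']) auto
    show "arc x \<beta>" using right[of "\<beta> - x"] right[of 0] that k by (intro arc_edge[of k]) auto
  qed
  moreover have "0 < min pi (min d d')" using k k' by simp
  ultimately show ?thesis by blast
qed

text \<open>Bisection passes from short arcs to a full turn. Its end points coincide, so the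
  \<open>N\<close> terms cancel and \<open>exp (\<Lambda> z) = 1\<close>; the branch is then
  constant, and its value at \<open>c\<close> records exactly one turn. Dividing by it isolates
  \<open>f\<close>.\<close>

lemma bergman_decomposition: "\<exists>g. (\<forall>k\<in>I. g k \<in> bergman_space p (H k)) \<and> (\<forall>z\<in>P. f z = (\<Sum>k\<in>I. g k z))"
proof -
  have "arc 0 (2 * pi)"
  proof (rule Bolzano)
    show "arc \<alpha> \<gamma>" if "arc \<alpha> \<beta>" "arc \<beta> \<gamma>" for \<alpha> \<beta> \<gamma> using that by (rule arc_trans)
    show "\<exists>d>0. \<forall>\<alpha> \<beta>. \<alpha> \<le> x \<and> x \<le> \<beta> \<and> \<beta> - \<alpha> < d \<longrightarrow> arc \<alpha> \<beta>" for x by (rule arc_local)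
  qed simp
  then obtain h \<Lambda> where h: "\<forall>k\<in>I. h k \<in> bergman_space p (H k)" and cont: "continuous_on P \<Lambda>"
    and ex: "\<forall>z\<in>P. exp (\<Lambda> z) = (vtx (2 * pi) - z) / (vtx 0 - z)" and ctr: "\<Lambda> c = Complex (ln (m 0 / m (2 * pi))) (2 * pi - 0)"
    and sum: "\<forall>z\<in>P. (\<Sum>k\<in>I. h k z) = f z * \<Lambda> z - N 0 z + N (2 * pi) z"
    unfolding arc_def by blast
  have m2: "m (2 * pi) = m 0" by (simp add: m_def cis.code)
  then have v2: "vtx (2 * pi) = vtx 0" by (simp add: vtx_def cis.code)
  have ex1: "exp (\<Lambda> z) = 1" if "z \<in> P" for z using ex that v2 vtx_ne[OF that] by simp
  have "\<Lambda> constant_on P"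
  proof (rule continuous_discrete_range_constant[OF convex_connected[OF convexP] cont])
    fix x assume x: "x \<in> P"
    \<comment> \<open>Distinct logarithms of one number differ by at least 2 * pi, so a continuous
      choice on the connected set \<open>P\<close> cannot vary.\<close>
    have "2 * pi \<le> norm (\<Lambda> y - \<Lambda> x)" if y: "y \<in> P" "\<Lambda> y \<noteq> \<Lambda> x" for y
    proof -
      have "exp (\<Lambda> y) = exp (\<Lambda> x)" using ex1 x y by simp
      then obtain j :: int where j: "\<Lambda> y = \<Lambda> x + of_real (real_of_int (2 * j) * pi) * \<i>" unfolding exp_eq by blast
      then have "j \<noteq> 0" using y by auto
      then have "1 \<le> \<bar>real_of_int j\<bar>" by linarith
      moreover have "norm (\<Lambda> y - \<Lambda> x) = 2 * pi * \<bar>real_of_int j\<bar>" unfolding j by (simp add: norm_mult abs_mult)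
      ultimately show ?thesis by simp
    qed
    then show "\<exists>e>0. \<forall>y. y \<in> P \<and> \<Lambda> y \<noteq> \<Lambda> x \<longrightarrow> e \<le> norm (\<Lambda> y - \<Lambda> x)"
      by (intro exI[of _ "2 * pi"]) auto
  qed
  then have \<Lambda>: "\<Lambda> z = 2 * pi * \<i>" if "z \<in> P" for z
    using that c_in ctr m2 m_pos[of 0] by (auto simp: constant_on_def complex_eq_iff)
  define g where "g k = restrict (\<lambda>z. (1 / (2 * pi * \<i>)) * h k z) (H k)" for k
  have "\<forall>k\<in>I. g k \<in> bergman_space p (H k)"
    unfolding g_def using h openH p by (intro ballI bergman_space_cmult) auto
  moreover have "f z = (\<Sum>k\<in>I. g k z)" if z: "z \<in> P" for z
  proof -
    have "(\<Sum>k\<in>I. g k z) = (\<Sum>k\<in>I. (1 / (2 * pi * \<i>)) * h k z)"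
      using z by (intro sum.cong) (auto simp: g_def P_eq)
    also have "\<dots> = (1 / (2 * pi * \<i>)) * (\<Sum>k\<in>I. h k z)" by (rule sum_distrib_left[symmetric])
    also have "(\<Sum>k\<in>I. h k z) = f z * (2 * pi * \<i>)" using sum z \<Lambda>[OF z] v2 by simp
    finally show ?thesis by simp
  qed
  ultimately show ?thesis by blast
qed

end

section \<open>Normalised half planes and the equality of the two spaces\<close>

text \<open>The slack \<open>b - a \<bullet> c\<close> is positive because \<open>c\<close> lies in
  \<open>H\<close>, so the normal can be divided by it.\<close>

lemma half_plane_normal_form:
  assumes "half_plane H" "c \<in> H"
  shows "\<exists>\<nu>. H = {z. \<nu> \<bullet> (z - c) < 1}"
proof -
  obtain a b where ab: "H = {z. a \<bullet> z < b}" using assms(1) by (auto simp: half_plane_def)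
  define d where "d = b - a \<bullet> c"
  have d: "0 < d" using assms(2) ab by (simp add: d_def)
  have "(a \<bullet> z < b) = (((1 / d) *\<^sub>R a) \<bullet> (z - c) < 1)" for z
    using d by (simp add: inner_diff_right field_simps) (auto simp: d_def)
  then show ?thesis unfolding ab by blast
qed

theorem theorem1p5:
  fixes p :: real and n :: nat and H :: "nat \<Rightarrow> complex set" and P :: "complex set"
  assumes "1 < p"
    and "\<And>k. k \<in> {1..n} \<Longrightarrow> half_plane (H k)"
    and "P = (\<Inter>k\<in>{1..n}. H k)"
    and "P \<noteq> {}"
    and "convex_polygon P"
  shows "bergman_space p P = bergman_sum p {1..n} H"
proof (intro equalityI subsetI)
  have bddP: "bounded P" using assms(5) by (auto simp: convex_polygon_def)
  obtain c where c: "c \<in> P" using assms(4) by blast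
  fix f assume f: "f \<in> bergman_space p P"
  have "\<exists>\<nu>. H k = {z. \<nu> \<bullet> (z - c) < 1}" if "k \<in> {1..n}" for k
    using half_plane_normal_form[OF assms(2)[OF that]] c assms(3) that by blast
  then obtain \<nu> where \<nu>: "\<And>k. k \<in> {1..n} \<Longrightarrow> H k = {z. \<nu> k \<bullet> (z - c) < 1}" by metis
  interpret B: bergman_polygon p "{1..n}" \<nu> c P f
  proof
    show "P = {z. \<forall>k\<in>{1..n}. \<nu> k \<bullet> (z - c) < 1}" unfolding assms(3) using \<nu> by auto
  qed (use assms(1) bddP f in auto)
  have BH: "B.H k = H k" if "k \<in> {1..n}" for k
    using \<nu>[OF that] by (simp add: B.H_def inner_diff_right algebra_simps)
  obtain g where g: "\<forall>k\<in>{1..n}. g k \<in> bergman_space p (B.H k)" "\<forall>z\<in>P. f z = (\<Sum>k\<in>{1..n}. g k z)"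
    using B.bergman_decomposition by blast
  have "f = restrict (\<lambda>z. \<Sum>k\<in>{1..n}. g k z) P"
    using f g(2) by (intro extensionalityI[where A = P]) (auto simp: bergman_space_def)
  then show "f \<in> bergman_sum p {1..n} H"
    unfolding bergman_sum_def assms(3)[symmetric] using g(1) BH by auto
next
  have openP: "open P" using assms(5) by (auto simp: convex_polygon_def)
  fix f assume "f \<in> bergman_sum p {1..n} H"
  then obtain g where g: "\<forall>k\<in>{1..n}. g k \<in> bergman_space p (H k)" and f: "f = restrict (\<lambda>z. \<Sum>k\<in>{1..n}. g k z) P"
    unfolding bergman_sum_def assms(3)[symmetric] by blast
  \<comment> \<open>Restricting each \<open>g k\<close> to \<open>P\<close> first brings all
    summands into a single space, which is closed under sums.\<close>
  have "restrict (\<lambda>z. \<Sum>k\<in>{1..n}. restrict (g k) P z) P \<in> bergman_space p P"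
    using assms(1,3) g openP by (intro bergman_space_sum bergman_space_restrict) auto
  also have "restrict (\<lambda>z. \<Sum>k\<in>{1..n}. restrict (g k) P z) P = f"
    unfolding f by (auto simp: restrict_def)
  finally show "f \<in> bergman_space p P" .
qed

end
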